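(* Let $k$ be a field and let $\Lambda$ be a representation-finite bound path $k$-algebra which is local, i.e. of rank $1$. Then the magnitude of the module category of $\Lambda$ satisfies $\chi(\Lambda\text{-}\mathrm{mod}) = 1$.
   Context: All modules are finitely generated left modules. A bound path $k$-algebra is an algebra $\Lambda=kQ/I$ with $Q$ a finite quiver and $I$ an admissible ideal of the path algebra $kQ$. The rank of $\Lambda$ is the number of isomorphism classes of indecomposable projective $\Lambda$-modules (equivalently $|Q_0|$). A finite-dimensional $k$-algebra is representation-finite if it has only finitely many indecomposable modules up to isomorphism. Magnitude: for a finite-dimensional $k$-algebra $\Gamma$ with indecomposable projective modules $P_1,\dots,P_N$ (up to isomorphism), put $\mathbf{Z}_\Gamma=(\dim_k\mathrm{Hom}_\Gamma(P_i,P_j))_{i,j}$. If $\mathbf{Z}_\Gamma$ is invertible over $\mathbb{Q}$, the magnitude $\chi(\Gamma)$ is the sum of all entries of $\mathbf{Z}_\Gamma^{-1}$. For $\Lambda$ representation-finite with indecomposable modules $M_1,\dots,M_N$ (up to isomorphism), the Auslander algebra is $\mathrm{Aus}(\Lambda)=\mathrm{End}_\Lambda(M_1\oplus\cdots\oplus M_N)$; its matrix is always invertible over $\mathbb{Q}$ (it has finite global dimension), and the magnitude of the module category is $\chi(\Lambda\text{-}\mathrm{mod}):=\chi(\mathrm{Aus}(\Lambda))$. Equivalently, $\chi(\Lambda\text{-}\mathrm{mod})$ is the sum of all entries of the inverse of the matrix $(\dim_k\mathrm{Hom}_\Lambda(M_i,M_j))_{i,j}$. *)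

theory Defs
  imports
    "HOL-Algebra.Ideal_Product"
    "HOL-Algebra.QuotRing"
    "Graph_Theory.Arc_Walk"
    "Jordan_Normal_Form.VS_Connect"
    "Jordan_Normal_Form.Gauss_Jordan_Elimination"
begin

text \<open>
  The ground field is a type \<open>'k\<close> of class \<^class>\<open>field\<close>; \<open>class_ring\<close> is the same field as a
  HOL-Algebra structure. A \<open>'k\<close>-algebra is a record of type \<open>('k, 'a) module\<close>: its ring
  operations are those of the algebra and its \<^const>\<open>module.smult\<close> is the action of \<open>'k\<close>.
\<close>

section \<open>Left modules\<close>

text \<open>
  The locale \<^locale>\<open>module\<close> of HOL-Algebra requires a commutative ring; this is the same
  list of axioms over an arbitrary ring. The fields \<^const>\<open>mult\<close> and \<^const>\<open>one\<close> of a
  record that serves as a module are ignored.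
\<close>

locale left_module = R?: ring R + M?: abelian_group M
    for R :: "('a, 'r) ring_scheme" and M :: "('a, 'm, 's) module_scheme" (structure) +
  assumes smult_closed: "\<lbrakk>a \<in> carrier R; x \<in> carrier M\<rbrakk> \<Longrightarrow> a \<odot>\<^bsub>M\<^esub> x \<in> carrier M"
    and smult_l_distr: "\<lbrakk>a \<in> carrier R; b \<in> carrier R; x \<in> carrier M\<rbrakk> \<Longrightarrow>
      (a \<oplus>\<^bsub>R\<^esub> b) \<odot>\<^bsub>M\<^esub> x = a \<odot>\<^bsub>M\<^esub> x \<oplus>\<^bsub>M\<^esub> b \<odot>\<^bsub>M\<^esub> x"
    and smult_r_distr: "\<lbrakk>a \<in> carrier R; x \<in> carrier M; y \<in> carrier M\<rbrakk> \<Longrightarrow>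
      a \<odot>\<^bsub>M\<^esub> (x \<oplus>\<^bsub>M\<^esub> y) = a \<odot>\<^bsub>M\<^esub> x \<oplus>\<^bsub>M\<^esub> a \<odot>\<^bsub>M\<^esub> y"
    and smult_assoc: "\<lbrakk>a \<in> carrier R; b \<in> carrier R; x \<in> carrier M\<rbrakk> \<Longrightarrow>
      (a \<otimes>\<^bsub>R\<^esub> b) \<odot>\<^bsub>M\<^esub> x = a \<odot>\<^bsub>M\<^esub> (b \<odot>\<^bsub>M\<^esub> x)"
    and smult_one: "x \<in> carrier M \<Longrightarrow> \<one>\<^bsub>R\<^esub> \<odot>\<^bsub>M\<^esub> x = x"

definition fg_module :: "('a, 'r) ring_scheme \<Rightarrow> ('a, 'm) module \<Rightarrow> bool" where
  "fg_module R M \<longleftrightarrow> left_module R M \<and>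
     (\<exists>S. finite S \<and> S \<subseteq> carrier M \<and>
          (\<forall>U. Module.submodule U R M \<and> S \<subseteq> U \<longrightarrow> U = carrier M))"

definition module_iso :: "('a, 'r) ring_scheme \<Rightarrow> ('a, 'm) module \<Rightarrow> ('a, 'n) module \<Rightarrow> bool" where
  "module_iso R M N \<longleftrightarrow> (\<exists>f \<in> module_hom R M N. bij_betw f (carrier M) (carrier N))"

definition indecomposable :: "('a, 'r) ring_scheme \<Rightarrow> ('a, 'm) module \<Rightarrow> bool" where
  "indecomposable R M \<longleftrightarrow> carrier M \<noteq> {\<zero>\<^bsub>M\<^esub>} \<and>
     (\<forall>U V. Module.submodule U R M \<and> Module.submodule V R M \<and>
            U <+>\<^bsub>M\<^esub> V = carrier M \<and> U \<inter> V = {\<zero>\<^bsub>M\<^esub>} \<longrightarrow>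
            U = {\<zero>\<^bsub>M\<^esub>} \<or> V = {\<zero>\<^bsub>M\<^esub>})"

text \<open>
  HOL cannot quantify over modules on all types at once. Over a finite-dimensional
  \<open>'k\<close>-algebra every finitely generated module is a finite-dimensional vector space, hence
  isomorphic to a module whose carrier is a set of functions \<open>nat \<Rightarrow> 'k\<close> (\<open>'k\<^sup>n\<close> being the
  functions that vanish from \<open>n\<close> on). So the finitely generated modules whose elements have this
  type represent all isomorphism classes. The carrier is not required to be of the form \<open>'k\<^sup>n\<close>,
  nor the addition to be pointwise.
\<close>

type_synonym ('k, 'a) coord_module = "('a, nat \<Rightarrow> 'k) module"

text \<open>Projectivity in the category of finitely generated modules.\<close>

definition projective :: "('k::field, 'a) module \<Rightarrow> ('k, 'a) coord_module \<Rightarrow> bool" where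
  "projective A P \<longleftrightarrow>
     (\<forall>(M :: ('k, 'a) coord_module) (N :: ('k, 'a) coord_module).
        fg_module A M \<and> fg_module A N \<longrightarrow>
        (\<forall>g \<in> module_hom A M N. \<forall>h \<in> module_hom A P N. g ` carrier M = carrier N \<longrightarrow>
           (\<exists>h' \<in> module_hom A P M. \<forall>x \<in> carrier P. g (h' x) = h x)))"

definition indecomposables :: "('k::field, 'a) module \<Rightarrow> ('k, 'a) coord_module set" where
  "indecomposables A = {M. fg_module A M \<and> indecomposable A M}"

definition indecomposable_projectives ::
    "('k::field, 'a) module \<Rightarrow> ('k, 'a) coord_module set" where
  "indecomposable_projectives A = {P \<in> indecomposables A. projective A P}"

definition iso_classes ::
    "('k::field, 'a) module \<Rightarrow> ('k, 'a) coord_module set \<Rightarrow> ('k, 'a) coord_module set set" where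
  "iso_classes A \<C> = \<C> // {(M, N). M \<in> \<C> \<and> N \<in> \<C> \<and> module_iso A M N}"

definition representation_finite :: "('k::field, 'a) module \<Rightarrow> bool" where
  "representation_finite A \<longleftrightarrow> finite (iso_classes A (indecomposables A))"

definition algebra_rank :: "('k::field, 'a) module \<Rightarrow> nat" where
  "algebra_rank A = card (iso_classes A (indecomposable_projectives A))"

text \<open>The list \<open>Ms\<close> contains exactly one member of every isomorphism class in \<open>\<C>\<close>.\<close>

definition iso_representatives ::
    "('k::field, 'a) module \<Rightarrow> ('k, 'a) coord_module set \<Rightarrow> ('k, 'a) coord_module list \<Rightarrow> bool" where
  "iso_representatives A \<C> Ms \<longleftrightarrow>
     set Ms \<subseteq> \<C> \<and> (\<forall>M \<in> \<C>. \<exists>!i. i < length Ms \<and> module_iso A M (Ms ! i))"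

section \<open>Homomorphism spaces and endomorphism algebras\<close>

text \<open>
  Homomorphisms are made extensional, so that equality of functions is equality of homomorphisms;
  a scalar \<open>c\<close> acts on a left \<open>A\<close>-module as \<open>c \<odot> \<one> \<in> A\<close>. The first definition is only
  used as a vector space, so its \<^const>\<open>mult\<close> and \<^const>\<open>one\<close> are left unspecified.
\<close>

definition hom_space ::
    "('k::field, 'a) module \<Rightarrow> ('a, 'm) module \<Rightarrow> ('a, 'n) module \<Rightarrow> ('k, 'm \<Rightarrow> 'n) module" where
  "hom_space A M N =
     \<lparr>carrier = module_hom A M N \<inter> extensional (carrier M),
      mult = undefined,
      one = undefined,
      zero = (\<lambda>x\<in>carrier M. \<zero>\<^bsub>N\<^esub>),
      add = (\<lambda>f g. \<lambda>x\<in>carrier M. f x \<oplus>\<^bsub>N\<^esub> g x),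
      smult = (\<lambda>c f. \<lambda>x\<in>carrier M. (c \<odot>\<^bsub>A\<^esub> \<one>\<^bsub>A\<^esub>) \<odot>\<^bsub>N\<^esub> f x)\<rparr>"

definition hom_dim ::
    "('k::field, 'a) module \<Rightarrow> ('a, 'm) module \<Rightarrow> ('a, 'n) module \<Rightarrow> nat" where
  "hom_dim A M N = vectorspace.dim class_ring (hom_space A M N)"

definition endomorphism_algebra ::
    "('k::field, 'a) module \<Rightarrow> ('a, 'm) module \<Rightarrow> ('k, 'm \<Rightarrow> 'm) module" where
  "endomorphism_algebra A M =
     (hom_space A M M)\<lparr>mult := compose (carrier M), one := (\<lambda>x\<in>carrier M. x)\<rparr>"

definition direct_sum_module :: "('a, 'm) module list \<Rightarrow> ('a, nat \<Rightarrow> 'm) module" where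
  "direct_sum_module Ms =
     \<lparr>carrier = (\<Pi>\<^sub>E i\<in>{..<length Ms}. carrier (Ms ! i)),
      mult = undefined,
      one = undefined,
      zero = (\<lambda>i\<in>{..<length Ms}. \<zero>\<^bsub>Ms ! i\<^esub>),
      add = (\<lambda>x y. \<lambda>i\<in>{..<length Ms}. x i \<oplus>\<^bsub>Ms ! i\<^esub> y i),
      smult = (\<lambda>a x. \<lambda>i\<in>{..<length Ms}. a \<odot>\<^bsub>Ms ! i\<^esub> x i)\<rparr>"

section \<open>Magnitude\<close>

definition hom_matrix :: "('k::field, 'a) module \<Rightarrow> ('a, 'm) module list \<Rightarrow> rat mat" where
  "hom_matrix A Ms =
     mat (length Ms) (length Ms) (\<lambda>(i, j). of_nat (hom_dim A (Ms ! i) (Ms ! j)))"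

text \<open>
  The magnitude is \<^const>\<open>None\<close> if it is undefined, that is, if there are infinitely many
  indecomposable projectives up to isomorphism or the matrix is not invertible over the rationals.
  Another choice of representatives only permutes the rows and columns of the matrix.
\<close>

definition magnitude :: "('k::field, 'a) module \<Rightarrow> rat option" where
  "magnitude A =
     (if \<exists>Ps. iso_representatives A (indecomposable_projectives A) Ps
      then map_option sum_mat (mat_inverse (hom_matrix A
             (SOME Ps. iso_representatives A (indecomposable_projectives A) Ps)))
      else None)"

text \<open>
  Meaningful for representation-finite \<open>A\<close>; another choice of representatives yields an
  isomorphic algebra.
\<close>

definition auslander_algebra ::
    "('k::field, 'a) module \<Rightarrow> ('k, (nat \<Rightarrow> nat \<Rightarrow> 'k) \<Rightarrow> (nat \<Rightarrow> nat \<Rightarrow> 'k)) module" where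
  "auslander_algebra A =
     endomorphism_algebra A
       (direct_sum_module (SOME Ms. iso_representatives A (indecomposables A) Ms))"

definition module_category_magnitude :: "('k::field, 'a) module \<Rightarrow> rat option" where
  "module_category_magnitude A = magnitude (auslander_algebra A)"

section \<open>Bound path algebras\<close>

text \<open>
  A quiver is a directed multigraph. A path is a triple of its source, its list of arrows and its
  target, so the stationary path at \<open>v\<close> is \<open>(v, [], v)\<close>. In a product \<open>p q\<close> the path \<open>p\<close> is
  traversed first; the other convention amounts to replacing the quiver by its opposite.
\<close>

type_synonym ('v, 'e) path = "'v \<times> 'e list \<times> 'v"

definition paths :: "('v, 'e) pre_digraph \<Rightarrow> ('v, 'e) path set" where
  "paths Q = {(u, p, v). pre_digraph.awalk Q u p v}"

fun path_concat :: "('v, 'e) path \<Rightarrow> ('v, 'e) path \<Rightarrow> ('v, 'e) path option" where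
  "path_concat (u, p, v) (v', q, w) = (if v = v' then Some (u, p @ q, w) else None)"

definition path_algebra :: "('v, 'e) pre_digraph \<Rightarrow> ('k::field, ('v, 'e) path \<Rightarrow> 'k) module" where
  "path_algebra Q =
     \<lparr>carrier = {f. finite {p. f p \<noteq> 0} \<and> {p. f p \<noteq> 0} \<subseteq> paths Q},
      mult = (\<lambda>f g r. \<Sum>(p, q) | f p \<noteq> 0 \<and> g q \<noteq> 0 \<and> path_concat p q = Some r. f p * g q),
      one = (\<lambda>(u, p, v). if u \<in> verts Q \<and> p = [] \<and> v = u then 1 else 0),
      zero = (\<lambda>p. 0),
      add = (\<lambda>f g p. f p + g p),
      smult = (\<lambda>c f p. c * f p)\<rparr>"

definition arrow_ideal :: "('v, 'e) pre_digraph \<Rightarrow> (('v, 'e) path \<Rightarrow> 'k::field) set" where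
  "arrow_ideal Q =
     Idl\<^bsub>path_algebra Q\<^esub> {(\<lambda>p. 0)((tail Q a, [a], head Q a) := 1) | a. a \<in> arcs Q}"

primrec ideal_power :: "('a, 'r) ring_scheme \<Rightarrow> 'a set \<Rightarrow> nat \<Rightarrow> 'a set" where
  "ideal_power R J 0 = carrier R"
| "ideal_power R J (Suc n) = ideal_prod R J (ideal_power R J n)"

definition admissible_ideal ::
    "('v, 'e) pre_digraph \<Rightarrow> (('v, 'e) path \<Rightarrow> 'k::field) set \<Rightarrow> bool" where
  "admissible_ideal Q I \<longleftrightarrow> ideal I (path_algebra Q) \<and>
     (\<exists>m\<ge>2. ideal_power (path_algebra Q) (arrow_ideal Q) m \<subseteq> I) \<and>
     I \<subseteq> ideal_power (path_algebra Q) (arrow_ideal Q) 2"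

text \<open>
  HOL-Algebra's quotient ring, extended by the induced scalar multiplication
  \<open>c (I + x) = I + c x\<close>, written as a union over representatives like
  \<^const>\<open>rcoset_mult\<close>.
\<close>

definition quotient_algebra :: "('k::field, 'a) module \<Rightarrow> 'a set \<Rightarrow> ('k, 'a set) module" where
  "quotient_algebra A I =
     \<lparr>carrier = carrier (A Quot I),
      mult = mult (A Quot I),
      one = one (A Quot I),
      zero = zero (A Quot I),
      add = add (A Quot I),
      smult = (\<lambda>c X. \<Union>x\<in>X. I +>\<^bsub>A\<^esub> (c \<odot>\<^bsub>A\<^esub> x))\<rparr>"

definition bound_path_algebra ::
    "('v, 'e) pre_digraph \<Rightarrow> (('v, 'e) path \<Rightarrow> 'k::field) set \<Rightarrow>
     ('k, (('v, 'e) path \<Rightarrow> 'k) set) module" where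
  "bound_path_algebra Q I = quotient_algebra (path_algebra Q) I"

end

(*
  Let L be the algebra. Each vertex v of the quiver yields an indecomposable projective module L e_v,
  and distinct vertices yield non-isomorphic ones, so rank 1 means one vertex. If there were two
  arrows, L would map onto k[x, y] / (x, y)^2, over which the preprojective Kronecker modules form an
  infinite family of indecomposables. So there is at most one arrow and L is a quotient of k[x] in
  which x is nilpotent.

  An indecomposable module over L is then cyclic, of some length l, and l determines it; the simple
  module is the one with l = 1. The indecomposable projectives over the endomorphism ring E of
  M_1 + ... + M_N are the E e_i for the projections e_i, and
  dim Hom(E e_i, E e_j) = dim e_i E e_j = min(l_i, l_j). This matrix is positive definite since the
  lengths are distinct. As its column at the simple module consists of ones, the entries of its
  inverse add up to 1. Thus only the distinctness of the lengths and the presence of the length 1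
  matter, not which lengths occur.
*)

theory Submission
  imports Defs
begin

section \<open>Left modules\<close>

text \<open>Two features of the definitions shape the proof. The magnitude is computed from an
  arbitrarily chosen list of representatives of all indecomposable projectives over E, so these have
  to be classified: each of them is shown to be some E e_i, and the chosen list amounts to an
  injective choice of indices, with distinct lengths. That the length 1 is among them requires that
  the projective of the simple module is not isomorphic to that of a longer M_j. Moreover,
  projectivity and isomorphism classes speak only of modules whose elements are functions from nat
  to k. Hence an algebra enters together with an injection of its elements into that type, and every
  constructed module is moved there.

  The indecomposability of the E e_i and of the L e_v rests on one criterion for a local corner
  ring, that a or e - a has a left inverse; in both cases a constant coefficient decides which. Over
  the quotient of k[x], a cyclic submodule of maximal length is split off with a maximal subspace
  that avoids a socle vector, so that no basis of the module has to be chosen.\<close>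

context left_module
begin

lemma smult_zero_left: "x \<in> carrier M \<Longrightarrow> \<zero>\<^bsub>R\<^esub> \<odot>\<^bsub>M\<^esub> x = \<zero>\<^bsub>M\<^esub>"
  using smult_l_distr[of "\<zero>\<^bsub>R\<^esub>" "\<zero>\<^bsub>R\<^esub>" x] smult_closed[of "\<zero>\<^bsub>R\<^esub>" x] by simp

lemma smult_zero_right: "a \<in> carrier R \<Longrightarrow> a \<odot>\<^bsub>M\<^esub> \<zero>\<^bsub>M\<^esub> = \<zero>\<^bsub>M\<^esub>"
  using smult_r_distr[of a "\<zero>\<^bsub>M\<^esub>" "\<zero>\<^bsub>M\<^esub>"] smult_closed[of a "\<zero>\<^bsub>M\<^esub>"] by simp

lemma smult_neg_left:
  assumes "a \<in> carrier R" "x \<in> carrier M"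
  shows "(\<ominus>\<^bsub>R\<^esub> a) \<odot>\<^bsub>M\<^esub> x = \<ominus>\<^bsub>M\<^esub> (a \<odot>\<^bsub>M\<^esub> x)"
  using smult_l_distr[of "\<ominus>\<^bsub>R\<^esub> a" a x] assms
  by (intro M.minus_equality[symmetric]) (simp_all add: smult_closed smult_zero_left R.l_neg)

lemma smult_neg_right:
  assumes "a \<in> carrier R" "x \<in> carrier M"
  shows "a \<odot>\<^bsub>M\<^esub> (\<ominus>\<^bsub>M\<^esub> x) = \<ominus>\<^bsub>M\<^esub> (a \<odot>\<^bsub>M\<^esub> x)"
  using smult_r_distr[of a "\<ominus>\<^bsub>M\<^esub> x" x] assms
  by (intro M.minus_equality[symmetric]) (simp_all add: smult_closed smult_zero_right M.l_neg)

lemma smult_diff_left: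
  assumes "a \<in> carrier R" "b \<in> carrier R" "x \<in> carrier M"
  shows "(a \<ominus>\<^bsub>R\<^esub> b) \<odot>\<^bsub>M\<^esub> x = a \<odot>\<^bsub>M\<^esub> x \<ominus>\<^bsub>M\<^esub> b \<odot>\<^bsub>M\<^esub> x"
  using assms by (simp add: R.minus_eq M.minus_eq smult_l_distr smult_neg_left)

lemma smult_diff_right:
  assumes "a \<in> carrier R" "x \<in> carrier M" "y \<in> carrier M"
  shows "a \<odot>\<^bsub>M\<^esub> (x \<ominus>\<^bsub>M\<^esub> y) = a \<odot>\<^bsub>M\<^esub> x \<ominus>\<^bsub>M\<^esub> a \<odot>\<^bsub>M\<^esub> y"
  using assms by (simp add: M.minus_eq smult_r_distr smult_neg_right)

lemma submoduleI:
  assumes "H \<subseteq> carrier M" "\<zero>\<^bsub>M\<^esub> \<in> H"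
    and "\<And>x y. x \<in> H \<Longrightarrow> y \<in> H \<Longrightarrow> x \<oplus>\<^bsub>M\<^esub> y \<in> H"
    and sm: "\<And>a x. a \<in> carrier R \<Longrightarrow> x \<in> H \<Longrightarrow> a \<odot>\<^bsub>M\<^esub> x \<in> H"
  shows "Module.submodule H R M"
proof -
  \<comment> \<open>Negation is the action of the negative of the unit, so closure under it
    follows.\<close>
  have "\<ominus>\<^bsub>M\<^esub> x \<in> H" if "x \<in> H" for x
    using sm[of "\<ominus>\<^bsub>R\<^esub> \<one>\<^bsub>R\<^esub>" x] that assms(1) smult_neg_left[of "\<one>\<^bsub>R\<^esub>" x]
    by (auto simp: smult_one)
  then show ?thesis
    using assms
    by (auto intro!: Module.submodule.intro subgroup.intro submodule_axioms.intro simp: a_inv_def)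
qed

lemma submoduleD:
  assumes "Module.submodule H R M"
  shows "H \<subseteq> carrier M" "\<zero>\<^bsub>M\<^esub> \<in> H"
    and "\<And>x y. x \<in> H \<Longrightarrow> y \<in> H \<Longrightarrow> x \<oplus>\<^bsub>M\<^esub> y \<in> H"
    and "\<And>x y. x \<in> H \<Longrightarrow> y \<in> H \<Longrightarrow> x \<ominus>\<^bsub>M\<^esub> y \<in> H"
    and "\<And>a x. a \<in> carrier R \<Longrightarrow> x \<in> H \<Longrightarrow> a \<odot>\<^bsub>M\<^esub> x \<in> H"
proof -
  have s: "subgroup H (add_monoid M)" and ax: "submodule_axioms H R M"
    using assms by (auto simp: Module.submodule_def)
  show "H \<subseteq> carrier M" "\<zero>\<^bsub>M\<^esub> \<in> H"
    and *: "\<And>x y. x \<in> H \<Longrightarrow> y \<in> H \<Longrightarrow> x \<oplus>\<^bsub>M\<^esub> y \<in> H"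
    and "\<And>a x. a \<in> carrier R \<Longrightarrow> x \<in> H \<Longrightarrow> a \<odot>\<^bsub>M\<^esub> x \<in> H"
    using subgroup.subset[OF s] subgroup.one_closed[OF s] subgroup.m_closed[OF s] ax
    by (auto simp: submodule_axioms_def)
  show "\<And>x y. x \<in> H \<Longrightarrow> y \<in> H \<Longrightarrow> x \<ominus>\<^bsub>M\<^esub> y \<in> H"
    using * subgroup.m_inv_closed[OF s] by (auto simp: M.minus_eq a_inv_def)
qed

end

section \<open>Homomorphisms and isomorphisms of left modules\<close>

lemma module_homI:
  assumes "\<And>x. x \<in> carrier M \<Longrightarrow> f x \<in> carrier N"
    and "\<And>x y. x \<in> carrier M \<Longrightarrow> y \<in> carrier M \<Longrightarrow> f (x \<oplus>\<^bsub>M\<^esub> y) = f x \<oplus>\<^bsub>N\<^esub> f y"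
    and "\<And>a x. a \<in> carrier R \<Longrightarrow> x \<in> carrier M \<Longrightarrow> f (a \<odot>\<^bsub>M\<^esub> x) = a \<odot>\<^bsub>N\<^esub> f x"
  shows "f \<in> module_hom R M N"
  using assms by (auto simp: module_hom_def)

lemma module_homD:
  assumes "f \<in> module_hom R M N"
  shows "\<And>x. x \<in> carrier M \<Longrightarrow> f x \<in> carrier N"
    and "\<And>x y. x \<in> carrier M \<Longrightarrow> y \<in> carrier M \<Longrightarrow> f (x \<oplus>\<^bsub>M\<^esub> y) = f x \<oplus>\<^bsub>N\<^esub> f y"
    and "\<And>a x. a \<in> carrier R \<Longrightarrow> x \<in> carrier M \<Longrightarrow> f (a \<odot>\<^bsub>M\<^esub> x) = a \<odot>\<^bsub>N\<^esub> f x"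
  using assms by (auto simp: module_hom_def)

lemma module_hom_zero:
  assumes "left_module R M" "left_module R N" "f \<in> module_hom R M N"
  shows "f \<zero>\<^bsub>M\<^esub> = \<zero>\<^bsub>N\<^esub>"
proof -
  interpret M: left_module R M by fact
  interpret N: left_module R N by fact
  show ?thesis
    using module_homD(2)[OF assms(3), of "\<zero>\<^bsub>M\<^esub>" "\<zero>\<^bsub>M\<^esub>"] module_homD(1)[OF assms(3), of "\<zero>\<^bsub>M\<^esub>"]
    by simp
qed

lemma module_hom_compose:
  assumes "f \<in> module_hom R M N" "g \<in> module_hom R N L"
  shows "(\<lambda>x. g (f x)) \<in> module_hom R M L"
  using module_homD[OF assms(1)] module_homD[OF assms(2)] by (auto intro: module_homI)

lemma module_iso_inverse:
  assumes "left_module R M" "f \<in> module_hom R M N" "bij_betw f (carrier M) (carrier N)"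
  obtains g where "g \<in> module_hom R N M" "bij_betw g (carrier N) (carrier M)"
    "\<And>x. x \<in> carrier M \<Longrightarrow> g (f x) = x" "\<And>y. y \<in> carrier N \<Longrightarrow> f (g y) = y"
proof -
  interpret M: left_module R M by fact
  note h = module_homD[OF assms(2)]
  let ?g = "inv_into (carrier M) f"
  have inj: "inj_on f (carrier M)" and im: "f ` carrier M = carrier N"
    using assms(3) by (auto simp: bij_betw_def)
  have gf: "?g (f x) = x" if "x \<in> carrier M" for x
    using that inj by simp
  have fg: "f (?g y) = y" "?g y \<in> carrier M" if "y \<in> carrier N" for y
    using that im by (auto intro: f_inv_into_f inv_into_into)
  have "?g \<in> module_hom R N M"
  proof (rule module_homI)
    show "?g (x \<oplus>\<^bsub>N\<^esub> y) = ?g x \<oplus>\<^bsub>M\<^esub> ?g y" if "x \<in> carrier N" "y \<in> carrier N" for x y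
      using that fg gf[of "?g x \<oplus>\<^bsub>M\<^esub> ?g y"] h(2)[of "?g x" "?g y"] by auto
    show "?g (a \<odot>\<^bsub>N\<^esub> x) = a \<odot>\<^bsub>M\<^esub> ?g x" if "a \<in> carrier R" "x \<in> carrier N" for a x
      using that fg gf[of "a \<odot>\<^bsub>M\<^esub> ?g x"] h(3)[of a "?g x"] by (auto simp: M.smult_closed)
  qed (use fg in auto)
  then show thesis
    using that[of ?g] bij_betw_inv_into[OF assms(3)] gf fg by auto
qed

lemma module_iso_refl: "module_iso R M M"
  unfolding module_iso_def
  by (intro bexI[of _ "\<lambda>x. x"]) (auto simp: bij_betw_def inj_on_def intro: module_homI)

lemma module_iso_sym:
  assumes "left_module R M" "module_iso R M N"
  shows "module_iso R N M"
proof -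
  obtain f where "f \<in> module_hom R M N" "bij_betw f (carrier M) (carrier N)"
    using assms(2) by (auto simp: module_iso_def)
  then obtain g where "g \<in> module_hom R N M" "bij_betw g (carrier N) (carrier M)"
    by (rule module_iso_inverse[OF assms(1)])
  then show ?thesis
    by (auto simp: module_iso_def)
qed

lemma module_iso_trans:
  assumes "module_iso R M N" "module_iso R N L"
  shows "module_iso R M L"
proof -
  obtain f g where "f \<in> module_hom R M N" "bij_betw f (carrier M) (carrier N)"
    and "g \<in> module_hom R N L" "bij_betw g (carrier N) (carrier L)"
    using assms by (auto simp: module_iso_def)
  then show ?thesis
    using module_hom_compose[of f R M N g L] bij_betw_trans[of f _ _ g]
    by (auto simp: module_iso_def comp_def)
qed

section \<open>Isomorphism classes and lists of representatives\<close>

lemma equiv_module_iso: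
  assumes "\<And>M. M \<in> \<C> \<Longrightarrow> left_module R M"
  shows "equiv \<C> {(M, N). M \<in> \<C> \<and> N \<in> \<C> \<and> module_iso R M N}"
  using assms
  by (intro equivI refl_onI symI transI)
    (auto intro: module_iso_refl dest: module_iso_sym module_iso_trans)

text \<open>A list of the classes without repetitions is mapped to chosen members. A module is
  isomorphic to the member chosen from a class exactly when that class is its own, so the index
  exists and is unique.\<close>

lemma iso_representatives_exists:
  assumes "\<And>M. M \<in> \<C> \<Longrightarrow> left_module A M" and "finite (iso_classes A \<C>)"
  shows "\<exists>Ms. iso_representatives A \<C> Ms"
proof -
  define r where "r = {(M, N). M \<in> \<C> \<and> N \<in> \<C> \<and> module_iso A M N}"
  have eq: "equiv \<C> r"
    unfolding r_def using assms(1) by (rule equiv_module_iso)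
  obtain Xs where Xs: "set Xs = \<C> // r" "distinct Xs"
    using finite_distinct_list[OF assms(2)[unfolded iso_classes_def, folded r_def]] by auto
  let ?c = "\<lambda>X. SOME M. M \<in> X"
  have c: "?c X \<in> X" if "X \<in> \<C> // r" for X
    using in_quotient_imp_non_empty[OF eq that] some_in_eq by blast
  have cC: "?c X \<in> \<C>" if "X \<in> \<C> // r" for X
    using c[OF that] in_quotient_imp_subset[OF eq that] by blast
  have "\<exists>!i. i < length (map ?c Xs) \<and> module_iso A M (map ?c Xs ! i)" if M: "M \<in> \<C>" for M
  proof -
    have "r `` {M} \<in> set Xs"
      using quotientI[OF M, of r] Xs(1) by simp
    then obtain i where i: "i < length Xs" "Xs ! i = r `` {M}"
      by (metis in_set_conv_nth)
    have *: "module_iso A M (?c (Xs ! j)) \<longleftrightarrow> Xs ! j = r `` {M}" if j: "j < length Xs" for j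
    proof -
      have q: "Xs ! j \<in> \<C> // r"
        using j Xs(1) nth_mem by blast
      have "module_iso A M (?c (Xs ! j)) \<longleftrightarrow> (M, ?c (Xs ! j)) \<in> r"
        using M cC[OF q] by (auto simp: r_def)
      also have "\<dots> \<longleftrightarrow> r `` {M} = r `` {?c (Xs ! j)}"
        using eq_equiv_class_iff[OF eq M cC[OF q]] by simp
      also have "r `` {?c (Xs ! j)} = Xs ! j"
      proof -
        obtain N where N: "Xs ! j = r `` {N}"
          using q by (rule quotientE)
        then have "(N, ?c (Xs ! j)) \<in> r"
          using c[OF q] by blast
        then show ?thesis
          using equiv_class_eq[OF eq] N by blast
      qed
      finally show ?thesis by auto
    qed
    show ?thesis
    proof (rule ex1I[of _ i])
      show "i < length (map ?c Xs) \<and> module_iso A M (map ?c Xs ! i)"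
        using i(1) *[OF i(1)] i(2) by (simp only: length_map nth_map simp_thms)
      show "j = i" if "j < length (map ?c Xs) \<and> module_iso A M (map ?c Xs ! j)" for j
      proof -
        have j: "j < length Xs"
          using that by simp
        then have "Xs ! j = Xs ! i"
          using that *[OF j] i(2) by (simp only: length_map nth_map simp_thms)
        then show ?thesis
          using nth_eq_iff_index_eq[OF Xs(2) j i(1)] by simp
      qed
    qed
  qed
  then have "iso_representatives A \<C> (map ?c Xs)"
    using cC Xs(1) unfolding iso_representatives_def by auto
  then show ?thesis ..
qed

lemma infinite_iso_classes:
  fixes M :: "nat \<Rightarrow> ('k::field, 'a) coord_module"
  assumes "\<And>N. N \<in> \<C> \<Longrightarrow> left_module A N" and "\<And>n. M n \<in> \<C>"
    and non_iso: "\<And>m n. module_iso A (M m) (M n) \<Longrightarrow> m = n"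
  shows "infinite (iso_classes A \<C>)"
proof -
  let ?r = "{(M, N). M \<in> \<C> \<and> N \<in> \<C> \<and> module_iso A M N}"
  have eq: "equiv \<C> ?r"
    using assms(1) by (rule equiv_module_iso)
  have "inj (\<lambda>n. ?r `` {M n})"
  proof (rule injI)
    fix m n
    assume "?r `` {M m} = ?r `` {M n}"
    then have "(M m, M n) \<in> ?r"
      using eq_equiv_class_iff[OF eq assms(2) assms(2)] by blast
    then show "m = n"
      using non_iso by blast
  qed
  moreover have "range (\<lambda>n. ?r `` {M n}) \<subseteq> iso_classes A \<C>"
    unfolding iso_classes_def using quotientI[OF assms(2)] by blast
  ultimately show ?thesis
    using infinite_iff_countable_subset by blast
qed

lemma card_iso_classes_eq_1D:
  fixes \<C> :: "('k::field, 'a) coord_module set"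
  assumes "\<And>N. N \<in> \<C> \<Longrightarrow> left_module A N" and "card (iso_classes A \<C>) = 1"
  shows "\<C> \<noteq> {}" and "\<And>M N. M \<in> \<C> \<Longrightarrow> N \<in> \<C> \<Longrightarrow> module_iso A M N"
proof -
  let ?r = "{(M, N). M \<in> \<C> \<and> N \<in> \<C> \<and> module_iso A M N}"
  have eq: "equiv \<C> ?r"
    using assms(1) by (rule equiv_module_iso)
  obtain X where X: "\<C> // ?r = {X}"
    using assms(2) unfolding iso_classes_def by (auto simp: card_1_singleton_iff)
  show "\<C> \<noteq> {}"
    using X by auto
  show "module_iso A M N" if "M \<in> \<C>" "N \<in> \<C>" for M N
    using quotientI[OF that(1), of ?r] quotientI[OF that(2), of ?r]
      eq_equiv_class_iff[OF eq that] X by auto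
qed

text \<open>Moves a module along an injection \<open>\<iota>\<close> of its carrier, which becomes
  an isomorphism. Projectivity, representatives and magnitude speak only of modules on functions
  \<open>nat \<Rightarrow> 'k\<close>; a module built on another type reaches them in this
  way.\<close>

definition transport :: "('m \<Rightarrow> 'n) \<Rightarrow> ('a, 'm) module \<Rightarrow> ('a, 'n) module" where
  "transport \<iota> M =
     \<lparr>carrier = \<iota> ` carrier M, mult = undefined, one = undefined, zero = \<iota> \<zero>\<^bsub>M\<^esub>,
      add = (\<lambda>x y. \<iota> (inv_into (carrier M) \<iota> x \<oplus>\<^bsub>M\<^esub> inv_into (carrier M) \<iota> y)),
      smult = (\<lambda>a x. \<iota> (a \<odot>\<^bsub>M\<^esub> inv_into (carrier M) \<iota> x))\<rparr>"

lemma bij_betw_transport: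
  "inj_on \<iota> (carrier M) \<Longrightarrow> bij_betw \<iota> (carrier M) (carrier (transport \<iota> M))"
  by (simp add: transport_def bij_betw_def)

lemma transport_hom:
  assumes "inj_on \<iota> (carrier M)"
  shows "\<iota> \<in> module_hom R M (transport \<iota> M)"
  using assms by (intro module_homI) (auto simp: transport_def)

lemma left_module_transport:
  assumes "left_module R M" "inj_on \<iota> (carrier M)"
  shows "left_module R (transport \<iota> M)"
proof -
  interpret M: left_module R M by fact
  have 1: "abelian_group (transport \<iota> M)"
  proof (rule abelian_groupI)
    fix x assume "x \<in> carrier (transport \<iota> M)"
    then obtain u where u: "u \<in> carrier M" "x = \<iota> u"
      by (auto simp: transport_def)
    then show "\<exists>y\<in>carrier (transport \<iota> M). y \<oplus>\<^bsub>transport \<iota> M\<^esub> x = \<zero>\<^bsub>transport \<iota> M\<^esub>"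
      using assms(2) by (intro bexI[of _ "\<iota> (\<ominus>\<^bsub>M\<^esub> u)"]) (auto simp: transport_def M.M.l_neg)
  qed (use assms(2) in \<open>auto simp: transport_def M.M.a_ac\<close>)
  show ?thesis
    using assms(2)
    by (intro left_module.intro left_module_axioms.intro 1 M.R.ring_axioms)
      (auto simp: transport_def M.smult_closed M.smult_l_distr M.smult_r_distr M.smult_assoc
        M.smult_one)
qed

section \<open>Projective modules and idempotents\<close>

text \<open>A nonzero idempotent whose corner ring \<open>e R e\<close> is local: of
  \<open>a\<close> and \<open>e - a\<close>, one has a left inverse. The witness \<open>b\<close>
  ranges over the whole ring, but \<open>e b e\<close> serves as well and lies in the
  corner.\<close>

definition local_idempotent :: "('a, 'r) ring_scheme \<Rightarrow> 'a \<Rightarrow> bool" where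
  "local_idempotent R e \<longleftrightarrow> e \<in> carrier R \<and> e \<otimes>\<^bsub>R\<^esub> e = e \<and> e \<noteq> \<zero>\<^bsub>R\<^esub> \<and>
     (\<forall>a\<in>carrier R. e \<otimes>\<^bsub>R\<^esub> a = a \<and> a \<otimes>\<^bsub>R\<^esub> e = a \<longrightarrow>
        (\<exists>b\<in>carrier R. b \<otimes>\<^bsub>R\<^esub> a = e \<or> b \<otimes>\<^bsub>R\<^esub> (e \<ominus>\<^bsub>R\<^esub> a) = e))"

text \<open>The module is isomorphic to the left ideal generated by \<open>e\<close>, with \<open>y\<close> in the role of \<open>e\<close>.\<close>

locale principal_module = left_module R M
    for R :: "('a, 'r) ring_scheme" and M :: "('a, 'm) module" (structure) +
  fixes e :: 'a and y :: 'm
  assumes e_closed: "e \<in> carrier R"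
    and y_closed: "y \<in> carrier M"
    and e_y: "e \<odot>\<^bsub>M\<^esub> y = y"
    and generates: "\<And>z. z \<in> carrier M \<Longrightarrow> \<exists>a\<in>carrier R. z = a \<odot>\<^bsub>M\<^esub> y"
    and annihilates: "\<And>a. a \<in> carrier R \<Longrightarrow> a \<odot>\<^bsub>M\<^esub> y = \<zero>\<^bsub>M\<^esub> \<Longrightarrow> a \<otimes>\<^bsub>R\<^esub> e = \<zero>\<^bsub>R\<^esub>"
begin

lemma smult_y_eq_iff:
  assumes "a \<in> carrier R" "b \<in> carrier R"
  shows "a \<odot>\<^bsub>M\<^esub> y = b \<odot>\<^bsub>M\<^esub> y \<longleftrightarrow> a \<otimes>\<^bsub>R\<^esub> e = b \<otimes>\<^bsub>R\<^esub> e"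
proof
  assume "a \<odot>\<^bsub>M\<^esub> y = b \<odot>\<^bsub>M\<^esub> y"
  then have "(a \<ominus>\<^bsub>R\<^esub> b) \<odot>\<^bsub>M\<^esub> y = \<zero>\<^bsub>M\<^esub>"
    using assms y_closed by (simp add: smult_diff_left smult_closed M.minus_eq M.r_neg)
  then have "(a \<ominus>\<^bsub>R\<^esub> b) \<otimes>\<^bsub>R\<^esub> e = \<zero>\<^bsub>R\<^esub>"
    using assms annihilates by simp
  then show "a \<otimes>\<^bsub>R\<^esub> e = b \<otimes>\<^bsub>R\<^esub> e"
    using assms e_closed
    by (simp add: R.minus_eq R.l_distr R.l_minus) (metis R.m_closed R.minus_equality R.minus_minus R.a_inv_closed)
next
  assume "a \<otimes>\<^bsub>R\<^esub> e = b \<otimes>\<^bsub>R\<^esub> e"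
  then show "a \<odot>\<^bsub>M\<^esub> y = b \<odot>\<^bsub>M\<^esub> y"
    using smult_assoc[of a e y] smult_assoc[of b e y] assms e_closed y_closed e_y by simp
qed

text \<open>By \<open>smult_y_eq_iff\<close>, the equation \<open>e y = y = 1 y\<close> turns into
  \<open>e e = 1 e\<close>.\<close>

lemma idempotent: "e \<otimes>\<^bsub>R\<^esub> e = e"
  using smult_y_eq_iff[of e "\<one>\<^bsub>R\<^esub>"] e_closed y_closed e_y by (simp add: smult_one)

lemma fg: "fg_module R M"
proof -
  have "U = carrier M" if U: "Module.submodule U R M" "{y} \<subseteq> U" for U
  proof
    show "U \<subseteq> carrier M"
      using submoduleD(1)[OF U(1)] .
    show "carrier M \<subseteq> U"
      using generates submoduleD(5)[OF U(1)] U(2) by blast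
  qed
  then show ?thesis
    using y_closed left_module_axioms unfolding fg_module_def
    by (intro conjI exI[of _ "{y}"]) auto
qed

text \<open>The universal property of \<open>R e\<close>: homomorphisms to \<open>N\<close> are
  given by the elements of \<open>e N\<close>. The map \<open>a y \<mapsto> a z\<close> is well
  defined because \<open>a y = c y\<close> yields \<open>a e = c e\<close>, hence
  \<open>a z = a e z = c e z = c z\<close>.\<close>

lemma hom_from:
  assumes "left_module R N" and z: "z \<in> carrier N" "e \<odot>\<^bsub>N\<^esub> z = z"
  obtains h where "h \<in> module_hom R M N" "\<And>a. a \<in> carrier R \<Longrightarrow> h (a \<odot>\<^bsub>M\<^esub> y) = a \<odot>\<^bsub>N\<^esub> z"
proof -
  interpret N: left_module R N by fact
  define c where "c x = (SOME a. a \<in> carrier R \<and> x = a \<odot>\<^bsub>M\<^esub> y)" for x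
  have c: "c x \<in> carrier R \<and> x = c x \<odot>\<^bsub>M\<^esub> y" if "x \<in> carrier M" for x
    unfolding c_def by (rule someI_ex) (use generates[OF that] in auto)
  define h where "h x = c x \<odot>\<^bsub>N\<^esub> z" for x
  have h: "h (a \<odot>\<^bsub>M\<^esub> y) = a \<odot>\<^bsub>N\<^esub> z" if a: "a \<in> carrier R" for a
  proof -
    let ?c = "c (a \<odot>\<^bsub>M\<^esub> y)"
    have "?c \<in> carrier R" "a \<odot>\<^bsub>M\<^esub> y = ?c \<odot>\<^bsub>M\<^esub> y"
      using c[of "a \<odot>\<^bsub>M\<^esub> y"] a y_closed smult_closed by auto
    then have "a \<otimes>\<^bsub>R\<^esub> e = ?c \<otimes>\<^bsub>R\<^esub> e" "?c \<in> carrier R"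
      using smult_y_eq_iff a by auto
    then show ?thesis
      using N.smult_assoc[of a e z] N.smult_assoc[of ?c e z] a e_closed z by (simp add: h_def)
  qed
  have "h \<in> module_hom R M N"
  proof (rule module_homI)
    show "h x \<in> carrier N" if "x \<in> carrier M" for x
      using c[OF that] z N.smult_closed by (simp add: h_def)
    show "h (x \<oplus>\<^bsub>M\<^esub> x') = h x \<oplus>\<^bsub>N\<^esub> h x'" if x: "x \<in> carrier M" "x' \<in> carrier M" for x x'
    proof -
      obtain a a' where "a \<in> carrier R" "x = a \<odot>\<^bsub>M\<^esub> y" "a' \<in> carrier R" "x' = a' \<odot>\<^bsub>M\<^esub> y"
        using generates x by meson
      then show ?thesis
        using h y_closed z by (simp add: N.smult_l_distr flip: smult_l_distr)
    qed
    show "h (r \<odot>\<^bsub>M\<^esub> x) = r \<odot>\<^bsub>N\<^esub> h x" if r: "r \<in> carrier R" and x: "x \<in> carrier M" for r x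
    proof -
      obtain a where "a \<in> carrier R" "x = a \<odot>\<^bsub>M\<^esub> y"
        using generates x by meson
      then show ?thesis
        using h y_closed z r by (simp add: N.smult_assoc flip: smult_assoc)
    qed
  qed
  then show thesis
    using h that by blast
qed

lemma hom_eqI:
  assumes "h \<in> module_hom R M N" "h' \<in> module_hom R M N" "h y = h' y" "x \<in> carrier M"
  shows "h x = h' x"
proof -
  obtain a where "a \<in> carrier R" "x = a \<odot>\<^bsub>M\<^esub> y"
    using generates assms(4) by meson
  then show ?thesis
    using module_homD(3)[OF assms(1), of a y] module_homD(3)[OF assms(2), of a y] y_closed assms(3)
    by simp
qed

text \<open>For a decomposition into \<open>U\<close> and \<open>V\<close> write
  \<open>y = u + v\<close>. A corner element \<open>a\<close> satisfies \<open>a y = e u\<close> and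
  \<open>(e - a) y = e v\<close>; a left inverse of \<open>a\<close> or of \<open>e - a\<close> then
  brings \<open>y\<close> into \<open>U\<close> or into \<open>V\<close>, which is therefore the
  whole module.\<close>

lemma indecomposable:
  assumes "local_idempotent R e"
  shows "indecomposable R M"
  unfolding indecomposable_def
proof (intro conjI allI impI)
  have "y \<noteq> \<zero>\<^bsub>M\<^esub>"
  proof
    assume "y = \<zero>\<^bsub>M\<^esub>"
    then have "\<one>\<^bsub>R\<^esub> \<odot>\<^bsub>M\<^esub> y = \<zero>\<^bsub>M\<^esub>"
      by (simp add: smult_one)
    then show False
      using annihilates[of "\<one>\<^bsub>R\<^esub>"] assms by (simp add: local_idempotent_def)
  qed
  then show "carrier M \<noteq> {\<zero>\<^bsub>M\<^esub>}"
    using y_closed by auto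
next
  fix U V
  assume "Module.submodule U R M \<and> Module.submodule V R M \<and>
            U <+>\<^bsub>M\<^esub> V = carrier M \<and> U \<inter> V = {\<zero>\<^bsub>M\<^esub>}"
  then have U: "Module.submodule U R M" and V: "Module.submodule V R M"
    and sum: "U <+>\<^bsub>M\<^esub> V = carrier M" and int: "U \<inter> V = {\<zero>\<^bsub>M\<^esub>}"
    by auto
  have carrier_subset: "carrier M \<subseteq> W" if "Module.submodule W R M" "y \<in> W" for W
    using generates submoduleD(5)[OF that(1) _ that(2)] by blast
  have "y \<in> U <+>\<^bsub>M\<^esub> V"
    using sum y_closed by simp
  then obtain u v where u: "u \<in> U" and v: "v \<in> V" and uv: "y = u \<oplus>\<^bsub>M\<^esub> v"
    by (auto simp: set_add_def' )
  have uM: "u \<in> carrier M" and vM: "v \<in> carrier M"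
    using submoduleD(1)[OF U] submoduleD(1)[OF V] u v by auto
  obtain c where c: "c \<in> carrier R" "u = c \<odot>\<^bsub>M\<^esub> y"
    using generates uM by meson
  define a where "a = e \<otimes>\<^bsub>R\<^esub> c \<otimes>\<^bsub>R\<^esub> e"
  have a: "a \<in> carrier R" "e \<otimes>\<^bsub>R\<^esub> a = a" "a \<otimes>\<^bsub>R\<^esub> e = a"
    using c e_closed idempotent by (auto simp: a_def R.m_assoc) (simp flip: R.m_assoc add: idempotent)
  have ay: "a \<odot>\<^bsub>M\<^esub> y = e \<odot>\<^bsub>M\<^esub> u"
    using c e_closed y_closed e_y by (simp add: a_def smult_assoc)
  have "(e \<ominus>\<^bsub>R\<^esub> a) \<odot>\<^bsub>M\<^esub> y = y \<ominus>\<^bsub>M\<^esub> e \<odot>\<^bsub>M\<^esub> u"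
    using a e_closed y_closed by (simp add: smult_diff_left e_y ay)
  also have "\<dots> = e \<odot>\<^bsub>M\<^esub> (u \<oplus>\<^bsub>M\<^esub> v) \<ominus>\<^bsub>M\<^esub> e \<odot>\<^bsub>M\<^esub> u"
    using e_y uv by simp
  also have "\<dots> = e \<odot>\<^bsub>M\<^esub> v"
  proof -
    have eu: "e \<odot>\<^bsub>M\<^esub> u \<in> carrier M" and ev: "e \<odot>\<^bsub>M\<^esub> v \<in> carrier M"
      using e_closed uM vM smult_closed by auto
    have "e \<odot>\<^bsub>M\<^esub> (u \<oplus>\<^bsub>M\<^esub> v) \<ominus>\<^bsub>M\<^esub> e \<odot>\<^bsub>M\<^esub> u
        = (e \<odot>\<^bsub>M\<^esub> v \<oplus>\<^bsub>M\<^esub> e \<odot>\<^bsub>M\<^esub> u) \<oplus>\<^bsub>M\<^esub> \<ominus>\<^bsub>M\<^esub> (e \<odot>\<^bsub>M\<^esub> u)"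
      using M.a_comm[OF eu ev] smult_r_distr[OF e_closed uM vM] by (simp only: M.minus_eq)
    also have "\<dots> = e \<odot>\<^bsub>M\<^esub> v"
      using M.a_assoc[OF ev eu M.a_inv_closed[OF eu]] M.r_neg[OF eu] M.r_zero[OF ev] by simp
    finally show ?thesis .
  qed
  finally have ey: "(e \<ominus>\<^bsub>R\<^esub> a) \<odot>\<^bsub>M\<^esub> y = e \<odot>\<^bsub>M\<^esub> v" .
  obtain b where b: "b \<in> carrier R" "b \<otimes>\<^bsub>R\<^esub> a = e \<or> b \<otimes>\<^bsub>R\<^esub> (e \<ominus>\<^bsub>R\<^esub> a) = e"
    using assms a by (auto simp: local_idempotent_def)
  from b(2) show "U = {\<zero>\<^bsub>M\<^esub>} \<or> V = {\<zero>\<^bsub>M\<^esub>}"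
  proof
    assume "b \<otimes>\<^bsub>R\<^esub> a = e"
    then have "y = b \<odot>\<^bsub>M\<^esub> (e \<odot>\<^bsub>M\<^esub> u)"
      using a b y_closed e_y ay smult_assoc[of b a y] by simp
    then have "y \<in> U"
      using submoduleD(5)[OF U] b e_closed u by simp
    then show ?thesis
      using carrier_subset[OF U] int submoduleD(1)[OF V] by blast
  next
    assume "b \<otimes>\<^bsub>R\<^esub> (e \<ominus>\<^bsub>R\<^esub> a) = e"
    then have "y = b \<odot>\<^bsub>M\<^esub> (e \<odot>\<^bsub>M\<^esub> v)"
      using a b e_closed y_closed e_y ey smult_assoc[of b "e \<ominus>\<^bsub>R\<^esub> a" y] by simp
    then have "y \<in> V"
      using submoduleD(5)[OF V] b e_closed v by simp
    then show ?thesis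
      using carrier_subset[OF V] int submoduleD(1)[OF U] by blast
  qed
qed

text \<open>The map \<open>a y \<mapsto> a z\<close> is injective because equalities of such
  elements amount to the same equation \<open>a e = a' e\<close> in both modules.\<close>

lemma isomorphic:
  assumes "principal_module R N e z"
  shows "module_iso R M N"
proof -
  interpret N: principal_module R N e z by fact
  obtain h where h: "h \<in> module_hom R M N"
    "\<And>a. a \<in> carrier R \<Longrightarrow> h (a \<odot>\<^bsub>M\<^esub> y) = a \<odot>\<^bsub>N\<^esub> z"
    using hom_from[OF N.left_module_axioms N.y_closed N.e_y] by blast
  have "bij_betw h (carrier M) (carrier N)"
    unfolding bij_betw_def
  proof
    show "inj_on h (carrier M)"
    proof (rule inj_onI)
      fix x x' assume x: "x \<in> carrier M" "x' \<in> carrier M" and eq: "h x = h x'"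
      obtain a a' where a: "a \<in> carrier R" "x = a \<odot>\<^bsub>M\<^esub> y" "a' \<in> carrier R" "x' = a' \<odot>\<^bsub>M\<^esub> y"
        using generates x by meson
      then have "a \<odot>\<^bsub>N\<^esub> z = a' \<odot>\<^bsub>N\<^esub> z"
        using eq h(2) by simp
      then show "x = x'"
        using a smult_y_eq_iff N.smult_y_eq_iff by simp
    qed
    show "h ` carrier M = carrier N"
    proof
      show "h ` carrier M \<subseteq> carrier N"
        using module_homD(1)[OF h(1)] by auto
      show "carrier N \<subseteq> h ` carrier M"
        using N.generates h(2) y_closed smult_closed by (metis image_eqI subsetI)
    qed
  qed
  then show ?thesis
    using h(1) by (auto simp: module_iso_def)
qed

text \<open>An isomorphism from \<open>R e\<close> to \<open>R e'\<close> and its inverse are right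
  multiplications by some \<open>a\<close> in \<open>e R e'\<close> and \<open>b\<close> in
  \<open>e' R e\<close>; that they compose to the identity means \<open>a b = e\<close>. This is how
  such modules are told apart later.\<close>

lemma isomorphic_imp_factors:
  assumes "principal_module R N e' z" and "module_iso R M N"
  obtains a b where "a \<in> carrier R" "b \<in> carrier R" "e \<otimes>\<^bsub>R\<^esub> a = a" "a \<otimes>\<^bsub>R\<^esub> e' = a"
    "e' \<otimes>\<^bsub>R\<^esub> b = b" "b \<otimes>\<^bsub>R\<^esub> e = b" "a \<otimes>\<^bsub>R\<^esub> b = e"
proof -
  interpret N: principal_module R N e' z by fact
  obtain f where f: "f \<in> module_hom R M N" "bij_betw f (carrier M) (carrier N)"
    using assms(2) by (auto simp: module_iso_def)
  obtain g where g: "g \<in> module_hom R N M" "\<And>x. x \<in> carrier M \<Longrightarrow> g (f x) = x"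
    using module_iso_inverse[OF left_module_axioms f] by metis
  obtain a0 b0 where a0: "a0 \<in> carrier R" "f y = a0 \<odot>\<^bsub>N\<^esub> z"
    and b0: "b0 \<in> carrier R" "g z = b0 \<odot>\<^bsub>M\<^esub> y"
    using generates[OF module_homD(1)[OF g(1) N.y_closed]]
      N.generates[OF module_homD(1)[OF f(1) y_closed]] by auto
  \<comment> \<open>Enclosing \<open>a0\<close> and \<open>b0\<close> between the idempotents puts
    them into the corners and leaves \<open>f y\<close> and \<open>g z\<close> unchanged, because
    \<open>e y = y\<close> and \<open>e' z = z\<close>.\<close>
  define a where "a = e \<otimes>\<^bsub>R\<^esub> a0 \<otimes>\<^bsub>R\<^esub> e'"
  define b where "b = e' \<otimes>\<^bsub>R\<^esub> b0 \<otimes>\<^bsub>R\<^esub> e"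
  note cl = e_closed N.e_closed a0(1) b0(1) y_closed N.y_closed
  have a: "a \<in> carrier R" "e \<otimes>\<^bsub>R\<^esub> a = a" "a \<otimes>\<^bsub>R\<^esub> e' = a"
    using cl idempotent N.idempotent by (simp_all add: a_def R.m_assoc) (simp flip: R.m_assoc)
  have b: "b \<in> carrier R" "e' \<otimes>\<^bsub>R\<^esub> b = b" "b \<otimes>\<^bsub>R\<^esub> e = b"
    using cl idempotent N.idempotent by (simp_all add: b_def R.m_assoc) (simp flip: R.m_assoc)
  have "f y = a \<odot>\<^bsub>N\<^esub> z"
    using module_homD(3)[OF f(1), of e y] cl a0(2) e_y N.e_y by (simp add: a_def N.smult_assoc)
  moreover have "g z = b \<odot>\<^bsub>M\<^esub> y"
    using module_homD(3)[OF g(1), of e' z] cl b0(2) e_y N.e_y by (simp add: b_def smult_assoc)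
  ultimately have "y = (a \<otimes>\<^bsub>R\<^esub> b) \<odot>\<^bsub>M\<^esub> y"
    using g(2)[OF y_closed] module_homD(3)[OF g(1), of a z] a(1) b(1) cl
    by (simp add: smult_assoc)
  then have "(a \<otimes>\<^bsub>R\<^esub> b) \<otimes>\<^bsub>R\<^esub> e = e"
    using smult_y_eq_iff[of "a \<otimes>\<^bsub>R\<^esub> b" "\<one>\<^bsub>R\<^esub>"] a(1) b(1) cl by (simp add: smult_one)
  then have "a \<otimes>\<^bsub>R\<^esub> b = e"
    using a(1) b(1,3) cl by (simp add: R.m_assoc)
  then show thesis
    using that a b by blast
qed

end

text \<open>A preimage \<open>m\<close> of \<open>h y\<close> may fail to be fixed by
  \<open>e\<close>, but \<open>e m\<close> is fixed and still maps to
  \<open>e (h y) = h (e y) = h y\<close>. The lift sends \<open>y\<close> to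
  \<open>e m\<close>.\<close>

lemma principal_module_projective:
  fixes P :: "('k::field, 'a) coord_module"
  assumes "principal_module A P e y"
  shows "projective A P"
  unfolding projective_def
proof (intro allI impI ballI)
  interpret P: principal_module A P e y by fact
  fix M N :: "('k, 'a) coord_module" and g h
  assume fg: "fg_module A M \<and> fg_module A N" and g: "g \<in> module_hom A M N"
    and h: "h \<in> module_hom A P N" and surj: "g ` carrier M = carrier N"
  interpret M: left_module A M using fg by (simp add: fg_module_def)
  interpret N: left_module A N using fg by (simp add: fg_module_def)
  have "h y \<in> g ` carrier M"
    using module_homD(1)[OF h] P.y_closed surj by simp
  then obtain m where m: "m \<in> carrier M" "g m = h y"
    by auto
  have em: "e \<odot>\<^bsub>M\<^esub> m \<in> carrier M" "e \<odot>\<^bsub>M\<^esub> (e \<odot>\<^bsub>M\<^esub> m) = e \<odot>\<^bsub>M\<^esub> m"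
    using m P.e_closed P.idempotent by (auto simp: M.smult_closed simp flip: M.smult_assoc)
  obtain h' where h': "h' \<in> module_hom A P M"
    "\<And>a. a \<in> carrier A \<Longrightarrow> h' (a \<odot>\<^bsub>P\<^esub> y) = a \<odot>\<^bsub>M\<^esub> (e \<odot>\<^bsub>M\<^esub> m)"
    using P.hom_from[OF M.left_module_axioms em] by blast
  have "h' y = e \<odot>\<^bsub>M\<^esub> m"
    using h'(2)[OF P.e_closed] em P.e_y by simp
  then have "g (h' y) = h y"
    using module_homD(3)[OF g, of e m] module_homD(3)[OF h, of e y] m P.e_closed P.e_y P.y_closed
    by simp
  then show "\<exists>h'\<in>module_hom A P M. \<forall>x\<in>carrier P. g (h' x) = h x"
    using P.hom_eqI[OF module_hom_compose[OF h'(1) g] h] h'(1) by blast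
qed

lemma principal_module_indecomposable_projective:
  fixes P :: "('k::field, 'a) coord_module"
  assumes "principal_module A P e y" and "local_idempotent A e"
  shows "P \<in> indecomposable_projectives A"
  using principal_module_projective[OF assms(1)] principal_module.fg[OF assms(1)]
    principal_module.indecomposable[OF assms]
  by (simp add: indecomposable_projectives_def indecomposables_def)

text \<open>The left ideal \<open>A e\<close>, described as the set of \<open>a\<close> with
  \<open>a e = a\<close> and moved to the coordinate type by \<open>\<iota>\<close>. Its generator
  is the image of \<open>e\<close>.\<close>

lemma principal_module_exists:
  fixes A :: "('k::field, 'a) module" and \<iota> :: "'a \<Rightarrow> nat \<Rightarrow> 'k"
  assumes "ring A" and inj: "inj_on \<iota> (carrier A)" and e: "e \<in> carrier A" "e \<otimes>\<^bsub>A\<^esub> e = e"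
  obtains P :: "('k, 'a) coord_module" and y where "principal_module A P e y"
proof -
  interpret A: ring A by fact
  let ?C = "{a \<in> carrier A. a \<otimes>\<^bsub>A\<^esub> e = a}"
  define L :: "('a, 'a) module" where
    "L = \<lparr>carrier = ?C, mult = undefined, one = undefined, zero = \<zero>\<^bsub>A\<^esub>, add = add A, smult = mult A\<rparr>"
  have ag: "abelian_group L"
  proof (rule abelian_groupI)
    fix x assume "x \<in> carrier L"
    then show "\<exists>z\<in>carrier L. z \<oplus>\<^bsub>L\<^esub> x = \<zero>\<^bsub>L\<^esub>"
      using e by (intro bexI[of _ "\<ominus>\<^bsub>A\<^esub> x"]) (auto simp: L_def A.l_neg A.l_minus)
  qed (use e in \<open>auto simp: L_def A.l_distr A.a_ac\<close>)
  have L: "left_module A L"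
    using e
    by (intro left_module.intro left_module_axioms.intro ag A.ring_axioms)
      (auto simp: L_def A.m_assoc A.l_distr A.r_distr)
  have inj': "inj_on \<iota> (carrier L)"
    using inj by (rule inj_on_subset) (auto simp: L_def)
  interpret T: left_module A "transport \<iota> L"
    using left_module_transport[OF L inj'] .
  note t = module_homD[OF transport_hom[OF inj', of A]]
  have eL: "e \<in> carrier L"
    using e by (simp add: L_def)
  have "principal_module A (transport \<iota> L) e (\<iota> e)"
  proof
    show "e \<in> carrier A" by fact
    show "\<iota> e \<in> carrier (transport \<iota> L)"
      using t(1) eL .
    show "e \<odot>\<^bsub>transport \<iota> L\<^esub> \<iota> e = \<iota> e"
      using t(3)[OF e(1) eL] e by (simp add: L_def)
    fix z assume "z \<in> carrier (transport \<iota> L)"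
    then obtain a where a: "a \<in> carrier L" "z = \<iota> a"
      by (auto simp: transport_def)
    then show "\<exists>a\<in>carrier A. z = a \<odot>\<^bsub>transport \<iota> L\<^esub> \<iota> e"
      using t(3)[of a e] eL by (intro bexI[of _ a]) (auto simp: L_def)
  next
    fix a assume a: "a \<in> carrier A" "a \<odot>\<^bsub>transport \<iota> L\<^esub> \<iota> e = \<zero>\<^bsub>transport \<iota> L\<^esub>"
    then have "\<iota> (a \<otimes>\<^bsub>A\<^esub> e) = \<iota> \<zero>\<^bsub>A\<^esub>"
      using t(3)[of a e] eL by (simp add: L_def transport_def)
    then show "a \<otimes>\<^bsub>A\<^esub> e = \<zero>\<^bsub>A\<^esub>"
      using inj a e by (auto dest: inj_onD)
  qed
  then show thesis by (rule that)
qed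

section \<open>Generation of modules and the classification of indecomposable projectives\<close>

lemma submodule_vimage:
  assumes "left_module R M" "left_module R N" "f \<in> module_hom R M N" "Module.submodule U R N"
  shows "Module.submodule {x \<in> carrier M. f x \<in> U} R M"
proof -
  interpret M: left_module R M by fact
  interpret N: left_module R N by fact
  note f = module_homD[OF assms(3)] and U = N.submoduleD[OF assms(4)]
  show ?thesis
    using f U module_hom_zero[OF assms(1-3)] by (intro M.submoduleI) (auto simp: M.smult_closed)
qed

text \<open>A submodule that contains the image of a generating set has a preimage that contains the
  generating set itself, so the preimage is everything.\<close>

lemma fg_module_image:
  assumes "fg_module R M" "left_module R N" "f \<in> module_hom R M N" "f ` carrier M = carrier N"
  shows "fg_module R N"
proof -
  have M: "left_module R M"
    using assms(1) by (simp add: fg_module_def)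
  interpret M: left_module R M by fact
  interpret N: left_module R N by fact
  obtain S where S: "finite S" "S \<subseteq> carrier M"
    "\<And>U. Module.submodule U R M \<Longrightarrow> S \<subseteq> U \<Longrightarrow> U = carrier M"
    using assms(1) by (auto simp: fg_module_def)
  have "U = carrier N" if U: "Module.submodule U R N" "f ` S \<subseteq> U" for U
  proof -
    have "{x \<in> carrier M. f x \<in> U} = carrier M"
      using U S(2) by (intro S(3) submodule_vimage[OF M assms(2,3)]) auto
    then have "f ` carrier M \<subseteq> U"
      by auto
    then show ?thesis
      using assms(4) N.submoduleD(1)[OF U(1)] by auto
  qed
  then show ?thesis
    using S assms(2) module_homD(1)[OF assms(3)] unfolding fg_module_def
    by (intro conjI exI[of _ "f ` S"]) auto
qed

context left_module
begin

lemma submodule_zero: "Module.submodule {\<zero>\<^bsub>M\<^esub>} R M"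
  by (rule submoduleI) (auto simp: smult_zero_right)

lemma submodule_Inter:
  assumes "\<U> \<noteq> {}" "\<And>U. U \<in> \<U> \<Longrightarrow> Module.submodule U R M"
  shows "Module.submodule (\<Inter>\<U>) R M"
proof (rule submoduleI)
  show "\<Inter>\<U> \<subseteq> carrier M"
    using assms(1) submoduleD(1)[OF assms(2)] by blast
qed (use submoduleD(2,3,5)[OF assms(2)] in auto)

lemma submodule_carrier: "Module.submodule (carrier M) R M"
  by (rule submoduleI) (auto simp: smult_closed)

text \<open>Meant for a decomposition of the unit into idempotents: then \<open>x\<close> itself
  lies in \<open>U\<close> as soon as all its components \<open>\<epsilon> i x\<close> do.\<close>

lemma finsum_smult_mem:
  assumes "finite J" "\<And>i. i \<in> J \<Longrightarrow> \<epsilon> i \<in> carrier R" "Module.submodule U R M" "x \<in> carrier M"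
    and "\<And>i. i \<in> J \<Longrightarrow> \<epsilon> i \<odot>\<^bsub>M\<^esub> x \<in> U"
  shows "finsum R \<epsilon> J \<odot>\<^bsub>M\<^esub> x \<in> U"
  using assms
proof (induction J rule: finite_induct)
  case empty
  then show ?case
    using submoduleD(2) by (simp add: smult_zero_left)
next
  case (insert j J)
  have "finsum R \<epsilon> (insert j J) = \<epsilon> j \<oplus>\<^bsub>R\<^esub> finsum R \<epsilon> J"
    using insert by (intro R.finsum_insert) auto
  moreover have "finsum R \<epsilon> J \<in> carrier R"
    using insert by (intro R.finsum_closed) auto
  ultimately show ?case
    using insert submoduleD(3)[OF insert.prems(2)] by (simp add: smult_l_distr)
qed

end

lemma projectiveD:
  fixes P M N :: "('k::field, 'a) coord_module"
  assumes "projective A P" "fg_module A M" "fg_module A N" "g \<in> module_hom A M N"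
    "h \<in> module_hom A P N" "g ` carrier M = carrier N"
  shows "\<exists>h'\<in>module_hom A P M. \<forall>x\<in>carrier P. g (h' x) = h x"
  using assms by (simp add: projective_def)

text \<open>
  Let \<open>x\<close> belong to a minimal set of homogeneous generators of \<open>P\<close> and let \<open>U\<close> be the submodule
  generated by the others. A section \<open>(s\<^sub>1, s\<^sub>2)\<close> of \<open>A \<oplus> U \<rightarrow> P\<close>, \<open>(a, u) \<mapsto> a x + u\<close>, satisfies
  \<open>(1 - s\<^sub>1 x) x \<in> U\<close>, so minimality makes \<open>s\<^sub>1 x\<close> a unit of the corner ring of \<open>x\<close>; hence \<open>A x\<close>
  splits off.
\<close>

lemma indecomposable_projective_principal:
  fixes A :: "('k::field, 'a) module" and \<iota> :: "'a \<Rightarrow> nat \<Rightarrow> 'k" and N :: nat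
  assumes "ring A" and inj: "inj_on \<iota> (carrier A)"
    and loc: "\<And>i. i < N \<Longrightarrow> local_idempotent A (\<epsilon> i)"
    and sum: "finsum A \<epsilon> {..<N} = \<one>\<^bsub>A\<^esub>"
    and P: "P \<in> indecomposable_projectives A"
  obtains i y where "i < N" "principal_module A P (\<epsilon> i) y"
proof -
  interpret A: ring A by fact
  have fgP: "fg_module A P" and indec: "indecomposable A P" and proj: "projective A P"
    using P by (auto simp: indecomposable_projectives_def indecomposables_def)
  interpret P: left_module A P
    using fgP by (simp add: fg_module_def)
  define homog where "homog x \<longleftrightarrow> x \<in> carrier P \<and> (\<exists>i<N. \<epsilon> i \<odot>\<^bsub>P\<^esub> x = x)" for x
  define gen where "gen T \<longleftrightarrow> (\<forall>U. Module.submodule U A P \<and> T \<subseteq> U \<longrightarrow> U = carrier P)" for T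
  have eps: "\<epsilon> i \<in> carrier A" "\<epsilon> i \<otimes>\<^bsub>A\<^esub> \<epsilon> i = \<epsilon> i" if "i < N" for i
    using loc[OF that] by (auto simp: local_idempotent_def)
  obtain S where S: "finite S" "S \<subseteq> carrier P" "gen S"
    using fgP by (auto simp: fg_module_def gen_def)
  define Q where "Q T \<longleftrightarrow> finite T \<and> (\<forall>x\<in>T. homog x) \<and> gen T" for T
  \<comment> \<open>Splitting each generator into its components makes the generators homogeneous;
    they still generate because the \<open>\<epsilon> i\<close> add up to one.\<close>
  define T0 where "T0 = (\<lambda>(i, s). \<epsilon> i \<odot>\<^bsub>P\<^esub> s) ` ({..<N} \<times> S)"
  have "Q T0"
    unfolding Q_def
  proof (intro conjI ballI)
    show "finite T0"
      using S unfolding T0_def by (intro finite_imageI finite_cartesian_product) auto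
    show "homog x" if x: "x \<in> T0" for x
    proof -
      obtain i s where js: "i < N" "s \<in> S" "x = \<epsilon> i \<odot>\<^bsub>P\<^esub> s"
        using x by (auto simp: T0_def)
      then have "\<epsilon> i \<odot>\<^bsub>P\<^esub> x = x"
        using P.smult_assoc[of "\<epsilon> i" "\<epsilon> i" s] eps S by auto
      then show ?thesis
        using js eps S P.smult_closed unfolding homog_def by blast
    qed
    show "gen T0"
      unfolding gen_def
    proof (intro allI impI)
      fix U assume U: "Module.submodule U A P \<and> T0 \<subseteq> U"
      have "s \<in> U" if s: "s \<in> S" for s
      proof -
        have "finsum A \<epsilon> {..<N} \<odot>\<^bsub>P\<^esub> s \<in> U"
          using U eps S s by (intro P.finsum_smult_mem) (auto simp: T0_def)
        then show ?thesis
          using s S sum P.smult_one by auto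
      qed
      then show "U = carrier P"
        using S(3) U unfolding gen_def by blast
    qed
  qed
  then obtain T where T: "Q T" and least: "\<And>T'. Q T' \<Longrightarrow> card T \<le> card T'"
    using ex_has_least_nat[of Q T0 card] by blast
  have "T \<noteq> {}"
  proof
    assume "T = {}"
    then have "carrier P = {\<zero>\<^bsub>P\<^esub>}"
      using T P.submodule_zero unfolding Q_def gen_def by blast
    then show False
      using indec by (simp add: indecomposable_def)
  qed
  then obtain x where x: "x \<in> T" by blast
  then obtain i where i: "i < N" "\<epsilon> i \<odot>\<^bsub>P\<^esub> x = x" and xP: "x \<in> carrier P"
    using T by (auto simp: Q_def homog_def)
  let ?e = "\<epsilon> i"
  note e = eps[OF i(1)]
  let ?T' = "T - {x}"
  define U where "U = \<Inter>{U. Module.submodule U A P \<and> ?T' \<subseteq> U}"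
  have TP: "T \<subseteq> carrier P"
    using T by (auto simp: Q_def homog_def)
  have U: "Module.submodule U A P"
    unfolding U_def using P.submodule_carrier TP by (intro P.submodule_Inter) blast+
  note Ud = P.submoduleD[OF U]
  have T'U: "?T' \<subseteq> U"
    by (auto simp: U_def)
  have U_least: "U \<subseteq> W" if "Module.submodule W A P" "?T' \<subseteq> W" for W
    using that by (auto simp: U_def)
  \<comment> \<open>Otherwise the remaining generators would suffice, against the minimality of
    \<open>T\<close>.\<close>
  have xU: "x \<notin> U"
  proof
    assume xU: "x \<in> U"
    have "Q ?T'"
      unfolding Q_def gen_def
    proof (intro conjI allI impI)
      fix W assume W: "Module.submodule W A P \<and> ?T' \<subseteq> W"
      then have "T \<subseteq> W"
        using U_least[of W] xU by auto
      then show "W = carrier P"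
        using T W by (auto simp: Q_def gen_def)
    qed (use T in \<open>auto simp: Q_def\<close>)
    then have "card T \<le> card ?T'"
      by (rule least)
    then show False
      using x T card_Diff1_less[of T x] by (auto simp: Q_def)
  qed

  \<comment> \<open>The module \<open>A \<oplus> U\<close>. Its elements are pairs, so it has to be
    moved to the coordinate type before the projectivity of \<open>P\<close> can be applied to
    it.\<close>
  define F :: "('a, 'a \<times> (nat \<Rightarrow> 'k)) module" where
    "F = \<lparr>carrier = carrier A \<times> U, mult = undefined, one = undefined,
          zero = (\<zero>\<^bsub>A\<^esub>, \<zero>\<^bsub>P\<^esub>), add = (\<lambda>(a, u) (b, v). (a \<oplus>\<^bsub>A\<^esub> b, u \<oplus>\<^bsub>P\<^esub> v)),
          smult = (\<lambda>c (a, u). (c \<otimes>\<^bsub>A\<^esub> a, c \<odot>\<^bsub>P\<^esub> u))\<rparr>"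
  have UP: "u \<in> carrier P" if "u \<in> U" for u
    using Ud(1) that by blast
  have agF: "abelian_group F"
  proof (rule abelian_groupI)
    fix z assume "z \<in> carrier F"
    then obtain a u where "z = (a, u)" "a \<in> carrier A" "u \<in> U"
      by (auto simp: F_def)
    then show "\<exists>z'\<in>carrier F. z' \<oplus>\<^bsub>F\<^esub> z = \<zero>\<^bsub>F\<^esub>"
      using Ud(4)[OF Ud(2)] UP P.M.minus_eq
      by (intro bexI[of _ "(\<ominus>\<^bsub>A\<^esub> a, \<ominus>\<^bsub>P\<^esub> u)"]) (auto simp: F_def A.l_neg P.M.l_neg)
  qed (use Ud UP in \<open>auto simp: F_def A.a_ac P.M.a_ac\<close>)
  have F: "left_module A F"
    using Ud UP
    by (intro left_module.intro left_module_axioms.intro agF A.ring_axioms)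
      (auto simp: F_def A.m_assoc A.l_distr A.r_distr P.smult_l_distr P.smult_r_distr
        P.smult_assoc P.smult_one)
  interpret F: left_module A F by fact
  have fgF: "fg_module A F"
  proof -
    let ?S = "insert (\<one>\<^bsub>A\<^esub>, \<zero>\<^bsub>P\<^esub>) (Pair \<zero>\<^bsub>A\<^esub> ` ?T')"
    have "W = carrier F" if W: "Module.submodule W A F" and SW: "?S \<subseteq> W" for W
    proof -
      note Wd = F.submoduleD[OF W]
      have "Module.submodule {u \<in> U. (\<zero>\<^bsub>A\<^esub>, u) \<in> W} A P"
        using Ud UP Wd(2) Wd(3)[of "(\<zero>\<^bsub>A\<^esub>, _)" "(\<zero>\<^bsub>A\<^esub>, _)"] Wd(5)[of _ "(\<zero>\<^bsub>A\<^esub>, _)"]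
        by (intro P.submoduleI) (auto simp: F_def)
      then have "U \<subseteq> {u \<in> U. (\<zero>\<^bsub>A\<^esub>, u) \<in> W}"
        using SW T'U by (intro U_least) auto
      then have "(a, u) \<in> W" if "a \<in> carrier A" "u \<in> U" for a u
        using that SW Wd(3)[of "(a, \<zero>\<^bsub>P\<^esub>)" "(\<zero>\<^bsub>A\<^esub>, u)"] Wd(5)[of a "(\<one>\<^bsub>A\<^esub>, \<zero>\<^bsub>P\<^esub>)"] UP
        by (auto simp: F_def P.smult_zero_right)
      then show ?thesis
        using Wd(1) by (auto simp: F_def)
    qed
    moreover have "finite ?S" "?S \<subseteq> carrier F"
      using T T'U Ud(2) by (auto simp: Q_def F_def)
    ultimately show ?thesis
      using F unfolding fg_module_def by blast
  qed
  \<comment> \<open>Interleaving: the even positions carry the coordinates of \<open>a\<close>, the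
    odd ones those of \<open>u\<close>.\<close>
  define \<kappa> where "\<kappa> = (\<lambda>(a, u) n. if even n then \<iota> a (n div 2) else u (n div 2))"
  have inj\<kappa>: "inj_on \<kappa> (carrier F)"
  proof (rule inj_onI)
    fix z z' assume zz: "z \<in> carrier F" "z' \<in> carrier F" and eq: "\<kappa> z = \<kappa> z'"
    obtain a u b v where z: "z = (a, u)" "z' = (b, v)" by (metis surj_pair)
    have "\<iota> a n = \<iota> b n" "u n = v n" for n
      using fun_cong[OF eq, of "2 * n"] fun_cong[OF eq, of "2 * n + 1"] by (auto simp: \<kappa>_def z)
    then have "\<iota> a = \<iota> b" "u = v"
      by auto
    then show "z = z'"
      using zz z inj by (auto simp: F_def dest: inj_onD)
  qed
  let ?F = "transport \<kappa> F"
  have F': "left_module A ?F"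
    using left_module_transport[OF F inj\<kappa>] .
  have k: "\<kappa> \<in> module_hom A F ?F" "bij_betw \<kappa> (carrier F) (carrier ?F)"
    using transport_hom[OF inj\<kappa>] bij_betw_transport[OF inj\<kappa>] by auto
  then have fgF': "fg_module A ?F"
    using fg_module_image[OF fgF F'] by (auto simp: bij_betw_def)
  obtain \<tau> where tau: "\<tau> \<in> module_hom A ?F F" "bij_betw \<tau> (carrier ?F) (carrier F)"
    using module_iso_inverse[OF F k] by metis
  define \<phi> where "\<phi> = (\<lambda>(a, u). a \<odot>\<^bsub>P\<^esub> x \<oplus>\<^bsub>P\<^esub> u)"
  have phi: "\<phi> \<in> module_hom A F P"
    using UP xP
    by (intro module_homI)
      (auto simp: F_def \<phi>_def P.smult_l_distr P.smult_r_distr P.smult_assoc P.smult_closed P.M.a_ac)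
  have phi_surj: "\<phi> ` carrier F = carrier P"
  proof -
    have "Module.submodule (\<phi> ` carrier F) A P"
    proof (rule P.submoduleI)
      note p = module_homD[OF phi]
      show "\<phi> ` carrier F \<subseteq> carrier P"
        using p(1) by auto
      show "\<zero>\<^bsub>P\<^esub> \<in> \<phi> ` carrier F"
        using module_hom_zero[OF F P.left_module_axioms phi] by (metis F.M.zero_closed image_eqI)
      show "a \<oplus>\<^bsub>P\<^esub> b \<in> \<phi> ` carrier F" if "a \<in> \<phi> ` carrier F" "b \<in> \<phi> ` carrier F" for a b
        using that p(2) F.M.a_closed by (metis (no_types, lifting) image_iff)
      show "c \<odot>\<^bsub>P\<^esub> b \<in> \<phi> ` carrier F" if "c \<in> carrier A" "b \<in> \<phi> ` carrier F" for c b
        using that p(3) F.smult_closed by (metis (no_types, lifting) image_iff)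
    qed
    moreover have "T \<subseteq> \<phi> ` carrier F"
    proof
      fix t assume t: "t \<in> T"
      show "t \<in> \<phi> ` carrier F"
      proof (cases "t = x")
        case True
        then show ?thesis
          using xP Ud(2) by (intro image_eqI[of _ _ "(\<one>\<^bsub>A\<^esub>, \<zero>\<^bsub>P\<^esub>)"]) (auto simp: \<phi>_def F_def P.smult_one)
      next
        case False
        then show ?thesis
          using xP t T'U TP
          by (intro image_eqI[of _ _ "(\<zero>\<^bsub>A\<^esub>, t)"]) (auto simp: \<phi>_def F_def P.smult_zero_left)
      qed
    qed
    ultimately show ?thesis
      using T by (auto simp: Q_def gen_def)
  qed
  have g: "(\<lambda>z. \<phi> (\<tau> z)) \<in> module_hom A ?F P" "(\<lambda>z. \<phi> (\<tau> z)) ` carrier ?F = carrier P"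
    using module_hom_compose[OF tau(1) phi] tau(2) phi_surj by (auto simp: bij_betw_def image_image[symmetric])
  have id: "(\<lambda>z. z) \<in> module_hom A P P"
    by (intro module_homI) auto
  \<comment> \<open>A section of \<open>\<phi>\<close>, obtained by lifting the identity of
    \<open>P\<close>.\<close>
  obtain s' where s': "s' \<in> module_hom A P ?F" "\<And>z. z \<in> carrier P \<Longrightarrow> \<phi> (\<tau> (s' z)) = z"
    using projectiveD[OF proj fgF' fgP g(1) id g(2)] by auto
  define s where "s z = \<tau> (s' z)" for z
  have s: "s \<in> module_hom A P F" "\<And>z. z \<in> carrier P \<Longrightarrow> \<phi> (s z) = z"
    using module_hom_compose[OF s'(1) tau(1)] s'(2) by (auto simp: s_def[abs_def])
  note sd = module_homD[OF s(1)]
  define s1 where "s1 z = fst (s z)" for z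
  have s1: "s1 z \<in> carrier A" if "z \<in> carrier P" for z
    using sd(1)[OF that] by (auto simp: s1_def F_def)
  have s1_add: "s1 (z \<oplus>\<^bsub>P\<^esub> w) = s1 z \<oplus>\<^bsub>A\<^esub> s1 w" if "z \<in> carrier P" "w \<in> carrier P" for z w
    using sd(2)[OF that] by (simp add: s1_def F_def split_beta)
  have s1_smult: "s1 (c \<odot>\<^bsub>P\<^esub> z) = c \<otimes>\<^bsub>A\<^esub> s1 z" if "c \<in> carrier A" "z \<in> carrier P" for c z
    using sd(3)[OF that] by (simp add: s1_def F_def split_beta)
  have s_split: "\<exists>u\<in>U. z = s1 z \<odot>\<^bsub>P\<^esub> x \<oplus>\<^bsub>P\<^esub> u" if "z \<in> carrier P" for z
    using sd(1)[OF that] s(2)[OF that] by (intro bexI[of _ "snd (s z)"]) (auto simp: s1_def F_def \<phi>_def split_beta)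
  define a where "a = s1 x \<otimes>\<^bsub>A\<^esub> ?e"
  have s1x: "?e \<otimes>\<^bsub>A\<^esub> s1 x = s1 x"
    using s1_smult[OF e(1) xP] i by simp
  have a: "a \<in> carrier A" "?e \<otimes>\<^bsub>A\<^esub> a = a" "a \<otimes>\<^bsub>A\<^esub> ?e = a"
    using s1[OF xP] e s1x by (auto simp: a_def A.m_assoc) (simp flip: A.m_assoc)
  have ax: "a \<odot>\<^bsub>P\<^esub> x = s1 x \<odot>\<^bsub>P\<^esub> x"
    using s1[OF xP] e xP i by (simp add: a_def P.smult_assoc)
  obtain b where b: "b \<in> carrier A" "b \<otimes>\<^bsub>A\<^esub> a = ?e \<or> b \<otimes>\<^bsub>A\<^esub> (?e \<ominus>\<^bsub>A\<^esub> a) = ?e"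
    using loc[OF i(1)] a by (auto simp: local_idempotent_def)
  \<comment> \<open>Otherwise \<open>b\<close> is a left inverse of \<open>e - a\<close>. Since
    \<open>(e - a) x\<close> is an element \<open>u\<close> of \<open>U\<close>, so is
    \<open>x = b u\<close>, which contradicts \<open>xU\<close>.\<close>
  have b_eq: "b \<otimes>\<^bsub>A\<^esub> a = ?e"
  proof (rule ccontr)
    assume "b \<otimes>\<^bsub>A\<^esub> a \<noteq> ?e"
    then have be: "b \<otimes>\<^bsub>A\<^esub> (?e \<ominus>\<^bsub>A\<^esub> a) = ?e"
      using b(2) by simp
    obtain u where u: "u \<in> U" "x = s1 x \<odot>\<^bsub>P\<^esub> x \<oplus>\<^bsub>P\<^esub> u"
      using s_split[OF xP] by blast
    have axP: "a \<odot>\<^bsub>P\<^esub> x \<in> carrier P"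
      using a xP by (simp add: P.smult_closed)
    have "(?e \<ominus>\<^bsub>A\<^esub> a) \<odot>\<^bsub>P\<^esub> x = x \<ominus>\<^bsub>P\<^esub> a \<odot>\<^bsub>P\<^esub> x"
      using e a xP i by (simp add: P.smult_diff_left)
    also have "\<dots> = (u \<oplus>\<^bsub>P\<^esub> a \<odot>\<^bsub>P\<^esub> x) \<oplus>\<^bsub>P\<^esub> \<ominus>\<^bsub>P\<^esub> (a \<odot>\<^bsub>P\<^esub> x)"
      using u(2) P.M.a_comm[OF axP UP[OF u(1)]] ax by (simp only: P.M.minus_eq)
    also have "\<dots> = u"
      using P.M.a_assoc[OF UP[OF u(1)] axP P.M.a_inv_closed[OF axP]] P.M.r_neg[OF axP] UP[OF u(1)]
      by simp
    finally have "(?e \<ominus>\<^bsub>A\<^esub> a) \<odot>\<^bsub>P\<^esub> x = u" .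
    then have "x = b \<odot>\<^bsub>P\<^esub> u"
      using P.smult_assoc[of b "?e \<ominus>\<^bsub>A\<^esub> a" x] b(1) e a xP i be by simp
    then show False
      using Ud(5)[OF b(1) u(1)] xU by simp
  qed

  \<comment> \<open>The map \<open>\<pi>\<close> is \<open>s1\<close> followed by right
    multiplication by \<open>e\<close>, with values in \<open>A e\<close>. As
    \<open>\<pi> y = e b a = e\<close>, it is split by \<open>c e \<mapsto> c y\<close>, and
    \<open>P\<close> is the direct sum of \<open>A y\<close> and the kernel of \<open>\<pi>\<close>.
    Indecomposability then leaves only \<open>A y\<close>.\<close>
  define y where "y = (?e \<otimes>\<^bsub>A\<^esub> b) \<odot>\<^bsub>P\<^esub> x"
  define \<pi> where "\<pi> z = s1 z \<otimes>\<^bsub>A\<^esub> ?e" for z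
  have yP: "y \<in> carrier P"
    using e b(1) xP by (simp add: y_def P.smult_closed)
  have ey: "?e \<odot>\<^bsub>P\<^esub> y = y"
    using e b(1) xP by (simp add: y_def A.m_assoc[symmetric] flip: P.smult_assoc)
  have pi: "\<pi> z \<in> carrier A" if "z \<in> carrier P" for z
    using s1[OF that] e by (simp add: \<pi>_def)
  have pi_add: "\<pi> (z \<oplus>\<^bsub>P\<^esub> w) = \<pi> z \<oplus>\<^bsub>A\<^esub> \<pi> w" if "z \<in> carrier P" "w \<in> carrier P" for z w
    using s1_add[OF that] s1 that e by (simp add: \<pi>_def A.l_distr)
  have pi_smult: "\<pi> (c \<odot>\<^bsub>P\<^esub> z) = c \<otimes>\<^bsub>A\<^esub> \<pi> z" if "c \<in> carrier A" "z \<in> carrier P" for c z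
    using s1_smult[OF that] s1 that e by (simp add: \<pi>_def A.m_assoc)
  have pi_y: "\<pi> y = ?e"
    using pi_smult[of "?e \<otimes>\<^bsub>A\<^esub> b" x] e b(1) xP b_eq
      A.m_assoc[OF e(1) b(1) a(1)] by (simp add: y_def \<pi>_def flip: a_def)
  have pi_e: "\<pi> z \<otimes>\<^bsub>A\<^esub> ?e = \<pi> z" if "z \<in> carrier P" for z
    using s1[OF that] e by (simp add: \<pi>_def A.m_assoc)
  have pi_cy: "\<pi> (c \<odot>\<^bsub>P\<^esub> y) = c \<otimes>\<^bsub>A\<^esub> ?e" if "c \<in> carrier A" for c
    using pi_smult[OF that yP] pi_y by simp
  have cey: "(c \<otimes>\<^bsub>A\<^esub> ?e) \<odot>\<^bsub>P\<^esub> y = c \<odot>\<^bsub>P\<^esub> y" if "c \<in> carrier A" for c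
    using that e yP ey by (simp add: P.smult_assoc)
  have pi0: "\<pi> \<zero>\<^bsub>P\<^esub> = \<zero>\<^bsub>A\<^esub>"
    using pi_smult[of "\<zero>\<^bsub>A\<^esub>" "\<zero>\<^bsub>P\<^esub>"] pi[of "\<zero>\<^bsub>P\<^esub>"] by (simp add: P.smult_zero_right)
  define W where "W = (\<lambda>c. c \<odot>\<^bsub>P\<^esub> y) ` carrier A"
  define V where "V = {z \<in> carrier P. \<pi> z = \<zero>\<^bsub>A\<^esub>}"
  have W: "Module.submodule W A P"
  proof (rule P.submoduleI)
    show "W \<subseteq> carrier P"
      using yP by (auto simp: W_def P.smult_closed)
    show "\<zero>\<^bsub>P\<^esub> \<in> W"
      using yP P.smult_zero_left by (force simp: W_def)
    show "z \<oplus>\<^bsub>P\<^esub> w \<in> W" if "z \<in> W" "w \<in> W" for z w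
      using that yP by (auto simp: W_def image_iff) (metis A.a_closed P.smult_l_distr)
    show "c \<odot>\<^bsub>P\<^esub> w \<in> W" if "c \<in> carrier A" "w \<in> W" for c w
      using that yP by (auto simp: W_def image_iff) (metis A.m_closed P.smult_assoc)
  qed
  have V: "Module.submodule V A P"
    using pi_add pi_smult pi0 by (intro P.submoduleI) (auto simp: V_def P.smult_closed)
  have split: "\<exists>v\<in>V. z = \<pi> z \<odot>\<^bsub>P\<^esub> y \<oplus>\<^bsub>P\<^esub> v" if z: "z \<in> carrier P" for z
  proof
    let ?w = "\<pi> z \<odot>\<^bsub>P\<^esub> y"
    have w: "?w \<in> carrier P"
      using pi[OF z] yP by (simp add: P.smult_closed)
    show "z = ?w \<oplus>\<^bsub>P\<^esub> (\<ominus>\<^bsub>P\<^esub> ?w \<oplus>\<^bsub>P\<^esub> z)"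
      using z w by (simp add: P.M.r_neg flip: P.M.a_assoc)
    have "\<pi> (\<ominus>\<^bsub>P\<^esub> ?w) = \<pi> ((\<ominus>\<^bsub>A\<^esub> \<pi> z) \<odot>\<^bsub>P\<^esub> y)"
      using pi[OF z] yP by (simp add: P.smult_neg_left)
    also have "\<dots> = \<ominus>\<^bsub>A\<^esub> \<pi> z"
      using pi[OF z] pi_cy[of "\<ominus>\<^bsub>A\<^esub> \<pi> z"] e pi_e[OF z] by (simp add: A.l_minus)
    finally show "\<ominus>\<^bsub>P\<^esub> ?w \<oplus>\<^bsub>P\<^esub> z \<in> V"
      using z w pi_add[of "\<ominus>\<^bsub>P\<^esub> ?w" z] pi[OF z] by (simp add: V_def A.l_neg)
  qed
  have "W <+>\<^bsub>P\<^esub> V = carrier P"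
  proof
    show "W <+>\<^bsub>P\<^esub> V \<subseteq> carrier P"
      using P.submoduleD(1)[OF W] P.submoduleD(1)[OF V] by (auto simp: set_add_def')
    show "carrier P \<subseteq> W <+>\<^bsub>P\<^esub> V"
      using split pi by (force simp: set_add_def' W_def)
  qed
  moreover have "W \<inter> V = {\<zero>\<^bsub>P\<^esub>}"
  proof -
    have "z = \<zero>\<^bsub>P\<^esub>" if z: "z \<in> W" "z \<in> V" for z
    proof -
      obtain c where c: "c \<in> carrier A" "z = c \<odot>\<^bsub>P\<^esub> y"
        using z by (auto simp: W_def)
      then have "c \<otimes>\<^bsub>A\<^esub> ?e = \<zero>\<^bsub>A\<^esub>"
        using z pi_cy by (simp add: V_def)
      then show ?thesis
        using cey[OF c(1)] c yP by (simp add: P.smult_zero_left)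
    qed
    then show ?thesis
      using P.submoduleD(2)[OF W] P.submoduleD(2)[OF V] by blast
  qed
  moreover have "W \<noteq> {\<zero>\<^bsub>P\<^esub>}"
  proof
    assume "W = {\<zero>\<^bsub>P\<^esub>}"
    moreover have "y \<in> W"
      using yP P.smult_one by (force simp: W_def)
    ultimately have "?e = \<zero>\<^bsub>A\<^esub>"
      using pi_y pi0 by simp
    then show False
      using loc[OF i(1)] by (simp add: local_idempotent_def)
  qed
  ultimately have V0: "V = {\<zero>\<^bsub>P\<^esub>}"
    using indec W V unfolding indecomposable_def by blast
  have "principal_module A P ?e y"
  proof
    show "?e \<in> carrier A" "y \<in> carrier P" "?e \<odot>\<^bsub>P\<^esub> y = y"
      using e yP ey by auto
    show "\<exists>c\<in>carrier A. z = c \<odot>\<^bsub>P\<^esub> y" if "z \<in> carrier P" for z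
      using split[OF that] V0 pi[OF that] yP by (intro bexI[of _ "\<pi> z"]) (auto simp: P.smult_closed)
    show "c \<otimes>\<^bsub>A\<^esub> ?e = \<zero>\<^bsub>A\<^esub>" if "c \<in> carrier A" "c \<odot>\<^bsub>P\<^esub> y = \<zero>\<^bsub>P\<^esub>" for c
      using pi_cy[OF that(1)] that pi0 by simp
  qed
  then show thesis
    using that i(1) by blast
qed

section \<open>Dimensions of spaces of homomorphisms\<close>

text \<open>The model of a \<open>d\<close>-dimensional space to which the spaces of homomorphisms
  are compared. It also provides the two layers of the Kronecker modules.\<close>

definition poly_lt :: "nat \<Rightarrow> 'k::zero poly set" where
  "poly_lt d = {p. \<forall>i\<ge>d. coeff p i = 0}"

lemma poly_lt_sum_monom: "p \<in> poly_lt d \<Longrightarrow> p = (\<Sum>i<d. monom (coeff p i) i)"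
  for p :: "'k::comm_monoid_add poly"
  by (intro poly_eqI) (auto simp: poly_lt_def coeff_sum sum.delta' if_distrib cong: if_cong)

text \<open>The bijection carries the vector space axioms from polynomials to the record
  \<open>V\<close>, and the images of the monomials form a basis.\<close>

lemma dim_eqI:
  fixes V :: "('k::field, 'v) module"
  assumes bij: "bij_betw \<gamma> (poly_lt d) (carrier V)"
    and add: "\<And>p q. p \<in> poly_lt d \<Longrightarrow> q \<in> poly_lt d \<Longrightarrow> \<gamma> (p + q) = \<gamma> p \<oplus>\<^bsub>V\<^esub> \<gamma> q"
    and smult: "\<And>c p. p \<in> poly_lt d \<Longrightarrow> \<gamma> (Polynomial.smult c p) = c \<odot>\<^bsub>V\<^esub> \<gamma> p"
    and zero: "\<gamma> 0 = \<zero>\<^bsub>V\<^esub>"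
  shows "vectorspace.dim class_ring V = d"
proof -
  let ?K = "class_ring :: 'k ring"
  have inj: "inj_on \<gamma> (poly_lt d)" and im: "\<gamma> ` poly_lt d = carrier V"
    using bij by (auto simp: bij_betw_def)
  have pl: "0 \<in> poly_lt d" "p + q \<in> poly_lt d" "Polynomial.smult c p \<in> poly_lt d" "- p \<in> poly_lt d"
    if "p \<in> poly_lt d" "q \<in> poly_lt d" for p q :: "'k poly" and c
    using that by (auto simp: poly_lt_def)
  have z: "(0 :: 'k poly) \<in> poly_lt d"
    by (simp add: poly_lt_def)
  have closed: "\<gamma> p \<in> carrier V" if "p \<in> poly_lt d" for p
    using that im by auto
  have ex: "\<exists>p\<in>poly_lt d. x = \<gamma> p" if "x \<in> carrier V" for x
    using that im by auto
  have ag: "abelian_group V"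
  proof (rule abelian_groupI)
    show "\<zero>\<^bsub>V\<^esub> \<in> carrier V"
      using closed[OF z] zero by simp
    fix x assume "x \<in> carrier V"
    then obtain p where p: "p \<in> poly_lt d" "x = \<gamma> p" using ex by blast
    show "\<zero>\<^bsub>V\<^esub> \<oplus>\<^bsub>V\<^esub> x = x"
      using add[OF z p(1)] p zero by simp
    show "\<exists>y\<in>carrier V. y \<oplus>\<^bsub>V\<^esub> x = \<zero>\<^bsub>V\<^esub>"
      using add[OF pl(4)[OF p(1) p(1)] p(1)] closed[OF pl(4)[OF p(1) p(1)]] p zero by auto
    fix y assume "y \<in> carrier V"
    then obtain q where q: "q \<in> poly_lt d" "y = \<gamma> q" using ex by blast
    show "x \<oplus>\<^bsub>V\<^esub> y \<in> carrier V"
      using add[OF p(1) q(1)] closed[OF pl(2)[OF p(1) q(1)]] p q by simp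
    show "x \<oplus>\<^bsub>V\<^esub> y = y \<oplus>\<^bsub>V\<^esub> x"
      using add[OF p(1) q(1)] add[OF q(1) p(1)] p q by (simp add: add.commute)
    fix w assume "w \<in> carrier V"
    then obtain r where r: "r \<in> poly_lt d" "w = \<gamma> r" using ex by blast
    show "(x \<oplus>\<^bsub>V\<^esub> y) \<oplus>\<^bsub>V\<^esub> w = x \<oplus>\<^bsub>V\<^esub> (y \<oplus>\<^bsub>V\<^esub> w)"
      using add[OF p(1) q(1)] add[OF q(1) r(1)] add[OF pl(2)[OF p(1) q(1)] r(1)]
        add[OF p(1) pl(2)[OF q(1) r(1)]] p q r by (simp add: add.assoc)
  qed
  have "module ?K V"
  proof (rule moduleI)
    show "cring ?K"
      by (rule class_cring.cring_axioms)
    show "abelian_group V" by fact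
    fix a b :: 'k and x assume "x \<in> carrier V"
    then obtain p where p: "p \<in> poly_lt d" "x = \<gamma> p" using ex by blast
    note sm = smult[OF p(1)]
    show "a \<odot>\<^bsub>V\<^esub> x \<in> carrier V"
      using closed[OF pl(3)[OF p(1) p(1)]] p by (simp flip: sm)
    show "\<one>\<^bsub>?K\<^esub> \<odot>\<^bsub>V\<^esub> x = x"
      using p by (simp flip: sm)
    show "(a \<otimes>\<^bsub>?K\<^esub> b) \<odot>\<^bsub>V\<^esub> x = a \<odot>\<^bsub>V\<^esub> (b \<odot>\<^bsub>V\<^esub> x)"
      using p smult[OF pl(3)[OF p(1) p(1)], of a b] by (simp flip: sm)
    show "(a \<oplus>\<^bsub>?K\<^esub> b) \<odot>\<^bsub>V\<^esub> x = a \<odot>\<^bsub>V\<^esub> x \<oplus>\<^bsub>V\<^esub> b \<odot>\<^bsub>V\<^esub> x"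
      using p add[OF pl(3)[OF p(1) p(1)] pl(3)[OF p(1) p(1)], of a b]
      by (simp add: smult_add_left flip: sm)
    fix y assume "y \<in> carrier V"
    then obtain q where q: "q \<in> poly_lt d" "y = \<gamma> q" using ex by blast
    show "a \<odot>\<^bsub>V\<^esub> (x \<oplus>\<^bsub>V\<^esub> y) = a \<odot>\<^bsub>V\<^esub> x \<oplus>\<^bsub>V\<^esub> a \<odot>\<^bsub>V\<^esub> y"
      using p q add[OF p(1) q(1)] smult[OF q(1)] smult[OF pl(2)[OF p(1) q(1)], of a]
        add[OF pl(3)[OF p(1) p(1)] pl(3)[OF q(1) q(1)], of a a]
      by (simp add: smult_add_right flip: sm)
  qed
  then interpret V: vectorspace ?K V
    by (intro vectorspace.intro class_field.field_axioms)
  define b where "b i = \<gamma> (monom 1 i)" for i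
  have m: "monom c i \<in> poly_lt d" if "i < d" for c :: 'k and i
    using that by (auto simp: poly_lt_def)
  have b: "b i \<in> carrier V" if "i < d" for i
    using closed[OF m[OF that]] by (simp add: b_def)
  have injb: "inj_on b {..<d}"
  proof (rule inj_onI)
    fix i j assume ij: "i \<in> {..<d}" "j \<in> {..<d}" "b i = b j"
    then have "monom (1 :: 'k) i = monom 1 j"
      using inj m by (auto simp: b_def dest: inj_onD)
    then show "i = j"
      by (simp add: monom_eq_iff')
  qed
  have sum_eq: "finsum V (\<lambda>i. c i \<odot>\<^bsub>V\<^esub> b i) J = \<gamma> (\<Sum>i\<in>J. monom (c i) i)
      \<and> (\<Sum>i\<in>J. monom (c i) i) \<in> poly_lt d" if "finite J" "J \<subseteq> {..<d}" for c J
    using that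
  proof (induction J rule: finite_induct)
    case empty
    then show ?case using z zero by simp
  next
    case (insert j J)
    have "c j \<odot>\<^bsub>V\<^esub> b j = \<gamma> (monom (c j) j)"
      using smult[OF m[of j 1], of "c j"] insert.prems by (simp add: b_def smult_monom)
    then show ?case
      using insert m[of j "c j"] add[of "monom (c j) j" "\<Sum>i\<in>J. monom (c i) i"] b
        V.smult_closed
      by (subst V.M.finsum_insert) (auto intro!: pl(2) closed V.smult_closed)
  qed
  \<comment> \<open>Arbitrary subsets of the basis are considered because linear dependence is
    stated through finite subsets.\<close>
  have lc: "V.lincomb a (b ` J) = \<gamma> (\<Sum>i\<in>J. monom (a (b i)) i)" if "J \<subseteq> {..<d}" for a J
  proof -
    have "V.lincomb a (b ` J) = finsum V (\<lambda>i. a (b i) \<odot>\<^bsub>V\<^esub> b i) J"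
      unfolding V.lincomb_def using that b inj_on_subset[OF injb that]
      by (intro V.M.finsum_reindex) (auto intro!: V.smult_closed)
    then show ?thesis
      using sum_eq[OF _ that] finite_subset[OF that] by simp
  qed
  have "V.basis (b ` {..<d})"
    unfolding V.basis_def
  proof (intro conjI)
    show bc: "b ` {..<d} \<subseteq> carrier V"
      using b by auto
    show "V.gen_set (b ` {..<d})"
    proof
      show "V.span (b ` {..<d}) \<subseteq> carrier V"
        using V.span_is_subset2[OF bc] .
      show "carrier V \<subseteq> V.span (b ` {..<d})"
      proof
        fix x assume "x \<in> carrier V"
        then obtain p where p: "p \<in> poly_lt d" "x = \<gamma> p" using ex by blast
        \<comment> \<open>Linear combinations take their coefficients from a function on vectors, so
          \<open>inv_into\<close> recovers the index of a basis vector.\<close>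
        define a where "a v = coeff p (inv_into {..<d} b v)" for v
        have "(\<Sum>i<d. monom (a (b i)) i) = p"
          using poly_lt_sum_monom[OF p(1)] injb by (simp add: a_def)
        then have "x = V.lincomb a (b ` {..<d})"
          using lc[of "{..<d}" a] p by simp
        then show "x \<in> V.span (b ` {..<d})"
          unfolding V.span_def by (intro CollectI exI[of _ a] exI[of _ "b ` {..<d}"]) auto
      qed
    qed
    show "V.lin_indpt (b ` {..<d})"
      unfolding V.lin_dep_def
    proof (intro notI, elim exE conjE)
      fix A a v assume A: "finite A" "A \<subseteq> b ` {..<d}" "V.lincomb a A = \<zero>\<^bsub>V\<^esub>" "v \<in> A"
        and av: "a v \<noteq> \<zero>\<^bsub>?K\<^esub>"
      obtain J where J: "J \<subseteq> {..<d}" "A = b ` J"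
        using A(2) by (auto simp: subset_image_iff)
      have "finite J"
        using J finite_subset by blast
      have "\<gamma> (\<Sum>i\<in>J. monom (a (b i)) i) = \<gamma> 0"
        using A(3) lc[OF J(1)] J(2) zero by simp
      then have 0: "(\<Sum>i\<in>J. monom (a (b i)) i) = 0"
        using inj sum_eq[OF \<open>finite J\<close> J(1)] z by (auto dest: inj_onD)
      obtain j where j: "j \<in> J" "v = b j"
        using A(4) J(2) by auto
      have "coeff (\<Sum>i\<in>J. monom (a (b i)) i) j = a (b j)"
        using \<open>finite J\<close> j(1) by (simp add: coeff_sum)
      then show False
        using 0 j av by simp
    qed
  qed
  then have "V.dim = card (b ` {..<d})"
    by (intro V.dim_basis) auto
  then show ?thesis
    using injb by (simp add: card_image)
qed

text \<open>Evaluation at the generator identifies the homomorphisms from \<open>A e\<close> to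
  \<open>A e'\<close> with \<open>e A e'\<close>, which \<open>\<delta>\<close> parametrises. A
  scalar acts on homomorphisms through \<open>c \<odot> \<one>\<close>, and centrality of that
  element makes the result \<open>A\<close>-linear again.\<close>

lemma hom_dim_principal:
  fixes A :: "('k::field, 'a) module"
  assumes P: "principal_module A P e y" and P': "principal_module A P' e' y'"
    and scalar: "\<And>c. c \<odot>\<^bsub>A\<^esub> \<one>\<^bsub>A\<^esub> \<in> carrier A"
    and central: "\<And>c a. a \<in> carrier A \<Longrightarrow>
      (c \<odot>\<^bsub>A\<^esub> \<one>\<^bsub>A\<^esub>) \<otimes>\<^bsub>A\<^esub> a = a \<otimes>\<^bsub>A\<^esub> (c \<odot>\<^bsub>A\<^esub> \<one>\<^bsub>A\<^esub>)"
    and bij: "bij_betw \<delta> (poly_lt d) {a \<in> carrier A. e \<otimes>\<^bsub>A\<^esub> a = a \<and> a \<otimes>\<^bsub>A\<^esub> e' = a}"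
    and add: "\<And>p q. p \<in> poly_lt d \<Longrightarrow> q \<in> poly_lt d \<Longrightarrow> \<delta> (p + q) = \<delta> p \<oplus>\<^bsub>A\<^esub> \<delta> q"
    and smult: "\<And>c p. p \<in> poly_lt d \<Longrightarrow>
      \<delta> (Polynomial.smult c p) = (c \<odot>\<^bsub>A\<^esub> \<one>\<^bsub>A\<^esub>) \<otimes>\<^bsub>A\<^esub> \<delta> p"
  shows "hom_dim A P P' = d"
proof -
  interpret P: principal_module A P e y by fact
  interpret P': principal_module A P' e' y' by fact
  let ?H = "module_hom A P P' \<inter> extensional (carrier P)"
  have d: "\<delta> p \<in> carrier A" "e \<otimes>\<^bsub>A\<^esub> \<delta> p = \<delta> p" "\<delta> p \<otimes>\<^bsub>A\<^esub> e' = \<delta> p" if "p \<in> poly_lt d" for p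
    using bij_betw_apply[OF bij that] by auto
  have ext: "f = g" if "f \<in> ?H" "g \<in> ?H" "f y = g y" for f g
    using that P.hom_eqI[of f P' g] by (auto intro: extensionalityI)
  have ex: "\<exists>h\<in>?H. h y = \<delta> p \<odot>\<^bsub>P'\<^esub> y'" if p: "p \<in> poly_lt d" for p
  proof -
    have "e \<odot>\<^bsub>P'\<^esub> (\<delta> p \<odot>\<^bsub>P'\<^esub> y') = \<delta> p \<odot>\<^bsub>P'\<^esub> y'"
      using d[OF p] P.e_closed P'.y_closed by (simp flip: P'.smult_assoc)
    then obtain h where h: "h \<in> module_hom A P P'"
      "\<And>a. a \<in> carrier A \<Longrightarrow> h (a \<odot>\<^bsub>P\<^esub> y) = a \<odot>\<^bsub>P'\<^esub> (\<delta> p \<odot>\<^bsub>P'\<^esub> y')"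
      using P.hom_from[OF P'.left_module_axioms, of "\<delta> p \<odot>\<^bsub>P'\<^esub> y'"] d[OF p] P'.y_closed
        P'.smult_closed by auto
    have "restrict h (carrier P) \<in> ?H"
      using module_homD[OF h(1)] P.smult_closed by (auto intro!: module_homI)
    moreover have "restrict h (carrier P) y = \<delta> p \<odot>\<^bsub>P'\<^esub> y'"
      using h(2)[of "\<one>\<^bsub>A\<^esub>"] P.y_closed P'.y_closed d[OF p]
      by (simp add: P.smult_one P'.smult_one P'.smult_closed)
    ultimately show ?thesis by blast
  qed
  define \<gamma> where "\<gamma> p = (SOME h. h \<in> ?H \<and> h y = \<delta> p \<odot>\<^bsub>P'\<^esub> y')" for p
  have g: "\<gamma> p \<in> ?H \<and> \<gamma> p y = \<delta> p \<odot>\<^bsub>P'\<^esub> y'" if p: "p \<in> poly_lt d" for p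
  proof -
    have "\<exists>h. h \<in> ?H \<and> h y = \<delta> p \<odot>\<^bsub>P'\<^esub> y'"
      using ex[OF p] by blast
    then show ?thesis
      unfolding \<gamma>_def by (rule someI_ex)
  qed
  have gH: "\<gamma> p \<in> module_hom A P P'" if "p \<in> poly_lt d" for p
    using g[OF that] by blast
  let ?V = "hom_space A P P'"
  have "vectorspace.dim class_ring ?V = d"
  proof (rule dim_eqI[of \<gamma>])
    show "bij_betw \<gamma> (poly_lt d) (carrier ?V)"
      unfolding bij_betw_def
    proof
      show "inj_on \<gamma> (poly_lt d)"
      proof (rule inj_onI)
        fix p q assume pq: "p \<in> poly_lt d" "q \<in> poly_lt d" "\<gamma> p = \<gamma> q"
        then have "\<delta> p \<odot>\<^bsub>P'\<^esub> y' = \<delta> q \<odot>\<^bsub>P'\<^esub> y'"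
          using g by metis
        then have "\<delta> p = \<delta> q"
          using P'.smult_y_eq_iff d pq by simp
        then show "p = q"
          using bij pq by (auto simp: bij_betw_def dest: inj_onD)
      qed
      show "\<gamma> ` poly_lt d = carrier ?V"
      proof
        show "\<gamma> ` poly_lt d \<subseteq> carrier ?V"
          using g by (auto simp: hom_space_def)
        show "carrier ?V \<subseteq> \<gamma> ` poly_lt d"
        proof
          fix f assume "f \<in> carrier ?V"
          then have f: "f \<in> ?H"
            by (simp add: hom_space_def)
          then have fh: "f \<in> module_hom A P P'" by blast
          obtain c where c: "c \<in> carrier A" "f y = c \<odot>\<^bsub>P'\<^esub> y'"
            using P'.generates module_homD(1)[OF fh P.y_closed] by blast
          have "f y = e \<odot>\<^bsub>P'\<^esub> f y"
            using module_homD(3)[OF fh P.e_closed P.y_closed] P.e_y by simp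
          \<comment> \<open>The coefficient \<open>c\<close> may be replaced by
            \<open>e c e'\<close>, since \<open>f y = e (f y)\<close> and
            \<open>e' y' = y'\<close>.\<close>
          then have fy: "f y = (e \<otimes>\<^bsub>A\<^esub> c \<otimes>\<^bsub>A\<^esub> e') \<odot>\<^bsub>P'\<^esub> y'"
            using c P.e_closed P'.e_closed P'.y_closed P'.e_y by (simp add: P'.smult_assoc)
          have "e \<otimes>\<^bsub>A\<^esub> c \<otimes>\<^bsub>A\<^esub> e' \<in> {a \<in> carrier A. e \<otimes>\<^bsub>A\<^esub> a = a \<and> a \<otimes>\<^bsub>A\<^esub> e' = a}"
            using c P.e_closed P'.e_closed P.idempotent P'.idempotent
            by (auto simp: P.R.m_assoc) (simp flip: P.R.m_assoc)
          then have "e \<otimes>\<^bsub>A\<^esub> c \<otimes>\<^bsub>A\<^esub> e' \<in> \<delta> ` poly_lt d"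
            by (simp only: bij_betw_imp_surj_on[OF bij])
          then obtain p where p: "p \<in> poly_lt d" "\<delta> p = e \<otimes>\<^bsub>A\<^esub> c \<otimes>\<^bsub>A\<^esub> e'"
            by auto
          then have "f = \<gamma> p"
            using f g[OF p(1)] fy by (intro ext) auto
          then show "f \<in> \<gamma> ` poly_lt d"
            using p by blast
        qed
      qed
    qed
    have z: "(0 :: 'k poly) \<in> poly_lt d"
      by (simp add: poly_lt_def)
    have "\<delta> 0 \<oplus>\<^bsub>A\<^esub> \<delta> 0 = \<delta> 0"
      using add[OF z z] by simp
    then have d0: "\<delta> 0 = \<zero>\<^bsub>A\<^esub>"
      using d(1)[OF z] by simp
    show "\<gamma> 0 = \<zero>\<^bsub>?V\<^esub>"
    proof (rule ext)
      show "\<gamma> 0 \<in> ?H" "\<gamma> 0 y = \<zero>\<^bsub>?V\<^esub> y"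
        using g[OF z] P'.y_closed P.y_closed by (auto simp: d0 P'.smult_zero_left hom_space_def)
      show "\<zero>\<^bsub>?V\<^esub> \<in> ?H"
        using P.smult_closed by (auto intro!: module_homI simp: hom_space_def P'.smult_zero_right)
    qed
    fix p q :: "'k poly" assume p: "p \<in> poly_lt d" and q: "q \<in> poly_lt d"
    note h = module_homD[OF gH[OF p]] module_homD[OF gH[OF q]]
    show "\<gamma> (p + q) = \<gamma> p \<oplus>\<^bsub>?V\<^esub> \<gamma> q"
    proof (rule ext)
      have pq: "p + q \<in> poly_lt d"
        using p q by (auto simp: poly_lt_def)
      show "\<gamma> (p + q) \<in> ?H" "\<gamma> (p + q) y = (\<gamma> p \<oplus>\<^bsub>?V\<^esub> \<gamma> q) y"
        using g[OF pq] g[OF p] g[OF q] P.y_closed P'.y_closed d p q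
        by (auto simp: add P'.smult_l_distr hom_space_def)
      show "\<gamma> p \<oplus>\<^bsub>?V\<^esub> \<gamma> q \<in> ?H"
        using P.smult_closed h
        by (auto intro!: module_homI simp: hom_space_def P'.smult_r_distr P'.M.a_ac)
    qed
  next
    fix c :: 'k and p :: "'k poly" assume p: "p \<in> poly_lt d"
    note h = module_homD[OF gH[OF p]]
    show "\<gamma> (Polynomial.smult c p) = c \<odot>\<^bsub>?V\<^esub> \<gamma> p"
    proof (rule ext)
      have cp: "Polynomial.smult c p \<in> poly_lt d"
        using p by (auto simp: poly_lt_def)
      show "\<gamma> (Polynomial.smult c p) \<in> ?H"
        "\<gamma> (Polynomial.smult c p) y = (c \<odot>\<^bsub>?V\<^esub> \<gamma> p) y"
        using g[OF cp] g[OF p] P.y_closed P'.y_closed d p scalar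
        by (auto simp: smult P'.smult_assoc hom_space_def)
      show "c \<odot>\<^bsub>?V\<^esub> \<gamma> p \<in> ?H"
        using P.smult_closed h scalar central
        by (auto intro!: module_homI simp: hom_space_def P'.smult_r_distr P'.smult_closed
            simp flip: P'.smult_assoc)
    qed
  qed
  then show ?thesis
    by (simp add: hom_dim_def)
qed

section \<open>Matrices of minima\<close>

text \<open>With \<open>T\<close> an arbitrary bound for \<open>a\<close>, one range of summation
  serves all entries of a matrix, and the sums can be interchanged.\<close>

lemma min_eq_sum_of_bool:
  assumes "a \<le> T"
  shows "of_nat (min a b) = (\<Sum>t<T. of_bool (t < a) * of_bool (t < b) :: 'a::semiring_1)"
proof -
  have "(\<Sum>t<T. of_bool (t < a) * of_bool (t < b) :: 'a) = (\<Sum>t<T. of_bool (t < min a b))"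
    by (intro sum.cong) auto
  also have "\<dots> = (\<Sum>t\<in>{..<min a b}. 1)"
    using assms by (intro sum.mono_neutral_cong_right) auto
  finally show ?thesis by simp
qed

text \<open>
  As \<open>min a b\<close> is the number of \<open>t\<close> below both \<open>a\<close> and \<open>b\<close>, the quadratic form of the matrix is
  the sum over \<open>t\<close> of the squares of \<open>S t\<close>, the sum of the \<open>v j\<close> with \<open>t < l j\<close>.
\<close>

lemma min_matrix_injective:
  fixes v :: "nat \<Rightarrow> 'k::linordered_field"
  assumes inj: "inj_on l {..<n}" and pos: "\<And>i. i < n \<Longrightarrow> l i > 0"
    and zero: "\<And>i. i < n \<Longrightarrow> (\<Sum>j<n. of_nat (min (l i) (l j)) * v j) = 0"
    and i: "i < n"
  shows "v i = 0"
proof -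
  obtain T where T: "\<And>i. i < n \<Longrightarrow> l i \<le> T"
    using finite_nat_set_iff_bounded_le[of "l ` {..<n}"] by auto
  define S where "S t = (\<Sum>j<n. of_bool (t < l j) * v j)" for t
  have "(\<Sum>t<T. (S t)\<^sup>2) = (\<Sum>t<T. \<Sum>i<n. \<Sum>j<n. of_bool (t < l i) * v i * (of_bool (t < l j) * v j))"
    by (simp only: S_def power2_eq_square sum_product)
  also have "\<dots> = (\<Sum>i<n. \<Sum>t<T. \<Sum>j<n. of_bool (t < l i) * v i * (of_bool (t < l j) * v j))"
    by (rule sum.swap)
  also have "\<dots> = (\<Sum>i<n. \<Sum>j<n. \<Sum>t<T. of_bool (t < l i) * v i * (of_bool (t < l j) * v j))"
    by (intro sum.cong refl sum.swap)
  also have "\<dots> = (\<Sum>i<n. \<Sum>j<n. v i * (of_nat (min (l i) (l j)) * v j))"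
  proof (intro sum.cong refl)
    fix i j assume "i \<in> {..<n}"
    then have "l i \<le> T"
      using T by simp
    then show "(\<Sum>t<T. of_bool (t < l i) * v i * (of_bool (t < l j) * v j))
        = v i * (of_nat (min (l i) (l j)) * v j)"
      by (simp only: min_eq_sum_of_bool sum_distrib_left sum_distrib_right ac_simps)
  qed
  also have "\<dots> = (\<Sum>i<n. v i * (\<Sum>j<n. of_nat (min (l i) (l j)) * v j))"
    by (simp add: sum_distrib_left)
  also have "\<dots> = 0"
    using zero by simp
  finally have "S t = 0" if "t < T" for t
    using that by (subst (asm) sum_nonneg_eq_0_iff) auto
  moreover have "S t = 0" if "t \<ge> T" for t
    using T that unfolding S_def by (intro sum.neutral) fastforce
  ultimately have S: "S t = 0" for t
    by (meson not_le)
  have "v i = (\<Sum>j<n. if j = i then v j else 0)"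
    using i by simp
  \<comment> \<open>The condition \<open>l i - 1 < l j\<close> holds and \<open>l i < l j\<close>
    fails exactly if \<open>l j = l i\<close>, that is, for \<open>j = i\<close> by injectivity.
    Positivity of \<open>l i\<close> prevents the truncation of \<open>l i - 1\<close>.\<close>
  also have "\<dots> = (\<Sum>j<n. of_bool (l i - 1 < l j) * v j - of_bool (l i < l j) * v j)"
  proof (intro sum.cong refl)
    fix j assume j: "j \<in> {..<n}"
    have "l i = l j \<longleftrightarrow> j = i"
      using inj i j by (auto dest: inj_onD)
    moreover have "l i - 1 < l j \<longleftrightarrow> l i \<le> l j"
      using pos[OF i] by auto
    ultimately show "(if j = i then v j else 0) = of_bool (l i - 1 < l j) * v j - of_bool (l i < l j) * v j"
      by (auto simp: of_bool_def)
  qed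
  also have "\<dots> = S (l i - 1) - S (l i)"
    by (simp add: S_def sum_subtractf)
  finally show ?thesis
    using S by simp
qed

text \<open>
  The column of \<open>i0\<close> consists of ones, so the row sums of the inverse form the unit vector at \<open>i0\<close>.
\<close>

lemma sum_mat_inverse_min_matrix:
  assumes inj: "inj_on l {..<n}" and pos: "\<And>i. i < n \<Longrightarrow> l i > 0"
    and i0: "i0 < n" "l i0 = 1"
  shows "map_option sum_mat (mat_inverse (mat n n (\<lambda>(i, j). of_nat (min (l i) (l j))) :: rat mat)) = Some 1"
proof -
  define A :: "rat mat" where "A = mat n n (\<lambda>(i, j). of_nat (min (l i) (l j)))"
  have A: "A \<in> carrier_mat n n"
    by (simp add: A_def)
  have "det A \<noteq> 0"
  proof
    assume "det A = 0"
    then obtain v where v: "v \<in> carrier_vec n" "v \<noteq> 0\<^sub>v n" "A *\<^sub>v v = 0\<^sub>v n"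
      using det_0_iff_vec_prod_zero_field[OF A] by auto
    have "v $ i = 0" if "i < n" for i
    proof (rule min_matrix_injective[OF inj pos _ that])
      fix i assume i: "i < n"
      have "0 = (A *\<^sub>v v) $ i"
        using v i by simp
      also have "\<dots> = (\<Sum>j<n. of_nat (min (l i) (l j)) * v $ j)"
        using i v(1) by (simp add: A_def scalar_prod_def atLeast0LessThan)
      finally show "(\<Sum>j<n. of_nat (min (l i) (l j)) * v $ j) = 0" by simp
    qed auto
    then have "v = 0\<^sub>v n"
      using v(1) by auto
    then show False
      using v(2) by simp
  qed
  then have "A \<in> Units (ring_mat TYPE(rat) n ())"
    by (rule det_non_zero_imp_unit[OF A])
  then obtain B where B: "mat_inverse A = Some B"
    using mat_inverse(1)[OF A, where b = "()"] by (cases "mat_inverse A") auto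
  then have BA: "B * A = 1\<^sub>m n" and Bc: "B \<in> carrier_mat n n"
    using mat_inverse(2)[OF A] by auto
  have row: "(\<Sum>j<n. B $$ (i, j)) = of_bool (i = i0)" if i: "i < n" for i
  proof -
    have "of_bool (i = i0) = (B * A) $$ (i, i0)"
      using i i0 BA by simp
    also have "\<dots> = (\<Sum>j<n. B $$ (i, j) * of_nat (min (l j) (l i0)))"
      using i i0 Bc by (simp add: A_def scalar_prod_def atLeast0LessThan)
    also have "\<dots> = (\<Sum>j<n. B $$ (i, j))"
    proof (intro sum.cong refl)
      fix j assume "j \<in> {..<n}"
      then have "min (l j) (l i0) = 1"
        using pos[of j] i0 by auto
      then show "B $$ (i, j) * of_nat (min (l j) (l i0)) = B $$ (i, j)"
        by simp
    qed
    finally show ?thesis by simp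
  qed
  have "sum_mat B = (\<Sum>i<n. \<Sum>j<n. B $$ (i, j))"
    using Bc by (simp add: sum_mat_def sum.cartesian_product atLeast0LessThan)
  also have "\<dots> = (\<Sum>i<n. of_bool (i = i0))"
    using row by simp
  also have "\<dots> = 1"
    using i0 by (simp add: of_bool_def)
  finally show ?thesis
    using B by (simp add: A_def)
qed

section \<open>Modules over a truncated polynomial ring\<close>

text \<open>An inverse modulo \<open>X^l\<close> is corrected in degree \<open>l\<close>. If
  \<open>q p - 1 = X^l r\<close>, then subtracting \<open>c X^l\<close> from \<open>q\<close>
  changes \<open>r\<close> into \<open>r - c p\<close>, and \<open>c\<close> is chosen such that its
  constant coefficient vanishes.\<close>

lemma poly_unit_modulo_monom:
  fixes p :: "'k::field poly"
  assumes "coeff p 0 \<noteq> 0"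
  shows "\<exists>q. monom 1 l dvd q * p - 1"
proof (induction l)
  case (Suc l)
  then obtain q r where r: "q * p - 1 = monom 1 l * r"
    by (auto elim: dvdE)
  define c where "c = coeff r 0 / coeff p 0"
  have "(q - monom c l) * p - 1 = monom 1 l * (r - Polynomial.smult c p)"
  proof -
    have "monom c l = Polynomial.smult c (monom 1 l)"
      by (simp add: smult_monom)
    then show ?thesis
      using r by (simp add: algebra_simps)
  qed
  moreover have "coeff (r - Polynomial.smult c p) 0 = 0"
    using assms by (simp add: c_def)
  then have "monom 1 1 dvd r - Polynomial.smult c p"
    by (simp add: monom_1_dvd_iff')
  ultimately have "monom 1 l * monom 1 1 dvd (q - monom c l) * p - 1"
    by (metis mult_dvd_mono dvd_refl)
  then show ?case
    by (auto simp: mult_monom)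
qed simp

text \<open>Through \<open>\<Phi>\<close> the algebra is a quotient of \<open>k[X]\<close> by the
  ideal of a power of \<open>X\<close>, whose exponent is at most \<open>m\<close>.
  \<open>Phi_augmented\<close> keeps the kernel inside the ideal of \<open>X\<close>, so that
  constant coefficients are well defined on \<open>A\<close>.\<close>

locale truncated_polynomial_ring = ring A for A :: "('k::field, 'a) module" (structure) +
  fixes \<Phi> :: "'k poly \<Rightarrow> 'a" and m :: nat
  assumes Phi_closed: "\<Phi> p \<in> carrier A"
    and Phi_add: "\<Phi> (p + q) = \<Phi> p \<oplus>\<^bsub>A\<^esub> \<Phi> q"
    and Phi_mult: "\<Phi> (p * q) = \<Phi> p \<otimes>\<^bsub>A\<^esub> \<Phi> q"
    and Phi_1: "\<Phi> 1 = \<one>\<^bsub>A\<^esub>"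
    and Phi_surj: "a \<in> carrier A \<Longrightarrow> \<exists>p. a = \<Phi> p"
    and Phi_scalar: "\<Phi> [:c:] = c \<odot>\<^bsub>A\<^esub> \<one>\<^bsub>A\<^esub>"
    and Phi_nilpotent: "\<Phi> (monom 1 m) = \<zero>\<^bsub>A\<^esub>"
    and Phi_augmented: "\<Phi> p = \<Phi> q \<Longrightarrow> coeff p 0 = coeff q 0"
begin

lemma Phi_0: "\<Phi> 0 = \<zero>\<^bsub>A\<^esub>"
  using Phi_add[of 0 0] Phi_closed[of 0] by simp

lemma commutative: "a \<in> carrier A \<Longrightarrow> b \<in> carrier A \<Longrightarrow> a \<otimes>\<^bsub>A\<^esub> b = b \<otimes>\<^bsub>A\<^esub> a"
  using Phi_surj by (metis Phi_mult mult.commute)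

text \<open>\<open>M = A x\<close> is a copy of \<open>k[X] / (X^l)\<close>. The annihilator of
  \<open>x\<close> is described by polynomials, where divisibility by \<open>X^l\<close> is a matter
  of coefficients.\<close>

definition cyclic :: "('a, 'n) module \<Rightarrow> 'n \<Rightarrow> nat \<Rightarrow> bool" where
  "cyclic M x l \<longleftrightarrow> left_module A M \<and> 0 < l \<and> x \<in> carrier M \<and>
     (\<forall>y\<in>carrier M. \<exists>p. y = \<Phi> p \<odot>\<^bsub>M\<^esub> x) \<and>
     (\<forall>p. \<Phi> p \<odot>\<^bsub>M\<^esub> x = \<zero>\<^bsub>M\<^esub> \<longleftrightarrow> monom 1 l dvd p)"

context
  fixes M :: "('a, 'n) module" assumes M: "left_module A M"
begin

interpretation M: left_module A M by (rule M)

lemma act_closed: "x \<in> carrier M \<Longrightarrow> \<Phi> p \<odot>\<^bsub>M\<^esub> x \<in> carrier M"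
  by (simp add: M.smult_closed Phi_closed)

lemma act_add: "x \<in> carrier M \<Longrightarrow> \<Phi> (p + q) \<odot>\<^bsub>M\<^esub> x = \<Phi> p \<odot>\<^bsub>M\<^esub> x \<oplus>\<^bsub>M\<^esub> \<Phi> q \<odot>\<^bsub>M\<^esub> x"
  by (simp add: M.smult_l_distr Phi_closed Phi_add)

lemma act_mult: "x \<in> carrier M \<Longrightarrow> \<Phi> (p * q) \<odot>\<^bsub>M\<^esub> x = \<Phi> p \<odot>\<^bsub>M\<^esub> (\<Phi> q \<odot>\<^bsub>M\<^esub> x)"
  by (simp add: M.smult_assoc Phi_closed Phi_mult)

lemma act_1: "x \<in> carrier M \<Longrightarrow> \<Phi> 1 \<odot>\<^bsub>M\<^esub> x = x"
  by (simp add: M.smult_one Phi_1)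

lemma act_0: "x \<in> carrier M \<Longrightarrow> \<Phi> 0 \<odot>\<^bsub>M\<^esub> x = \<zero>\<^bsub>M\<^esub>"
  by (simp add: M.smult_zero_left Phi_0)

lemma act_zero: "\<Phi> p \<odot>\<^bsub>M\<^esub> \<zero>\<^bsub>M\<^esub> = \<zero>\<^bsub>M\<^esub>"
  by (simp add: M.smult_zero_right Phi_closed)

lemma act_diff: "x \<in> carrier M \<Longrightarrow> \<Phi> (p - q) \<odot>\<^bsub>M\<^esub> x = \<Phi> p \<odot>\<^bsub>M\<^esub> x \<ominus>\<^bsub>M\<^esub> \<Phi> q \<odot>\<^bsub>M\<^esub> x"
proof -
  assume x: "x \<in> carrier M"
  have "\<Phi> p \<odot>\<^bsub>M\<^esub> x = \<Phi> (p - q) \<odot>\<^bsub>M\<^esub> x \<oplus>\<^bsub>M\<^esub> \<Phi> q \<odot>\<^bsub>M\<^esub> x"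
    using act_add[OF x, of "p - q" q] by simp
  then show ?thesis
    using act_closed[OF x, of "p - q"] act_closed[OF x, of q]
    by (simp add: M.M.minus_eq M.M.a_assoc M.M.r_neg)
qed

lemma act_minus: "x \<in> carrier M \<Longrightarrow> y \<in> carrier M \<Longrightarrow>
    \<Phi> p \<odot>\<^bsub>M\<^esub> (x \<ominus>\<^bsub>M\<^esub> y) = \<Phi> p \<odot>\<^bsub>M\<^esub> x \<ominus>\<^bsub>M\<^esub> \<Phi> p \<odot>\<^bsub>M\<^esub> y"
  by (simp add: M.smult_diff_right Phi_closed)

lemma act_eqI:
  assumes "x \<in> carrier M" "r dvd p - q" "\<Phi> r \<odot>\<^bsub>M\<^esub> x = \<zero>\<^bsub>M\<^esub>"
  shows "\<Phi> p \<odot>\<^bsub>M\<^esub> x = \<Phi> q \<odot>\<^bsub>M\<^esub> x"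
proof -
  obtain s where s: "p - q = s * r"
    using assms(2) by (metis dvdE mult.commute)
  have "\<Phi> p \<odot>\<^bsub>M\<^esub> x = \<Phi> (s * r + q) \<odot>\<^bsub>M\<^esub> x"
    by (simp flip: s)
  then show ?thesis
    using assms act_closed by (simp add: act_add act_mult act_zero)
qed

lemma act_scalar_eq_zero_iff:
  assumes "x \<in> carrier M" "c \<noteq> 0"
  shows "\<Phi> [:c:] \<odot>\<^bsub>M\<^esub> x = \<zero>\<^bsub>M\<^esub> \<longleftrightarrow> x = \<zero>\<^bsub>M\<^esub>"
proof
  assume "\<Phi> [:c:] \<odot>\<^bsub>M\<^esub> x = \<zero>\<^bsub>M\<^esub>"
  then have "\<Phi> ([:inverse c:] * [:c:]) \<odot>\<^bsub>M\<^esub> x = \<zero>\<^bsub>M\<^esub>"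
    using assms(1) by (simp only: act_mult act_zero)
  moreover have "[:inverse c:] * [:c:] = 1"
    using assms(2) by (simp add: pCons_one)
  ultimately show "x = \<zero>\<^bsub>M\<^esub>"
    using assms(1) by (simp add: act_1)
qed (simp add: act_zero)

text \<open>\<open>H\<close> is merely a linear subspace, which \<open>X\<close> may fail to
  preserve; therefore all \<open>X^i z\<close> are asked to lie in it. The induction follows
  Horner's scheme \<open>(c + X p) z = c z + p (X z)\<close>, whence the generalisation over
  \<open>z\<close>.\<close>

lemma submodule_scalar:
  assumes "\<And>c y. y \<in> H \<Longrightarrow> \<Phi> [:c:] \<odot>\<^bsub>M\<^esub> y \<in> H" "\<And>y z. y \<in> H \<Longrightarrow> z \<in> H \<Longrightarrow> y \<oplus>\<^bsub>M\<^esub> z \<in> H"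
    and "\<zero>\<^bsub>M\<^esub> \<in> H" and "\<And>i. \<Phi> (monom 1 i) \<odot>\<^bsub>M\<^esub> z \<in> H" and "z \<in> carrier M"
  shows "\<Phi> p \<odot>\<^bsub>M\<^esub> z \<in> H"
  using assms(4,5)
proof (induction p arbitrary: z)
  case 0
  then show ?case
    using assms(3) by (simp add: act_0)
next
  case (pCons c p)
  let ?w = "\<Phi> (monom 1 1) \<odot>\<^bsub>M\<^esub> z"
  have "\<Phi> (monom 1 i) \<odot>\<^bsub>M\<^esub> ?w \<in> H" for i
    using pCons.prems(1)[of "Suc i"] pCons.prems(2) by (simp add: mult_monom flip: act_mult)
  then have "\<Phi> p \<odot>\<^bsub>M\<^esub> ?w \<in> H"
    using pCons.prems(2) act_closed by (intro pCons.IH) auto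
  moreover have "\<Phi> [:c:] \<odot>\<^bsub>M\<^esub> z \<in> H"
    using pCons.prems(1)[of 0] pCons.prems(2) assms(1)[of z c]
    by (simp add: act_1 flip: monom_0 )
  moreover have "\<Phi> (pCons c p) \<odot>\<^bsub>M\<^esub> z = \<Phi> [:c:] \<odot>\<^bsub>M\<^esub> z \<oplus>\<^bsub>M\<^esub> \<Phi> p \<odot>\<^bsub>M\<^esub> ?w"
    using pCons.prems(2) by (simp add: monom_Suc flip: act_mult act_add)
  ultimately show ?case
    using assms(2) by simp
qed

text \<open>
  If \<open>X\<^sup>l\<^sup>-\<^sup>1\<close> does not kill \<open>x\<close> but \<open>X\<^sup>l\<close> kills \<open>M\<close>, then \<open>A x\<close> has a complement: the largest
  submodule inside a hyperplane of \<open>M\<close> that avoids \<open>X\<^sup>l\<^sup>-\<^sup>1 x\<close>.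
\<close>

lemma indecomposable_imp_cyclic:
  assumes indec: "indecomposable A M"
  obtains x l where "cyclic M x l"
proof -
  let ?X = "\<lambda>i. monom (1 :: 'k) i"
  \<comment> \<open>The nilpotency index of \<open>X\<close> on \<open>M\<close>; it will be the
    length of \<open>M\<close>.\<close>
  define l where "l = (LEAST l. \<forall>y\<in>carrier M. \<Phi> (?X l) \<odot>\<^bsub>M\<^esub> y = \<zero>\<^bsub>M\<^esub>)"
  have "\<forall>y\<in>carrier M. \<Phi> (?X m) \<odot>\<^bsub>M\<^esub> y = \<zero>\<^bsub>M\<^esub>"
    by (simp add: Phi_nilpotent M.smult_zero_left)
  then have l: "\<forall>y\<in>carrier M. \<Phi> (?X l) \<odot>\<^bsub>M\<^esub> y = \<zero>\<^bsub>M\<^esub>"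
    unfolding l_def by (rule LeastI)
  have lpos: "0 < l"
  proof (rule ccontr)
    assume "\<not> 0 < l"
    then have "carrier M = {\<zero>\<^bsub>M\<^esub>}"
      using l act_1 by auto
    then show False
      using indec by (simp add: indecomposable_def)
  qed
  have kill: "\<Phi> (monom c i) \<odot>\<^bsub>M\<^esub> y = \<zero>\<^bsub>M\<^esub>" if "y \<in> carrier M" "i \<ge> l" for y i c
  proof -
    have "monom c i = monom c (i - l) * ?X l"
      using that by (simp add: mult_monom)
    then show ?thesis
      using that l by (simp add: act_mult act_zero)
  qed
  have "\<not> (\<forall>y\<in>carrier M. \<Phi> (?X (l - 1)) \<odot>\<^bsub>M\<^esub> y = \<zero>\<^bsub>M\<^esub>)"
    using not_less_Least[of "l - 1" "\<lambda>l. \<forall>y\<in>carrier M. \<Phi> (?X l) \<odot>\<^bsub>M\<^esub> y = \<zero>\<^bsub>M\<^esub>"] lpos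
    by (simp flip: l_def)
  then obtain x where x: "x \<in> carrier M" "\<Phi> (?X (l - 1)) \<odot>\<^bsub>M\<^esub> x \<noteq> \<zero>\<^bsub>M\<^esub>"
    by blast
  define s where "s = \<Phi> (?X (l - 1)) \<odot>\<^bsub>M\<^esub> x"
  have s: "s \<in> carrier M" "s \<noteq> \<zero>\<^bsub>M\<^esub>"
    using x act_closed by (auto simp: s_def)
  have top: "\<Phi> (monom c (l - 1)) \<odot>\<^bsub>M\<^esub> x = \<Phi> [:c:] \<odot>\<^bsub>M\<^esub> s" for c
    using x(1) by (simp add: s_def smult_monom flip: act_mult)
  \<comment> \<open>Every nonzero element \<open>p x\<close> is carried to a nonzero multiple of
    \<open>s\<close> by a power of \<open>X\<close>: if \<open>j\<close> is the lowest degree that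
    occurs in \<open>p\<close>, then multiplication by \<open>X^(l-1-j)\<close> moves that term to
    degree \<open>l - 1\<close> and kills all others.\<close>
  have socle: "\<exists>c i. c \<noteq> 0 \<and> \<Phi> (?X i) \<odot>\<^bsub>M\<^esub> (\<Phi> p \<odot>\<^bsub>M\<^esub> x) = \<Phi> [:c:] \<odot>\<^bsub>M\<^esub> s" if np: "\<not> ?X l dvd p" for p
  proof -
    define j where "j = (LEAST j. coeff p j \<noteq> 0)"
    obtain k where k: "k < l" "coeff p k \<noteq> 0"
      using np by (auto simp: monom_1_dvd_iff')
    have j: "coeff p j \<noteq> 0" "j \<le> k"
      using LeastI[of "\<lambda>j. coeff p j \<noteq> 0", OF k(2)] Least_le[of "\<lambda>j. coeff p j \<noteq> 0", OF k(2)]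
      by (auto simp: j_def)
    have below: "coeff p i = 0" if "i < j" for i
      using not_less_Least[of i "\<lambda>j. coeff p j \<noteq> 0"] that by (auto simp: j_def)
    let ?i = "l - 1 - j"
    have "?X l dvd ?X ?i * p - monom (coeff p j) (l - 1)"
      unfolding monom_1_dvd_iff'
    proof (intro allI impI)
      fix i assume "i < l"
      then show "coeff (?X ?i * p - monom (coeff p j) (l - 1)) i = 0"
        using below j(2) k(1) by (cases "i = l - 1") (auto simp: coeff_monom_mult)
    qed
    then have "\<Phi> (?X ?i * p) \<odot>\<^bsub>M\<^esub> x = \<Phi> (monom (coeff p j) (l - 1)) \<odot>\<^bsub>M\<^esub> x"
      using act_eqI[OF x(1)] l x(1) by blast
    then have "\<Phi> (?X ?i) \<odot>\<^bsub>M\<^esub> (\<Phi> p \<odot>\<^bsub>M\<^esub> x) = \<Phi> [:coeff p j:] \<odot>\<^bsub>M\<^esub> s"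
      using x(1) by (simp only: act_mult top)
    then show ?thesis
      using j(1) by blast
  qed
  \<comment> \<open>Linear subspaces, in general no submodules, that avoid \<open>s\<close>. A
    maximal one turns out to be a hyperplane complementary to the line through
    \<open>s\<close>.\<close>
  define \<H> where "\<H> = {H. H \<subseteq> carrier M \<and> \<zero>\<^bsub>M\<^esub> \<in> H \<and> s \<notin> H \<and> (\<forall>y\<in>H. \<forall>z\<in>H. y \<oplus>\<^bsub>M\<^esub> z \<in> H) \<and>
    (\<forall>c. \<forall>y\<in>H. \<Phi> [:c:] \<odot>\<^bsub>M\<^esub> y \<in> H)}"
  have "\<exists>H\<in>\<H>. \<forall>H'\<in>\<H>. H \<subseteq> H' \<longrightarrow> H' = H"
  proof (rule subset_Zorn_nonempty)
    have "{\<zero>\<^bsub>M\<^esub>} \<in> \<H>"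
      using s by (auto simp: \<H>_def act_zero)
    then show "\<H> \<noteq> {}"
      by blast
    fix \<C> assume C: "\<C> \<noteq> {}" "subset.chain \<H> \<C>"
    then have CH: "\<C> \<subseteq> \<H>" and lin: "\<And>Y Z. Y \<in> \<C> \<Longrightarrow> Z \<in> \<C> \<Longrightarrow> Y \<subseteq> Z \<or> Z \<subseteq> Y"
      by (auto simp: subset_chain_def)
    have H: "\<And>Y. Y \<in> \<C> \<Longrightarrow> Y \<in> \<H>"
      using CH by blast
    have "y \<oplus>\<^bsub>M\<^esub> z \<in> \<Union>\<C>" if "y \<in> \<Union>\<C>" "z \<in> \<Union>\<C>" for y z
    proof -
      from that obtain Y Z where yz: "y \<in> Y" "Y \<in> \<C>" "z \<in> Z" "Z \<in> \<C>"
        by blast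
      obtain W where "W \<in> \<C>" "y \<in> W" "z \<in> W"
        using lin[OF yz(2,4)] yz by blast
      then show ?thesis
        using H[of W] by (auto simp: \<H>_def)
    qed
    moreover have "\<zero>\<^bsub>M\<^esub> \<in> \<Union>\<C>"
      using C(1) H by (auto simp: \<H>_def)
    moreover have "\<Union>\<C> \<subseteq> carrier M" "s \<notin> \<Union>\<C>"
      using H unfolding \<H>_def by blast+
    moreover have "\<Phi> [:c:] \<odot>\<^bsub>M\<^esub> y \<in> \<Union>\<C>" if "y \<in> \<Union>\<C>" for c y
      using that H unfolding \<H>_def by blast
    ultimately show "\<Union>\<C> \<in> \<H>"
      unfolding \<H>_def by (intro CollectI conjI ballI allI) assumption+
  qed
  then obtain H where "H \<in> \<H>" and maximal: "\<And>H'. H' \<in> \<H> \<Longrightarrow> H \<subseteq> H' \<Longrightarrow> H' = H"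
    by blast
  then have HM: "H \<subseteq> carrier M" and H0: "\<zero>\<^bsub>M\<^esub> \<in> H" and Hs: "s \<notin> H"
    and Hadd: "\<And>y z. y \<in> H \<Longrightarrow> z \<in> H \<Longrightarrow> y \<oplus>\<^bsub>M\<^esub> z \<in> H"
    and Hscalar: "\<And>c y. y \<in> H \<Longrightarrow> \<Phi> [:c:] \<odot>\<^bsub>M\<^esub> y \<in> H"
    by (auto simp: \<H>_def)
  have hyperplane: "\<exists>c. \<exists>h\<in>H. y = h \<oplus>\<^bsub>M\<^esub> \<Phi> [:c:] \<odot>\<^bsub>M\<^esub> s" if y: "y \<in> carrier M" for y
  proof (cases "y \<in> H")
    case True
    then show ?thesis
      using y s(1) by (intro exI[of _ 0] bexI[of _ y]) (auto simp: act_0)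
  next
    case False
    \<comment> \<open>The span of \<open>H\<close> and \<open>y\<close> exceeds \<open>H\<close>, so
      it contains \<open>s\<close> by maximality. The coefficient \<open>c\<close> of
      \<open>y\<close> in \<open>s\<close> is nonzero because \<open>s\<close> is not in
      \<open>H\<close>, and the equation can be solved for \<open>y\<close>.\<close>
    define K where "K = {h \<oplus>\<^bsub>M\<^esub> \<Phi> [:c:] \<odot>\<^bsub>M\<^esub> y | h c. h \<in> H}"
    have "H \<subseteq> K"
    proof
      fix h assume "h \<in> H"
      then show "h \<in> K"
        using HM y unfolding K_def by (intro CollectI exI[of _ h] exI[of _ 0]) (auto simp: act_0)
    qed
    moreover have "y \<in> K"
      using H0 y unfolding K_def
      by (intro CollectI exI[of _ "\<zero>\<^bsub>M\<^esub>"] exI[of _ 1]) (auto simp: act_1 act_closed simp flip: one_pCons)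
    ultimately have "K \<notin> \<H>"
      using maximal False by blast
    moreover have "K \<subseteq> carrier M" "\<zero>\<^bsub>M\<^esub> \<in> K"
      using HM y act_closed \<open>H \<subseteq> K\<close> H0 by (auto simp: K_def)
    moreover have "u \<oplus>\<^bsub>M\<^esub> v \<in> K" if uv: "u \<in> K" "v \<in> K" for u v
    proof -
      obtain h c h' c' where "h \<in> H" "u = h \<oplus>\<^bsub>M\<^esub> \<Phi> [:c:] \<odot>\<^bsub>M\<^esub> y" "h' \<in> H" "v = h' \<oplus>\<^bsub>M\<^esub> \<Phi> [:c':] \<odot>\<^bsub>M\<^esub> y"
        using uv unfolding K_def by blast
      moreover from this have "h \<in> carrier M" "h' \<in> carrier M"
        using HM by auto
      ultimately have "u \<oplus>\<^bsub>M\<^esub> v = (h \<oplus>\<^bsub>M\<^esub> h') \<oplus>\<^bsub>M\<^esub> \<Phi> ([:c:] + [:c':]) \<odot>\<^bsub>M\<^esub> y"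
        using act_closed y by (simp only: act_add M.M.a_ac M.M.a_closed)
      then show ?thesis
        using Hadd \<open>h \<in> H\<close> \<open>h' \<in> H\<close> unfolding K_def by auto
    qed
    moreover have "\<Phi> [:c:] \<odot>\<^bsub>M\<^esub> u \<in> K" if u: "u \<in> K" for c u
    proof -
      obtain h d where h: "h \<in> H" "u = h \<oplus>\<^bsub>M\<^esub> \<Phi> [:d:] \<odot>\<^bsub>M\<^esub> y"
        using u unfolding K_def by blast
      then have "\<Phi> [:c:] \<odot>\<^bsub>M\<^esub> u = \<Phi> [:c:] \<odot>\<^bsub>M\<^esub> h \<oplus>\<^bsub>M\<^esub> \<Phi> ([:c:] * [:d:]) \<odot>\<^bsub>M\<^esub> y"
        using HM y act_closed by (auto simp only: act_mult M.smult_r_distr Phi_closed)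
      then show ?thesis
        using Hscalar[OF h(1)] unfolding K_def by auto
    qed
    ultimately have "s \<in> K"
      unfolding \<H>_def by blast
    then obtain h c where h: "h \<in> H" "s = h \<oplus>\<^bsub>M\<^esub> \<Phi> [:c:] \<odot>\<^bsub>M\<^esub> y"
      by (auto simp: K_def)
    have hM: "h \<in> carrier M"
      using h HM by auto
    have c: "c \<noteq> 0"
      using h Hs hM y by (auto simp: act_0)
    have "\<Phi> [:inverse c:] \<odot>\<^bsub>M\<^esub> s = \<Phi> [:inverse c:] \<odot>\<^bsub>M\<^esub> h \<oplus>\<^bsub>M\<^esub> \<Phi> ([:inverse c:] * [:c:]) \<odot>\<^bsub>M\<^esub> y"
      using hM y act_closed by (subst h(2)) (simp only: act_mult M.smult_r_distr Phi_closed)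
    also have "[:inverse c:] * [:c:] = 1"
      using c by (simp add: pCons_one)
    finally have "\<Phi> [:inverse c:] \<odot>\<^bsub>M\<^esub> s = \<Phi> [:inverse c:] \<odot>\<^bsub>M\<^esub> h \<oplus>\<^bsub>M\<^esub> y"
      using y by (simp add: act_1)
    moreover have "\<Phi> [:- inverse c:] \<odot>\<^bsub>M\<^esub> h = \<ominus>\<^bsub>M\<^esub> (\<Phi> [:inverse c:] \<odot>\<^bsub>M\<^esub> h)"
      using act_diff[OF hM, of 0 "[:inverse c:]"] hM act_closed by (simp add: act_0 M.M.minus_eq)
    ultimately have "y = \<Phi> [:- inverse c:] \<odot>\<^bsub>M\<^esub> h \<oplus>\<^bsub>M\<^esub> \<Phi> [:inverse c:] \<odot>\<^bsub>M\<^esub> s"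
      using hM y act_closed by (simp add: M.M.l_neg flip: M.M.a_assoc)
    then show ?thesis
      using Hscalar[OF h(1)] by blast
  qed
  define U where "U = {\<Phi> p \<odot>\<^bsub>M\<^esub> x | p. True}"
  \<comment> \<open>The largest submodule inside \<open>H\<close>. It meets \<open>U\<close>
    trivially because by \<open>socle\<close> every nonzero submodule of \<open>U\<close> contains
    \<open>s\<close>.\<close>
  define C where "C = {y \<in> carrier M. \<forall>p. \<Phi> p \<odot>\<^bsub>M\<^esub> y \<in> H}"
  have U: "Module.submodule U A M"
  proof (rule M.submoduleI)
    show "U \<subseteq> carrier M"
      using x act_closed by (auto simp: U_def)
    show "\<zero>\<^bsub>M\<^esub> \<in> U"
      using act_0[OF x(1)] unfolding U_def by (metis (mono_tags, lifting) mem_Collect_eq)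
    show "y \<oplus>\<^bsub>M\<^esub> z \<in> U" if yz: "y \<in> U" "z \<in> U" for y z
    proof -
      obtain p q where "y = \<Phi> p \<odot>\<^bsub>M\<^esub> x" "z = \<Phi> q \<odot>\<^bsub>M\<^esub> x"
        using yz by (auto simp: U_def)
      then have "y \<oplus>\<^bsub>M\<^esub> z = \<Phi> (p + q) \<odot>\<^bsub>M\<^esub> x"
        using act_add[OF x(1)] by simp
      then show ?thesis
        unfolding U_def by blast
    qed
    show "a \<odot>\<^bsub>M\<^esub> z \<in> U" if az: "a \<in> carrier A" "z \<in> U" for a z
    proof -
      obtain p q where "a = \<Phi> p" "z = \<Phi> q \<odot>\<^bsub>M\<^esub> x"
        using az Phi_surj[OF az(1)] by (auto simp: U_def)
      then have "a \<odot>\<^bsub>M\<^esub> z = \<Phi> (p * q) \<odot>\<^bsub>M\<^esub> x"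
        using act_mult[OF x(1)] by simp
      then show ?thesis
        unfolding U_def by blast
    qed
  qed
  have C: "Module.submodule C A M"
  proof (rule M.submoduleI)
    show "a \<odot>\<^bsub>M\<^esub> z \<in> C" if "a \<in> carrier A" "z \<in> C" for a z
      using that Phi_surj[OF that(1)] by (auto simp: C_def act_closed simp flip: act_mult)
  qed (use H0 Hadd act_closed in \<open>auto simp: C_def act_zero M.smult_r_distr Phi_closed\<close>)
  have UC: "U \<inter> C = {\<zero>\<^bsub>M\<^esub>}"
  proof -
    have "y = \<zero>\<^bsub>M\<^esub>" if y: "y \<in> U" "y \<in> C" for y
    proof (rule ccontr)
      assume ny: "y \<noteq> \<zero>\<^bsub>M\<^esub>"
      obtain p where p: "y = \<Phi> p \<odot>\<^bsub>M\<^esub> x"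
        using y by (auto simp: U_def)
      have "\<not> ?X l dvd p"
        using act_eqI[OF x(1), of "?X l" p 0] l x(1) ny p by (auto simp: act_0)
      then obtain c i where c: "c \<noteq> 0" "\<Phi> (?X i) \<odot>\<^bsub>M\<^esub> y = \<Phi> [:c:] \<odot>\<^bsub>M\<^esub> s"
        using socle p by blast
      have "\<Phi> [:c:] \<odot>\<^bsub>M\<^esub> s \<in> H"
        using y(2) c(2) by (metis (no_types, lifting) C_def mem_Collect_eq)
      then have "\<Phi> [:inverse c:] \<odot>\<^bsub>M\<^esub> (\<Phi> [:c:] \<odot>\<^bsub>M\<^esub> s) \<in> H"
        by (rule Hscalar)
      then have "\<Phi> ([:inverse c:] * [:c:]) \<odot>\<^bsub>M\<^esub> s \<in> H"
        using s(1) by (simp only: act_mult)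
      moreover have "[:inverse c:] * [:c:] = 1"
        using c(1) by (simp add: pCons_one)
      ultimately show False
        using s(1) Hs by (simp add: act_1)
    qed
    then show ?thesis
      using M.submoduleD(2)[OF U] M.submoduleD(2)[OF C] by blast
  qed
  \<comment> \<open>The polynomial \<open>p\<close> is built degree by degree, while the condition
    extends to lower and lower powers of \<open>X\<close>. The condition for
    \<open>X^(l-1-j)\<close> determines the coefficient \<open>c\<close> of \<open>X^j\<close>, as
    \<open>X^(l-1-j)\<close> takes \<open>c X^j x\<close> to \<open>c s\<close>; the higher powers
    take it to zero, so the conditions already met persist.\<close>
  have approx: "\<exists>p. \<forall>i. l - j \<le> i \<longrightarrow> \<Phi> (?X i) \<odot>\<^bsub>M\<^esub> (y \<ominus>\<^bsub>M\<^esub> \<Phi> p \<odot>\<^bsub>M\<^esub> x) \<in> H"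
    if y: "y \<in> carrier M" and "j \<le> l" for y j
    using \<open>j \<le> l\<close>
  proof (induction j)
    case 0
    then show ?case
      using y x act_closed kill H0 by (intro exI[of _ 0]) auto
  next
    case (Suc j)
    then obtain p where p: "\<And>i. l - j \<le> i \<Longrightarrow> \<Phi> (?X i) \<odot>\<^bsub>M\<^esub> (y \<ominus>\<^bsub>M\<^esub> \<Phi> p \<odot>\<^bsub>M\<^esub> x) \<in> H"
      by auto
    let ?z = "y \<ominus>\<^bsub>M\<^esub> \<Phi> p \<odot>\<^bsub>M\<^esub> x"
    let ?i = "l - Suc j"
    have z: "?z \<in> carrier M"
      using y x act_closed by simp
    obtain c h where h: "h \<in> H" "\<Phi> (?X ?i) \<odot>\<^bsub>M\<^esub> ?z = h \<oplus>\<^bsub>M\<^esub> \<Phi> [:c:] \<odot>\<^bsub>M\<^esub> s"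
      using hyperplane[OF act_closed[OF z]] by blast
    have hM: "h \<in> carrier M" and csM: "\<Phi> [:c:] \<odot>\<^bsub>M\<^esub> s \<in> carrier M"
      using h HM s act_closed by auto
    have eq: "y \<ominus>\<^bsub>M\<^esub> \<Phi> (p + monom c j) \<odot>\<^bsub>M\<^esub> x = ?z \<ominus>\<^bsub>M\<^esub> \<Phi> (monom c j) \<odot>\<^bsub>M\<^esub> x"
      using y x act_closed by (simp add: act_add M.M.minus_eq M.M.minus_add M.M.a_ac)
    show ?case
    proof (intro exI[of _ "p + monom c j"] allI impI)
      fix i assume i: "l - Suc j \<le> i"
      have "\<Phi> (?X i) \<odot>\<^bsub>M\<^esub> (y \<ominus>\<^bsub>M\<^esub> \<Phi> (p + monom c j) \<odot>\<^bsub>M\<^esub> x)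
          = \<Phi> (?X i) \<odot>\<^bsub>M\<^esub> ?z \<ominus>\<^bsub>M\<^esub> \<Phi> (monom c (i + j)) \<odot>\<^bsub>M\<^esub> x"
        using z x act_closed by (simp add: eq act_minus mult_monom flip: act_mult)
      also have "\<dots> \<in> H"
      proof (cases "i = ?i")
        case True
        then have "i + j = l - 1"
          using Suc.prems by simp
        then have "\<Phi> (?X i) \<odot>\<^bsub>M\<^esub> ?z \<ominus>\<^bsub>M\<^esub> \<Phi> (monom c (i + j)) \<odot>\<^bsub>M\<^esub> x = h"
          using True h(2) hM csM by (simp only: top M.M.minus_eq M.M.a_assoc M.M.r_neg M.M.a_inv_closed M.M.r_zero)
        then show ?thesis
          using h(1) by simp
      next
        case False
        then have "l - j \<le> i" "l \<le> i + j"
          using i Suc.prems by auto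
        then show ?thesis
          using p[of i] z x(1) act_closed[OF z, of "?X i"] kill[of x "i + j" c] M.M.r_neg[of "\<zero>\<^bsub>M\<^esub>"]
          by (metis M.M.a_inv_closed M.M.l_zero M.M.minus_eq M.M.r_zero M.M.zero_closed)
      qed
      finally show "\<Phi> (?X i) \<odot>\<^bsub>M\<^esub> (y \<ominus>\<^bsub>M\<^esub> \<Phi> (p + monom c j) \<odot>\<^bsub>M\<^esub> x) \<in> H" .
    qed
  qed
  have "U <+>\<^bsub>M\<^esub> C = carrier M"
  proof
    show "U <+>\<^bsub>M\<^esub> C \<subseteq> carrier M"
      using M.submoduleD(1)[OF U] M.submoduleD(1)[OF C] by (auto simp: set_add_def')
    show "carrier M \<subseteq> U <+>\<^bsub>M\<^esub> C"
    proof
      fix y assume y: "y \<in> carrier M"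
      obtain p where p: "\<And>i. \<Phi> (?X i) \<odot>\<^bsub>M\<^esub> (y \<ominus>\<^bsub>M\<^esub> \<Phi> p \<odot>\<^bsub>M\<^esub> x) \<in> H"
        using approx[OF y order_refl] by auto
      let ?u = "\<Phi> p \<odot>\<^bsub>M\<^esub> x"
      have u: "?u \<in> carrier M"
        using x act_closed by simp
      have "y \<ominus>\<^bsub>M\<^esub> ?u \<in> C"
        using submodule_scalar[of H, OF Hscalar Hadd H0 p] y u by (auto simp: C_def)
      moreover have "y = ?u \<oplus>\<^bsub>M\<^esub> (y \<ominus>\<^bsub>M\<^esub> ?u)"
        using y u M.M.a_comm[OF u, of "y \<ominus>\<^bsub>M\<^esub> ?u"] by (simp add: M.M.minus_eq M.M.a_assoc M.M.l_neg)
      ultimately show "y \<in> U <+>\<^bsub>M\<^esub> C"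
        unfolding set_add_def' U_def by blast
    qed
  qed
  moreover have "U \<noteq> {\<zero>\<^bsub>M\<^esub>}"
    using s unfolding U_def s_def by blast
  ultimately have "C = {\<zero>\<^bsub>M\<^esub>}"
    using indec U C UC unfolding indecomposable_def by blast
  have UM: "carrier M \<subseteq> U"
  proof
    fix y assume "y \<in> carrier M"
    then obtain u where "u \<in> U" "y = u \<oplus>\<^bsub>M\<^esub> \<zero>\<^bsub>M\<^esub>"
      using \<open>U <+>\<^bsub>M\<^esub> C = carrier M\<close> \<open>C = {\<zero>\<^bsub>M\<^esub>}\<close> by (auto simp: set_add_def')
    then show "y \<in> U"
      using M.submoduleD(1)[OF U] by auto
  qed
  have ann: "\<Phi> p \<odot>\<^bsub>M\<^esub> x = \<zero>\<^bsub>M\<^esub> \<longleftrightarrow> ?X l dvd p" for p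
  proof
    assume "?X l dvd p"
    then show "\<Phi> p \<odot>\<^bsub>M\<^esub> x = \<zero>\<^bsub>M\<^esub>"
      using act_eqI[OF x(1), of "?X l" p 0] l x(1) by (simp add: act_0)
  next
    assume 0: "\<Phi> p \<odot>\<^bsub>M\<^esub> x = \<zero>\<^bsub>M\<^esub>"
    show "?X l dvd p"
    proof (rule ccontr)
      assume "\<not> ?X l dvd p"
      then obtain c i where "c \<noteq> 0" "\<zero>\<^bsub>M\<^esub> = \<Phi> [:c:] \<odot>\<^bsub>M\<^esub> s"
        using socle[of p] 0 act_zero by auto
      then show False
        using act_scalar_eq_zero_iff[OF s(1), of c] s(2) by auto
    qed
  qed
  have "cyclic M x l"
    unfolding cyclic_def using M lpos x(1) ann UM unfolding U_def by blast
  then show thesis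
    by (rule that)
qed

end

end

section \<open>Homomorphisms, lengths and indecomposability of cyclic modules\<close>

context truncated_polynomial_ring
begin

lemma cyclicD:
  assumes "cyclic M x l"
  shows "left_module A M" "0 < l" "x \<in> carrier M"
    and "\<And>y. y \<in> carrier M \<Longrightarrow> \<exists>p. y = \<Phi> p \<odot>\<^bsub>M\<^esub> x"
    and "\<And>p. \<Phi> p \<odot>\<^bsub>M\<^esub> x = \<zero>\<^bsub>M\<^esub> \<longleftrightarrow> monom 1 l dvd p"
  using assms by (auto simp: cyclic_def)

lemma cyclic_eq_iff:
  assumes "cyclic M x l"
  shows "\<Phi> p \<odot>\<^bsub>M\<^esub> x = \<Phi> q \<odot>\<^bsub>M\<^esub> x \<longleftrightarrow> monom 1 l dvd p - q"
proof
  note c = cyclicD[OF assms]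
  interpret M: left_module A M by (rule c(1))
  show "monom 1 l dvd p - q" if "\<Phi> p \<odot>\<^bsub>M\<^esub> x = \<Phi> q \<odot>\<^bsub>M\<^esub> x"
    using that c act_closed[OF c(1,3), of q] act_diff[OF c(1,3), of p q]
    by (simp add: M.M.minus_eq M.M.r_neg flip: c(5))
  show "\<Phi> p \<odot>\<^bsub>M\<^esub> x = \<Phi> q \<odot>\<^bsub>M\<^esub> x" if "monom 1 l dvd p - q"
    using act_eqI[OF c(1,3) that] c(5) by simp
qed

lemma cyclic_annihilated:
  assumes "cyclic M x l" "y \<in> carrier M"
  shows "\<Phi> (monom 1 l) \<odot>\<^bsub>M\<^esub> y = \<zero>\<^bsub>M\<^esub>"
proof -
  note c = cyclicD[OF assms(1)]
  obtain p where "y = \<Phi> p \<odot>\<^bsub>M\<^esub> x"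
    using c(4)[OF assms(2)] by blast
  then show ?thesis
    using c(5)[of "monom 1 l * p"] by (simp add: act_mult[OF c(1,3)])
qed

text \<open>A homomorphism from \<open>k[X] / (X^l)\<close> is the choice of an element killed by
  \<open>X^l\<close>. Elements of \<open>M\<close> determine their polynomials modulo
  \<open>X^l\<close>, so the chosen polynomial does not affect the value.\<close>

lemma cyclic_hom:
  fixes N :: "('a, 'n) module"
  assumes "cyclic M x l" "left_module A N" and z: "z \<in> carrier N" "\<Phi> (monom 1 l) \<odot>\<^bsub>N\<^esub> z = \<zero>\<^bsub>N\<^esub>"
  obtains h where "h \<in> module_hom A M N" "\<And>p. h (\<Phi> p \<odot>\<^bsub>M\<^esub> x) = \<Phi> p \<odot>\<^bsub>N\<^esub> z"
proof -
  note c = cyclicD[OF assms(1)]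
  interpret M: left_module A M by (rule c(1))
  interpret N: left_module A N by fact
  define r where "r y = (SOME p. y = \<Phi> p \<odot>\<^bsub>M\<^esub> x)" for y
  have r: "y = \<Phi> (r y) \<odot>\<^bsub>M\<^esub> x" if "y \<in> carrier M" for y
    unfolding r_def by (rule someI_ex) (rule c(4)[OF that])
  define h where "h y = \<Phi> (r y) \<odot>\<^bsub>N\<^esub> z" for y
  have h: "h (\<Phi> p \<odot>\<^bsub>M\<^esub> x) = \<Phi> p \<odot>\<^bsub>N\<^esub> z" for p
  proof -
    have "monom 1 l dvd r (\<Phi> p \<odot>\<^bsub>M\<^esub> x) - p"
      using r[OF act_closed[OF c(1,3)]] cyclic_eq_iff[OF assms(1)] by metis
    then show ?thesis
      unfolding h_def by (rule act_eqI[OF assms(2) z(1) _ z(2)])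
  qed
  have "h \<in> module_hom A M N"
  proof (rule module_homI)
    show "h y \<in> carrier N" for y
      using act_closed[OF assms(2) z(1)] by (simp add: h_def)
    fix y assume "y \<in> carrier M"
    then obtain p where p: "y = \<Phi> p \<odot>\<^bsub>M\<^esub> x"
      using c(4) by blast
    show "h (y \<oplus>\<^bsub>M\<^esub> w) = h y \<oplus>\<^bsub>N\<^esub> h w" if w: "w \<in> carrier M" for w
    proof -
      obtain q where q: "w = \<Phi> q \<odot>\<^bsub>M\<^esub> x"
        using c(4)[OF w] by blast
      show ?thesis
        unfolding p q act_add[OF c(1,3), symmetric] h by (rule act_add[OF assms(2) z(1)])
    qed
    show "h (a \<odot>\<^bsub>M\<^esub> y) = a \<odot>\<^bsub>N\<^esub> h y" if a: "a \<in> carrier A" for a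
    proof -
      obtain q where q: "a = \<Phi> q"
        using Phi_surj[OF a] by blast
      show ?thesis
        unfolding p q act_mult[OF c(1,3), symmetric] h by (rule act_mult[OF assms(2) z(1)])
    qed
  qed
  then show thesis
    using h that by blast
qed

lemma cyclic_isomorphic:
  assumes "cyclic M x l" "cyclic N z l"
  shows "module_iso A M N"
proof -
  note c = cyclicD[OF assms(1)] and d = cyclicD[OF assms(2)]
  obtain h where h: "h \<in> module_hom A M N" "\<And>p. h (\<Phi> p \<odot>\<^bsub>M\<^esub> x) = \<Phi> p \<odot>\<^bsub>N\<^esub> z"
    using cyclic_hom[OF assms(1) d(1,3)] d(5) by auto
  have "inj_on h (carrier M)"
  proof (rule inj_onI)
    fix y w assume "y \<in> carrier M" "w \<in> carrier M" and eq: "h y = h w"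
    then obtain p q where pq: "y = \<Phi> p \<odot>\<^bsub>M\<^esub> x" "w = \<Phi> q \<odot>\<^bsub>M\<^esub> x"
      using c(4) by blast
    then show "y = w"
      using eq h(2) cyclic_eq_iff[OF assms(1)] cyclic_eq_iff[OF assms(2)] by simp
  qed
  moreover have "h ` carrier M = carrier N"
  proof
    show "h ` carrier M \<subseteq> carrier N"
      using module_homD(1)[OF h(1)] by auto
    show "carrier N \<subseteq> h ` carrier M"
    proof
      fix w assume "w \<in> carrier N"
      then obtain p where "w = \<Phi> p \<odot>\<^bsub>N\<^esub> z"
        using d(4) by blast
      then show "w \<in> h ` carrier M"
        using h(2) act_closed[OF c(1,3)] by (metis imageI)
    qed
  qed
  ultimately show ?thesis
    using h(1) by (auto simp: module_iso_def bij_betw_def)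
qed

text \<open>\<open>X^l\<close> annihilates \<open>M\<close>, hence also its image \<open>N\<close>,
  and so \<open>X^l'\<close> divides \<open>X^l\<close>.\<close>

lemma cyclic_length_le:
  assumes M: "cyclic M x l" and N: "cyclic N z l'" and f: "f \<in> module_hom A M N" "f ` carrier M = carrier N"
  shows "l' \<le> l"
proof -
  note c = cyclicD[OF M] and d = cyclicD[OF N]
  obtain w where w: "w \<in> carrier M" "z = f w"
    using d(3) f(2) by auto
  have "\<Phi> (monom 1 l) \<odot>\<^bsub>N\<^esub> z = f (\<Phi> (monom 1 l) \<odot>\<^bsub>M\<^esub> w)"
    using module_homD(3)[OF f(1) Phi_closed w(1)] w(2) by simp
  also have "\<dots> = \<zero>\<^bsub>N\<^esub>"
    using cyclic_annihilated[OF M w(1)] module_hom_zero[OF c(1) d(1) f(1)] by simp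
  finally have "monom 1 l' dvd (monom 1 l :: 'k poly)"
    using d(5) by simp
  then show ?thesis
    by (auto simp: monom_1_dvd_iff' not_le split: if_splits)
qed

lemma cyclic_length_unique:
  assumes "cyclic M x l" "cyclic N z l'" "module_iso A M N"
  shows "l = l'"
proof -
  obtain f where f: "f \<in> module_hom A M N" "f ` carrier M = carrier N"
    using assms(3) by (auto simp: module_iso_def bij_betw_def)
  obtain g where g: "g \<in> module_hom A N M" "g ` carrier N = carrier M"
    using module_iso_sym[OF cyclicD(1)[OF assms(1)] assms(3)] by (auto simp: module_iso_def bij_betw_def)
  show ?thesis
    using cyclic_length_le[OF assms(1,2) f] cyclic_length_le[OF assms(2,1) g] by simp
qed

lemma cyclic_fg:
  assumes "cyclic M x l"
  shows "fg_module A M"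
proof -
  note c = cyclicD[OF assms]
  interpret M: left_module A M by (rule c(1))
  have "U = carrier M" if U: "Module.submodule U A M" "{x} \<subseteq> U" for U
  proof
    show "U \<subseteq> carrier M"
      using M.submoduleD(1)[OF U(1)] .
    show "carrier M \<subseteq> U"
    proof
      fix y assume "y \<in> carrier M"
      then obtain p where "y = \<Phi> p \<odot>\<^bsub>M\<^esub> x"
        using c(4) by blast
      then show "y \<in> U"
        using M.submoduleD(5)[OF U(1) Phi_closed] U(2) by simp
    qed
  qed
  then show ?thesis
    using c(1,3) unfolding fg_module_def by (intro conjI exI[of _ "{x}"]) auto
qed

text \<open>A polynomial with nonzero constant coefficient is invertible modulo \<open>X^l\<close>,
  so \<open>x\<close> is recovered from \<open>p x\<close>.\<close>

lemma cyclic_unit_generates: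
  assumes "cyclic M x l" "coeff p 0 \<noteq> 0" "Module.submodule U A M" "\<Phi> p \<odot>\<^bsub>M\<^esub> x \<in> U"
  shows "carrier M \<subseteq> U"
proof
  note c = cyclicD[OF assms(1)]
  interpret M: left_module A M by (rule c(1))
  fix y assume "y \<in> carrier M"
  then obtain r where r: "y = \<Phi> r \<odot>\<^bsub>M\<^esub> x"
    using c(4) by blast
  obtain q where "monom 1 l dvd q * p - 1"
    using poly_unit_modulo_monom[OF assms(2)] by blast
  then have "\<Phi> (q * p) \<odot>\<^bsub>M\<^esub> x = \<Phi> 1 \<odot>\<^bsub>M\<^esub> x"
    using cyclic_eq_iff[OF assms(1)] by blast
  then have "\<Phi> q \<odot>\<^bsub>M\<^esub> (\<Phi> p \<odot>\<^bsub>M\<^esub> x) = x"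
    by (simp add: act_mult[OF c(1,3)] act_1[OF c(1,3)])
  then have "x \<in> U"
    using M.submoduleD(5)[OF assms(3) Phi_closed assms(4)] by metis
  then show "y \<in> U"
    using M.submoduleD(5)[OF assms(3) Phi_closed] r by simp
qed

text \<open>For \<open>x = u + v\<close> with \<open>u = p x\<close> and
  \<open>v = (1 - p) x\<close>, one of \<open>p\<close> and \<open>1 - p\<close> has a nonzero
  constant coefficient, and the corresponding summand is the whole module.\<close>

lemma cyclic_indecomposable:
  assumes "cyclic M x l"
  shows "indecomposable A M"
  unfolding indecomposable_def
proof (intro conjI allI impI)
  note c = cyclicD[OF assms]
  interpret M: left_module A M by (rule c(1))
  have "\<not> monom 1 l dvd (1 :: 'k poly)"
    using c(2) by (auto simp: monom_1_dvd_iff')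
  then have "x \<noteq> \<zero>\<^bsub>M\<^esub>"
    using c(5)[of 1] act_1[OF c(1,3)] by simp
  then show "carrier M \<noteq> {\<zero>\<^bsub>M\<^esub>}"
    using c(3) by auto
  fix U V
  assume UV: "Module.submodule U A M \<and> Module.submodule V A M \<and>
    U <+>\<^bsub>M\<^esub> V = carrier M \<and> U \<inter> V = {\<zero>\<^bsub>M\<^esub>}"
  then have U: "Module.submodule U A M" and V: "Module.submodule V A M" by auto
  have "x \<in> U <+>\<^bsub>M\<^esub> V"
    using UV c(3) by simp
  then obtain u v where uv: "u \<in> U" "v \<in> V" "x = u \<oplus>\<^bsub>M\<^esub> v"
    by (auto simp: set_add_def')
  have uM: "u \<in> carrier M" and vM: "v \<in> carrier M"
    using M.submoduleD(1)[OF U] M.submoduleD(1)[OF V] uv by auto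
  obtain p where p: "u = \<Phi> p \<odot>\<^bsub>M\<^esub> x"
    using c(4)[OF uM] by blast
  have "\<Phi> (1 - p) \<odot>\<^bsub>M\<^esub> x = x \<ominus>\<^bsub>M\<^esub> u"
    using p by (simp add: act_diff[OF c(1,3)] act_1[OF c(1,3)])
  also have "\<dots> = v"
    using uv(3) uM vM M.M.a_comm[OF uM vM] by (simp add: M.M.minus_eq M.M.a_assoc M.M.r_neg)
  finally have v: "v = \<Phi> (1 - p) \<odot>\<^bsub>M\<^esub> x" by simp
  show "U = {\<zero>\<^bsub>M\<^esub>} \<or> V = {\<zero>\<^bsub>M\<^esub>}"
  proof (cases "coeff p 0 = 0")
    case True
    then have "coeff (1 - p) 0 \<noteq> 0"
      by simp
    then have "carrier M \<subseteq> V"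
      using cyclic_unit_generates[OF assms _ V] v uv(2) by blast
    then show ?thesis
      using UV M.submoduleD(1)[OF U] by blast
  next
    case False
    then have "carrier M \<subseteq> U"
      using cyclic_unit_generates[OF assms _ U] p uv(1) by blast
    then show ?thesis
      using UV M.submoduleD(1)[OF V] by blast
  qed
qed

text \<open>The field with \<open>X\<close> acting as zero: an element of \<open>A\<close> acts by
  the constant coefficient of a polynomial that represents it, which is well defined by
  \<open>Phi_augmented\<close>.\<close>

lemma simple_module_exists:
  obtains S :: "('k, 'a) coord_module" and x where "cyclic S x 1"
proof -
  define r where "r a = (SOME p. a = \<Phi> p)" for a
  have r: "coeff (r (\<Phi> p)) 0 = coeff p 0" for p
  proof -
    have "\<Phi> p = \<Phi> (r (\<Phi> p))"
      unfolding r_def by (rule someI) (rule refl)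
    then show ?thesis
      using Phi_augmented by metis
  qed
  define K :: "('a, 'k) module" where
    "K = \<lparr>carrier = UNIV, mult = undefined, one = undefined, zero = 0, add = (+),
          smult = (\<lambda>a c. coeff (r a) 0 * c)\<rparr>"
  have ag: "abelian_group K"
    by (rule abelian_groupI) (auto simp: K_def add.assoc add.commute intro: exI[of _ "- _"])
  have K: "left_module A K"
  proof (intro left_module.intro left_module_axioms.intro ag ring_axioms)
    fix a b and c d :: 'k assume "a \<in> carrier A" "b \<in> carrier A"
    then obtain p q where pq: "a = \<Phi> p" "b = \<Phi> q"
      using Phi_surj by meson
    show "(a \<oplus>\<^bsub>A\<^esub> b) \<odot>\<^bsub>K\<^esub> c = a \<odot>\<^bsub>K\<^esub> c \<oplus>\<^bsub>K\<^esub> b \<odot>\<^bsub>K\<^esub> c"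
      unfolding pq Phi_add[symmetric] by (simp add: K_def r algebra_simps)
    show "(a \<otimes>\<^bsub>A\<^esub> b) \<odot>\<^bsub>K\<^esub> c = a \<odot>\<^bsub>K\<^esub> (b \<odot>\<^bsub>K\<^esub> c)"
      unfolding pq Phi_mult[symmetric] by (simp add: K_def r coeff_mult)
  next
    show "\<one>\<^bsub>A\<^esub> \<odot>\<^bsub>K\<^esub> c = c" for c
      unfolding Phi_1[symmetric] by (simp add: K_def r)
  qed (auto simp: K_def algebra_simps)
  \<comment> \<open>Constant sequences bring the field into the coordinate type.\<close>
  define \<kappa> :: "'k \<Rightarrow> nat \<Rightarrow> 'k" where "\<kappa> c = (\<lambda>_. c)" for c
  have inj: "inj_on \<kappa> (carrier K)"
    by (auto simp: inj_on_def \<kappa>_def fun_eq_iff)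
  let ?S = "transport \<kappa> K"
  note t = module_homD[OF transport_hom[OF inj, of A]]
  have S: "left_module A ?S"
    by (rule left_module_transport[OF K inj])
  have act: "\<Phi> p \<odot>\<^bsub>?S\<^esub> \<kappa> 1 = \<kappa> (coeff p 0)" for p
    using t(3)[OF Phi_closed[of p], of 1] by (simp add: K_def r)
  have "cyclic ?S (\<kappa> 1) 1"
    unfolding cyclic_def
  proof (intro conjI ballI allI S)
    show "\<kappa> 1 \<in> carrier ?S"
      using t(1)[of 1] by (simp add: K_def)
    fix y assume "y \<in> carrier ?S"
    then obtain c where "y = \<kappa> c"
      by (auto simp: transport_def)
    then show "\<exists>p. y = \<Phi> p \<odot>\<^bsub>?S\<^esub> \<kappa> 1"
      by (intro exI[of _ "[:c:]"]) (simp add: act)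
  next
    fix p
    have "\<zero>\<^bsub>?S\<^esub> = \<kappa> 0"
      by (simp add: transport_def K_def)
    then show "\<Phi> p \<odot>\<^bsub>?S\<^esub> \<kappa> 1 = \<zero>\<^bsub>?S\<^esub> \<longleftrightarrow> monom 1 1 dvd p"
      unfolding act by (simp add: monom_1_dvd_iff' \<kappa>_def fun_eq_iff)
  qed simp
  then show thesis by (rule that)
qed

end

section \<open>Endomorphisms of a sum of cyclic modules\<close>

lemma left_module_direct_sum:
  assumes "ring R" and M: "\<And>i. i < length Ms \<Longrightarrow> left_module R (Ms ! i)"
  shows "left_module R (direct_sum_module Ms)"
proof -
  have ag: "abelian_group (Ms ! i)" if "i < length Ms" for i
    using M[OF that] by (simp add: left_module_def)
  note g = abelian_group.axioms(1)[OF ag]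
  have "abelian_group (direct_sum_module Ms)"
  proof (rule abelian_groupI)
    fix x assume x: "x \<in> carrier (direct_sum_module Ms)"
    show "\<exists>y\<in>carrier (direct_sum_module Ms). y \<oplus>\<^bsub>direct_sum_module Ms\<^esub> x = \<zero>\<^bsub>direct_sum_module Ms\<^esub>"
    proof
      show "(\<lambda>i\<in>{..<length Ms}. \<ominus>\<^bsub>Ms ! i\<^esub> x i) \<in> carrier (direct_sum_module Ms)"
        using x abelian_group.a_inv_closed[OF ag] by (auto simp: direct_sum_module_def PiE_iff)
      show "(\<lambda>i\<in>{..<length Ms}. \<ominus>\<^bsub>Ms ! i\<^esub> x i) \<oplus>\<^bsub>direct_sum_module Ms\<^esub> x = \<zero>\<^bsub>direct_sum_module Ms\<^esub>"
        using x abelian_group.l_neg[OF ag]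
        by (auto simp: direct_sum_module_def PiE_iff intro!: restrict_ext)
    qed
    show "\<zero>\<^bsub>direct_sum_module Ms\<^esub> \<oplus>\<^bsub>direct_sum_module Ms\<^esub> x = x"
      using x abelian_monoid.l_zero[OF g]
      by (auto simp: direct_sum_module_def PiE_iff intro!: extensionalityI[of _ "{..<length Ms}"])
  qed (auto simp: direct_sum_module_def PiE_iff abelian_monoid.a_assoc[OF g]
      abelian_monoid.a_closed[OF g] abelian_monoid.zero_closed[OF g]
      intro!: restrict_ext abelian_monoid.a_comm[OF g])
  then show ?thesis
  proof (intro left_module.intro left_module_axioms.intro assms(1))
    show "\<one>\<^bsub>R\<^esub> \<odot>\<^bsub>direct_sum_module Ms\<^esub> x = x" if "x \<in> carrier (direct_sum_module Ms)" for x
      using that left_module.smult_one[OF M]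
      by (auto simp: direct_sum_module_def PiE_iff intro!: extensionalityI[of _ "{..<length Ms}"])
  qed (auto simp: direct_sum_module_def PiE_iff left_module.smult_closed[OF M]
      left_module.smult_l_distr[OF M] left_module.smult_r_distr[OF M] left_module.smult_assoc[OF M]
      intro!: restrict_ext)
qed

lemma endomorphism_algebra_simps:
  "carrier (endomorphism_algebra A M) = module_hom A M M \<inter> extensional (carrier M)"
  "\<zero>\<^bsub>endomorphism_algebra A M\<^esub> = (\<lambda>x\<in>carrier M. \<zero>\<^bsub>M\<^esub>)"
  "\<one>\<^bsub>endomorphism_algebra A M\<^esub> = (\<lambda>x\<in>carrier M. x)"
  "f \<oplus>\<^bsub>endomorphism_algebra A M\<^esub> g = (\<lambda>x\<in>carrier M. f x \<oplus>\<^bsub>M\<^esub> g x)"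
  "f \<otimes>\<^bsub>endomorphism_algebra A M\<^esub> g = (\<lambda>x\<in>carrier M. f (g x))"
  "c \<odot>\<^bsub>endomorphism_algebra A M\<^esub> f = (\<lambda>x\<in>carrier M. (c \<odot>\<^bsub>A\<^esub> \<one>\<^bsub>A\<^esub>) \<odot>\<^bsub>M\<^esub> f x)"
  by (simp_all add: endomorphism_algebra_def hom_space_def compose_def)

lemma ring_endomorphism_algebra:
  fixes A :: "('k::field, 'a) module" and M :: "('a, 'm) module"
  assumes "left_module A M"
  shows "ring (endomorphism_algebra A M)"
proof -
  interpret M: left_module A M by fact
  note es = endomorphism_algebra_simps and h = module_homD[of _ A M M]
  let ?E = "endomorphism_algebra A M"
  have closed: "f \<oplus>\<^bsub>?E\<^esub> g \<in> carrier ?E" if "f \<in> carrier ?E" "g \<in> carrier ?E" for f g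
    using that h[of f] h[of g] by (auto simp: es M.smult_closed M.smult_r_distr M.M.a_ac intro!: module_homI)
  have "abelian_group ?E"
  proof (rule abelian_groupI)
    show "\<zero>\<^bsub>?E\<^esub> \<in> carrier ?E"
      by (auto simp: es M.smult_closed M.smult_zero_right intro!: module_homI)
    fix f assume f: "f \<in> carrier ?E"
    show "\<zero>\<^bsub>?E\<^esub> \<oplus>\<^bsub>?E\<^esub> f = f"
      using f h[of f] by (auto simp: es intro!: extensionalityI[of _ "carrier M"])
    show "\<exists>g\<in>carrier ?E. g \<oplus>\<^bsub>?E\<^esub> f = \<zero>\<^bsub>?E\<^esub>"
    proof
      show "(\<lambda>x\<in>carrier M. \<ominus>\<^bsub>M\<^esub> f x) \<oplus>\<^bsub>?E\<^esub> f = \<zero>\<^bsub>?E\<^esub>"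
        using f h[of f] by (auto simp: es M.M.l_neg intro!: restrict_ext)
      show "(\<lambda>x\<in>carrier M. \<ominus>\<^bsub>M\<^esub> f x) \<in> carrier ?E"
        using f h[of f]
        by (auto simp: es M.smult_closed M.smult_neg_right M.M.minus_add intro!: module_homI)
    qed
    fix g assume g: "g \<in> carrier ?E"
    show "f \<oplus>\<^bsub>?E\<^esub> g \<in> carrier ?E"
      using closed f g .
    show "f \<oplus>\<^bsub>?E\<^esub> g = g \<oplus>\<^bsub>?E\<^esub> f"
      using f g h[of f] h[of g] by (auto simp: es M.M.a_comm intro!: restrict_ext)
    fix k assume k: "k \<in> carrier ?E"
    show "(f \<oplus>\<^bsub>?E\<^esub> g) \<oplus>\<^bsub>?E\<^esub> k = f \<oplus>\<^bsub>?E\<^esub> (g \<oplus>\<^bsub>?E\<^esub> k)"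
      using f g k h[of f] h[of g] h[of k] by (auto simp: es M.M.a_assoc intro!: restrict_ext)
  qed
  moreover have "monoid ?E"
  proof (rule monoidI)
    show "\<one>\<^bsub>?E\<^esub> \<in> carrier ?E"
      by (auto simp: es M.smult_closed intro!: module_homI)
    fix f g assume f: "f \<in> carrier ?E" and g: "g \<in> carrier ?E"
    show "f \<otimes>\<^bsub>?E\<^esub> g \<in> carrier ?E"
      using f g h[of f] h[of g] by (auto simp: es M.smult_closed intro!: module_homI)
    show "\<one>\<^bsub>?E\<^esub> \<otimes>\<^bsub>?E\<^esub> f = f" "f \<otimes>\<^bsub>?E\<^esub> \<one>\<^bsub>?E\<^esub> = f"
      using f h[of f] by (auto simp: es intro!: extensionalityI[of _ "carrier M"])
    fix k assume k: "k \<in> carrier ?E"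
    show "(f \<otimes>\<^bsub>?E\<^esub> g) \<otimes>\<^bsub>?E\<^esub> k = f \<otimes>\<^bsub>?E\<^esub> (g \<otimes>\<^bsub>?E\<^esub> k)"
      using k h[of k] by (auto simp: es intro!: restrict_ext)
  qed
  ultimately show ?thesis
  proof (rule ringI)
    fix f g k assume f: "f \<in> carrier ?E" and g: "g \<in> carrier ?E" and k: "k \<in> carrier ?E"
    show "(f \<oplus>\<^bsub>?E\<^esub> g) \<otimes>\<^bsub>?E\<^esub> k = f \<otimes>\<^bsub>?E\<^esub> k \<oplus>\<^bsub>?E\<^esub> g \<otimes>\<^bsub>?E\<^esub> k"
      "k \<otimes>\<^bsub>?E\<^esub> (f \<oplus>\<^bsub>?E\<^esub> g) = k \<otimes>\<^bsub>?E\<^esub> f \<oplus>\<^bsub>?E\<^esub> k \<otimes>\<^bsub>?E\<^esub> g"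
      using f g k h[of f] h[of g] h[of k] by (auto simp: es intro!: restrict_ext)
  qed
qed

section \<open>The direct sum of a family of cyclic modules\<close>

locale cyclic_family = truncated_polynomial_ring A \<Phi> m
    for A :: "('k::field, 'a) module" (structure) and \<Phi> m +
  fixes Ms :: "('k, 'a) coord_module list" and x :: "nat \<Rightarrow> nat \<Rightarrow> 'k" and l :: "nat \<Rightarrow> nat"
  assumes cyc: "i < length Ms \<Longrightarrow> cyclic (Ms ! i) (x i) (l i)"
begin

abbreviation "N \<equiv> length Ms"
abbreviation "D \<equiv> direct_sum_module Ms"
abbreviation "E \<equiv> endomorphism_algebra A D"

lemmas cyc_module = cyclicD(1)[OF cyc]
lemmas cyc_closed = cyclicD(3)[OF cyc]

sublocale D: left_module A D
  by (rule left_module_direct_sum[OF ring_axioms cyc_module])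

sublocale E: ring E
  by (rule ring_endomorphism_algebra[OF D.left_module_axioms])

lemma D_simps:
  "z \<in> carrier D \<longleftrightarrow> z \<in> extensional {..<N} \<and> (\<forall>i<N. z i \<in> carrier (Ms ! i))"
  "i < N \<Longrightarrow> (z \<oplus>\<^bsub>D\<^esub> w) i = z i \<oplus>\<^bsub>Ms ! i\<^esub> w i"
  "i < N \<Longrightarrow> (a \<odot>\<^bsub>D\<^esub> z) i = a \<odot>\<^bsub>Ms ! i\<^esub> z i"
  "i < N \<Longrightarrow> \<zero>\<^bsub>D\<^esub> i = \<zero>\<^bsub>Ms ! i\<^esub>"
  by (auto simp: direct_sum_module_def PiE_iff)

lemma D_eqI: "z \<in> carrier D \<Longrightarrow> w \<in> carrier D \<Longrightarrow> (\<And>i. i < N \<Longrightarrow> z i = w i) \<Longrightarrow> z = w"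
  by (rule extensionalityI[of z "{..<N}"]) (auto simp: D_simps(1))

lemma D_component: "z \<in> carrier D \<Longrightarrow> i < N \<Longrightarrow> z i \<in> carrier (Ms ! i)"
  by (simp add: D_simps)

definition incl :: "nat \<Rightarrow> (nat \<Rightarrow> 'k) \<Rightarrow> nat \<Rightarrow> nat \<Rightarrow> 'k" where
  "incl i y = (\<lambda>j\<in>{..<N}. if j = i then y else \<zero>\<^bsub>Ms ! j\<^esub>)"

lemma cyc_zero_closed: "i < N \<Longrightarrow> \<zero>\<^bsub>Ms ! i\<^esub> \<in> carrier (Ms ! i)"
  using left_module.submodule_zero[OF cyc_module] left_module.submoduleD(1)[OF cyc_module] by blast

lemma incl_closed: "y \<in> carrier (Ms ! i) \<Longrightarrow> incl i y \<in> carrier D"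
  by (auto simp: D_simps incl_def cyc_zero_closed)

lemma incl_apply: "j < N \<Longrightarrow> incl i y j = (if j = i then y else \<zero>\<^bsub>Ms ! j\<^esub>)"
  by (simp add: incl_def)

lemma incl_add:
  assumes "i < N" "y \<in> carrier (Ms ! i)" "w \<in> carrier (Ms ! i)"
  shows "incl i (y \<oplus>\<^bsub>Ms ! i\<^esub> w) = incl i y \<oplus>\<^bsub>D\<^esub> incl i w"
proof -
  interpret left_module A "Ms ! i" by (rule cyc_module[OF assms(1)])
  have z: "\<zero>\<^bsub>Ms ! j\<^esub> \<oplus>\<^bsub>Ms ! j\<^esub> \<zero>\<^bsub>Ms ! j\<^esub> = \<zero>\<^bsub>Ms ! j\<^esub>" if "j < N" for j
  proof -
    interpret j: left_module A "Ms ! j" by (rule cyc_module[OF that])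
    show ?thesis by simp
  qed
  show ?thesis
    using assms z by (intro D_eqI) (auto simp: D_simps(2) incl_apply intro!: incl_closed D.M.a_closed)
qed

lemma incl_smult:
  assumes "i < N" "y \<in> carrier (Ms ! i)" "a \<in> carrier A"
  shows "incl i (a \<odot>\<^bsub>Ms ! i\<^esub> y) = a \<odot>\<^bsub>D\<^esub> incl i y"
  using assms left_module.smult_zero_right[OF cyc_module] left_module.smult_closed[OF cyc_module]
  by (intro D_eqI) (auto simp: D_simps(3) incl_apply intro!: incl_closed D.smult_closed)

lemma incl_hom: "i < N \<Longrightarrow> incl i \<in> module_hom A (Ms ! i) D"
  by (intro module_homI incl_closed incl_add incl_smult)

lemma proj_hom: "i < N \<Longrightarrow> (\<lambda>z. z i) \<in> module_hom A D (Ms ! i)"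
  by (intro module_homI) (auto simp: D_simps)

text \<open>The projection onto the first \<open>k\<close> summands. It allows induction on
  \<open>k\<close> in place of finite sums in \<open>D\<close>, both for generating \<open>D\<close>
  and for adding up the idempotents.\<close>

definition truncation :: "nat \<Rightarrow> (nat \<Rightarrow> nat \<Rightarrow> 'k) \<Rightarrow> nat \<Rightarrow> nat \<Rightarrow> 'k" where
  "truncation k z = (\<lambda>j\<in>{..<N}. if j < k then z j else \<zero>\<^bsub>Ms ! j\<^esub>)"

lemma truncation_closed: "z \<in> carrier D \<Longrightarrow> truncation k z \<in> carrier D"
  by (auto simp: D_simps truncation_def cyc_zero_closed)

lemma truncation_0: "truncation 0 z = \<zero>\<^bsub>D\<^esub>"
  by (simp add: truncation_def direct_sum_module_def)

lemma truncation_Suc: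
  assumes "z \<in> carrier D" "k < N"
  shows "truncation (Suc k) z = incl k (z k) \<oplus>\<^bsub>D\<^esub> truncation k z"
proof (rule D_eqI)
  show "truncation (Suc k) z \<in> carrier D" "incl k (z k) \<oplus>\<^bsub>D\<^esub> truncation k z \<in> carrier D"
    using assms D_component by (auto intro!: truncation_closed D.M.a_closed incl_closed)
  fix j assume j: "j < N"
  interpret j: left_module A "Ms ! j" by (rule cyc_module[OF j])
  interpret k: left_module A "Ms ! k" by (rule cyc_module[OF assms(2)])
  show "truncation (Suc k) z j = (incl k (z k) \<oplus>\<^bsub>D\<^esub> truncation k z) j"
    using j assms(2) D_component[OF assms(1) j]
    by (auto simp: D_simps incl_apply truncation_def less_Suc_eq)
qed

lemma truncation_all: "z \<in> carrier D \<Longrightarrow> truncation N z = z"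
  by (intro D_eqI truncation_closed) (auto simp: truncation_def)

lemma submodule_containing_generators:
  assumes W: "Module.submodule W A D" and gen: "\<And>i. i < N \<Longrightarrow> incl i (x i) \<in> W"
  shows "carrier D \<subseteq> W"
proof
  fix z assume z: "z \<in> carrier D"
  note Wd = D.submoduleD[OF W]
  have "truncation k z \<in> W" if "k \<le> N" for k
    using that
  proof (induction k)
    case (Suc k)
    have "z k \<in> carrier (Ms ! k)"
      using Suc.prems D_component[OF z, of k] by simp
    then obtain p where "z k = \<Phi> p \<odot>\<^bsub>Ms ! k\<^esub> x k"
      using Suc.prems cyclicD(4)[OF cyc[of k]] by auto
    then have "incl k (z k) \<in> W"
      using Suc.prems incl_smult[of k "x k" "\<Phi> p"] cyc_closed[of k] Phi_closed Wd(5) gen by simp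
    then show ?case
      using Suc z Wd(3) by (simp add: truncation_Suc)
  qed (simp add: truncation_0 Wd(2))
  then show "z \<in> W"
    using truncation_all[OF z] by (metis order_refl)
qed

section \<open>The endomorphism ring of the sum: its idempotents and corners\<close>

lemmas E_simps = endomorphism_algebra_simps[of A D]

lemma E_hom: "f \<in> carrier E \<Longrightarrow> f \<in> module_hom A D D"
  by (simp add: E_simps)

lemma E_apply:
  assumes "f \<in> carrier E"
  shows "z \<in> carrier D \<Longrightarrow> f z \<in> carrier D"
    and "z \<in> carrier D \<Longrightarrow> w \<in> carrier D \<Longrightarrow> f (z \<oplus>\<^bsub>D\<^esub> w) = f z \<oplus>\<^bsub>D\<^esub> f w"
    and "a \<in> carrier A \<Longrightarrow> z \<in> carrier D \<Longrightarrow> f (a \<odot>\<^bsub>D\<^esub> z) = a \<odot>\<^bsub>D\<^esub> f z"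
  using module_homD[OF E_hom[OF assms]] by auto

lemma E_ops_apply:
  assumes "z \<in> carrier D"
  shows "(f \<oplus>\<^bsub>E\<^esub> g) z = f z \<oplus>\<^bsub>D\<^esub> g z" "(f \<otimes>\<^bsub>E\<^esub> g) z = f (g z)" "\<one>\<^bsub>E\<^esub> z = z"
    "\<zero>\<^bsub>E\<^esub> z = \<zero>\<^bsub>D\<^esub>"
  using assms by (simp_all add: E_simps)

lemma E_ext:
  assumes "f \<in> carrier E" "g \<in> carrier E" "\<And>z. z \<in> carrier D \<Longrightarrow> f z = g z"
  shows "f = g"
  using assms by (intro extensionalityI[of f "carrier D"]) (auto simp: E_simps)

text \<open>The set on which two endomorphisms agree is a submodule, and the generators of the
  summands generate \<open>D\<close>.\<close>

lemma E_eqI: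
  assumes f: "f \<in> carrier E" and g: "g \<in> carrier E"
    and eq: "\<And>i. i < N \<Longrightarrow> f (incl i (x i)) = g (incl i (x i))"
  shows "f = g"
proof (rule E_ext[OF f g])
  have "Module.submodule {z \<in> carrier D. f z = g z} A D"
    using E_apply[OF f] E_apply[OF g] module_hom_zero[OF D.left_module_axioms D.left_module_axioms E_hom[OF f]]
      module_hom_zero[OF D.left_module_axioms D.left_module_axioms E_hom[OF g]]
    by (intro D.submoduleI) (auto simp: D.smult_closed)
  then have "carrier D \<subseteq> {z \<in> carrier D. f z = g z}"
    using eq cyc_closed incl_closed by (intro submodule_containing_generators) auto
  then show "f z = g z" if "z \<in> carrier D" for z
    using that by blast
qed

text \<open>The action of \<open>A\<close> on \<open>D\<close>, by endomorphisms because
  \<open>A\<close> is commutative. These are central in \<open>E\<close>, and the constant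
  polynomials give the scalars of \<open>E\<close>.\<close>

definition scale :: "'k poly \<Rightarrow> (nat \<Rightarrow> nat \<Rightarrow> 'k) \<Rightarrow> (nat \<Rightarrow> nat \<Rightarrow> 'k)" where
  "scale p = (\<lambda>z\<in>carrier D. \<Phi> p \<odot>\<^bsub>D\<^esub> z)"

lemma scale_closed: "scale p \<in> carrier E"
  by (auto simp: E_simps scale_def D.smult_closed Phi_closed D.smult_r_distr commutative
      intro!: module_homI simp flip: D.smult_assoc)

lemma scale_apply: "z \<in> carrier D \<Longrightarrow> scale p z = \<Phi> p \<odot>\<^bsub>D\<^esub> z"
  by (simp add: scale_def)

lemma scale_central: "f \<in> carrier E \<Longrightarrow> scale p \<otimes>\<^bsub>E\<^esub> f = f \<otimes>\<^bsub>E\<^esub> scale p"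
  by (rule E_ext)
    (auto simp: E_ops_apply scale_closed scale_apply E_apply Phi_closed D.smult_closed)

lemma scalar_eq_scale: "c \<odot>\<^bsub>E\<^esub> \<one>\<^bsub>E\<^esub> = scale [:c:]"
  by (auto simp: E_simps scale_def Phi_scalar intro!: restrict_ext)

definition \<epsilon> :: "nat \<Rightarrow> (nat \<Rightarrow> nat \<Rightarrow> 'k) \<Rightarrow> (nat \<Rightarrow> nat \<Rightarrow> 'k)" where
  "\<epsilon> i = (\<lambda>z\<in>carrier D. incl i (z i))"

lemma corner_element_closed:
  assumes "i < N" "j < N" "h \<in> module_hom A (Ms ! j) (Ms ! i)"
  shows "(\<lambda>z\<in>carrier D. incl i (h (z j))) \<in> carrier E"
proof -
  have "(\<lambda>z. incl i (h (z j))) \<in> module_hom A D D"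
    using module_hom_compose[OF module_hom_compose[OF proj_hom[OF assms(2)] assms(3)] incl_hom[OF assms(1)]] .
  from module_homD[OF this] show ?thesis
    by (auto simp: E_simps D.smult_closed intro!: module_homI)
qed

lemma \<epsilon>_closed: "i < N \<Longrightarrow> \<epsilon> i \<in> carrier E"
  using corner_element_closed[of i i "\<lambda>y. y"] by (simp add: \<epsilon>_def module_homI)

lemma \<epsilon>_apply: "z \<in> carrier D \<Longrightarrow> \<epsilon> i z = incl i (z i)"
  by (simp add: \<epsilon>_def)

lemma \<epsilon>_incl: "i < N \<Longrightarrow> y \<in> carrier (Ms ! i) \<Longrightarrow> \<epsilon> i (incl i y) = incl i y"
  by (simp add: \<epsilon>_apply incl_closed incl_apply)

lemma \<epsilon>_incl_other:
  assumes "i < N" "j < N" "i \<noteq> j" "y \<in> carrier (Ms ! i)"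
  shows "\<epsilon> j (incl i y) = \<zero>\<^bsub>D\<^esub>"
  using assms
  by (intro D_eqI)
    (auto simp: \<epsilon>_apply incl_closed incl_apply D_simps(4) intro!: incl_closed cyc_zero_closed)

text \<open>The sum of the first \<open>k\<close> idempotents acts as
  \<open>truncation k\<close>.\<close>

lemma finsum_\<epsilon>: "finsum E \<epsilon> {..<N} = \<one>\<^bsub>E\<^esub>"
proof -
  have "k \<le> N \<Longrightarrow> finsum E \<epsilon> {..<k} \<in> carrier E \<and>
      (\<forall>z\<in>carrier D. finsum E \<epsilon> {..<k} z = truncation k z)" for k
  proof (induction k)
    case 0
    then show ?case by (simp add: E_ops_apply truncation_0)
  next
    case (Suc k)
    have "finsum E \<epsilon> {..<Suc k} = \<epsilon> k \<oplus>\<^bsub>E\<^esub> finsum E \<epsilon> {..<k}"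
      unfolding lessThan_Suc using Suc.prems \<epsilon>_closed by (intro E.finsum_insert) auto
    then show ?case
      using Suc \<epsilon>_closed[of k] by (simp add: E_ops_apply \<epsilon>_apply truncation_Suc)
  qed
  from this[of N] show ?thesis
    by (intro E_ext) (auto simp: E_ops_apply truncation_all)
qed

text \<open>A copy of the space of homomorphisms from the summand \<open>j\<close> to the summand
  \<open>i\<close>, since in \<open>E\<close> the right factor acts first.\<close>

definition corner :: "nat \<Rightarrow> nat \<Rightarrow> ((nat \<Rightarrow> nat \<Rightarrow> 'k) \<Rightarrow> (nat \<Rightarrow> nat \<Rightarrow> 'k)) set" where
  "corner i j = {f \<in> carrier E. \<epsilon> i \<otimes>\<^bsub>E\<^esub> f = f \<and> f \<otimes>\<^bsub>E\<^esub> \<epsilon> j = f}"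

lemma corner_apply:
  assumes "i < N" "j < N" "f \<in> corner i j" "z \<in> carrier D"
  shows "f z = incl i (f (incl j (z j)) i)"
proof -
  have f: "f \<in> carrier E" and "f z = (\<epsilon> i \<otimes>\<^bsub>E\<^esub> (f \<otimes>\<^bsub>E\<^esub> \<epsilon> j)) z"
    using assms by (auto simp: corner_def)
  then show ?thesis
    using assms E_apply(1)[OF f] incl_closed[OF D_component] by (simp add: E_ops_apply \<epsilon>_apply)
qed

lemma corner_eqI:
  assumes "i < N" "j < N" "f \<in> corner i j" "g \<in> corner i j"
    and eq: "f (incl j (x j)) i = g (incl j (x j)) i"
  shows "f = g"
proof (rule E_eqI)
  show fg: "f \<in> carrier E" "g \<in> carrier E"
    using assms by (auto simp: corner_def)
  show "f (incl k (x k)) = g (incl k (x k))" if k: "k < N" for k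
  proof (cases "k = j")
    case True
    then show ?thesis
      using corner_apply[OF assms(1-3) incl_closed[OF cyc_closed[OF k]]]
        corner_apply[OF assms(1,2,4) incl_closed[OF cyc_closed[OF k]]] assms(2) eq
      by (simp add: incl_apply)
  next
    case False
    have "f' (incl k (x k)) = \<zero>\<^bsub>D\<^esub>" if f': "f' \<in> corner i j" for f'
    proof -
      have f'E: "f' \<in> carrier E" and "f' (incl k (x k)) = (f' \<otimes>\<^bsub>E\<^esub> \<epsilon> j) (incl k (x k))"
        using f' by (auto simp: corner_def)
      then show ?thesis
        using False k assms(2) cyc_closed
          module_hom_zero[OF D.left_module_axioms D.left_module_axioms E_hom[OF f'E]]
        by (simp add: E_ops_apply incl_closed \<epsilon>_incl_other)
    qed
    then show ?thesis
      using assms(3,4) by simp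
  qed
qed

text \<open>The value at the generator of summand \<open>j\<close> is some \<open>p x_i\<close>. As
  \<open>X^(l j)\<close> kills that generator, it kills the value, which is the
  divisibility.\<close>

lemma corner_value:
  assumes "i < N" "j < N" "f \<in> corner i j"
  obtains p where "f (incl j (x j)) = incl i (\<Phi> p \<odot>\<^bsub>Ms ! i\<^esub> x i)" "monom 1 (l i) dvd monom 1 (l j) * p"
proof -
  have f: "f \<in> carrier E"
    using assms(3) by (simp add: corner_def)
  have z: "incl j (x j) \<in> carrier D"
    using cyc_closed[OF assms(2)] by (rule incl_closed)
  have fz: "f (incl j (x j)) \<in> carrier D"
    using E_apply(1)[OF f z] .
  obtain p where p: "f (incl j (x j)) i = \<Phi> p \<odot>\<^bsub>Ms ! i\<^esub> x i"
    using cyclicD(4)[OF cyc[OF assms(1)] D_component[OF fz assms(1)]] by blast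
  have 1: "f (incl j (x j)) = incl i (\<Phi> p \<odot>\<^bsub>Ms ! i\<^esub> x i)"
    using corner_apply[OF assms z] assms(2) p by (simp add: incl_apply)
  have "\<Phi> (monom 1 (l j)) \<odot>\<^bsub>D\<^esub> incl j (x j) = \<zero>\<^bsub>D\<^esub>"
    using assms(2) z cyclic_annihilated[OF cyc cyc_closed] left_module.smult_zero_right[OF cyc_module] Phi_closed
    by (intro D_eqI) (auto simp: D_simps(3,4) incl_apply D.smult_closed)
  then have "\<Phi> (monom 1 (l j)) \<odot>\<^bsub>D\<^esub> f (incl j (x j)) = \<zero>\<^bsub>D\<^esub>"
    using E_apply(3)[OF f Phi_closed z]
      module_hom_zero[OF D.left_module_axioms D.left_module_axioms E_hom[OF f]] by metis
  then have "\<Phi> (monom 1 (l j)) \<odot>\<^bsub>Ms ! i\<^esub> f (incl j (x j)) i = \<zero>\<^bsub>Ms ! i\<^esub>"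
    using assms(1) by (metis D_simps(3,4))
  then have "\<Phi> (monom 1 (l j) * p) \<odot>\<^bsub>Ms ! i\<^esub> x i = \<zero>\<^bsub>Ms ! i\<^esub>"
    using act_mult[OF cyc_module cyc_closed] assms(1) p by simp
  then show thesis
    using that 1 cyclicD(5)[OF cyc[OF assms(1)]] by blast
qed

text \<open>The converse of \<open>corner_value\<close>: the divisibility makes
  \<open>X^(l j)\<close> kill \<open>p x_i\<close>, so that \<open>x_j \<mapsto> p x_i\<close>
  extends to a homomorphism.\<close>

lemma corner_exists:
  assumes "i < N" "j < N" "monom 1 (l i) dvd monom 1 (l j) * p"
  shows "\<exists>f\<in>corner i j. f (incl j (x j)) i = \<Phi> p \<odot>\<^bsub>Ms ! i\<^esub> x i"
proof -
  let ?z = "\<Phi> p \<odot>\<^bsub>Ms ! i\<^esub> x i"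
  have z: "?z \<in> carrier (Ms ! i)"
    using act_closed[OF cyc_module cyc_closed] assms(1) by simp
  have "\<Phi> (monom 1 (l j)) \<odot>\<^bsub>Ms ! i\<^esub> ?z = \<zero>\<^bsub>Ms ! i\<^esub>"
    using assms(1,3) cyclicD(5)[OF cyc] by (simp flip: act_mult[OF cyc_module cyc_closed])
  then obtain h where h: "h \<in> module_hom A (Ms ! j) (Ms ! i)" "\<And>q. h (\<Phi> q \<odot>\<^bsub>Ms ! j\<^esub> x j) = \<Phi> q \<odot>\<^bsub>Ms ! i\<^esub> ?z"
    using cyclic_hom[OF cyc cyc_module z] assms(1,2) by blast
  have hx: "h (x j) = ?z"
    using h(2)[of 1] assms(1,2) z act_1[OF cyc_module] cyc_closed by simp
  let ?f = "\<lambda>z\<in>carrier D. incl i (h (z j))"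
  have f: "?f \<in> carrier E"
    by (rule corner_element_closed[OF assms(1,2) h(1)])
  have hc: "h (z j) \<in> carrier (Ms ! i)" if "z \<in> carrier D" for z
    using module_homD(1)[OF h(1) D_component[OF that assms(2)]] .
  have "\<epsilon> i \<otimes>\<^bsub>E\<^esub> ?f = ?f"
    using hc assms(1) f \<epsilon>_closed
    by (intro E_ext) (auto simp: E_ops_apply \<epsilon>_incl)
  moreover have "?f \<otimes>\<^bsub>E\<^esub> \<epsilon> j = ?f"
    using assms(2) f \<epsilon>_closed
    by (intro E_ext) (auto simp: E_ops_apply \<epsilon>_apply incl_closed incl_apply D_component)
  moreover have "?f (incl j (x j)) i = ?z"
    using assms(1,2) incl_closed[OF cyc_closed] hx by (simp add: incl_apply)
  ultimately show ?thesis
    using f by (intro bexI[of _ ?f]) (auto simp: corner_def)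
qed

end

lemma finite_iso_classes:
  fixes T :: "nat \<Rightarrow> ('k::field, 'a) coord_module"
  assumes "\<And>M. M \<in> \<C> \<Longrightarrow> left_module A M"
    and T: "\<And>M. M \<in> \<C> \<Longrightarrow> \<exists>i<n. T i \<in> \<C> \<and> module_iso A M (T i)"
  shows "finite (iso_classes A \<C>)"
proof -
  let ?r = "{(M, N). M \<in> \<C> \<and> N \<in> \<C> \<and> module_iso A M N}"
  have eq: "equiv \<C> ?r"
    using assms(1) by (rule equiv_module_iso)
  have "iso_classes A \<C> \<subseteq> (\<lambda>i. ?r `` {T i}) ` {..<n}"
    unfolding iso_classes_def
  proof
    fix X assume "X \<in> \<C> // ?r"
    then obtain M where M: "M \<in> \<C>" "X = ?r `` {M}"
      by (rule quotientE)
    obtain i where i: "i < n" "T i \<in> \<C>" "module_iso A M (T i)"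
      using T[OF M(1)] by blast
    then have "(M, T i) \<in> ?r"
      using M(1) by blast
    then have "X = ?r `` {T i}"
      using equiv_class_eq[OF eq] M(2) by blast
    then show "X \<in> (\<lambda>i. ?r `` {T i}) ` {..<n}"
      using i(1) by blast
  qed
  then show ?thesis
    using finite_surj[of "{..<n}"] by auto
qed

section \<open>Locality and dimensions of the corners, and the magnitude of the endomorphism
  ring\<close>

context cyclic_family
begin

lemma \<epsilon>_idempotent: "i < N \<Longrightarrow> \<epsilon> i \<otimes>\<^bsub>E\<^esub> \<epsilon> i = \<epsilon> i"
  using \<epsilon>_closed
  by (intro E_ext) (auto simp: E_ops_apply \<epsilon>_apply incl_closed incl_apply D_component)

lemma \<epsilon>_in_corner: "i < N \<Longrightarrow> \<epsilon> i \<in> corner i i"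
  by (simp add: corner_def \<epsilon>_closed \<epsilon>_idempotent)

lemma \<epsilon>_value: "i < N \<Longrightarrow> \<epsilon> i (incl i (x i)) i = x i"
  by (simp add: \<epsilon>_incl cyc_closed incl_apply)

lemma corner_add:
  assumes "i < N" "j < N" "f \<in> corner i j" "g \<in> corner i j"
  shows "f \<oplus>\<^bsub>E\<^esub> g \<in> corner i j"
  using assms \<epsilon>_closed by (simp add: corner_def E.l_distr E.r_distr)

lemma corner_scale:
  assumes "i < N" "j < N" "f \<in> corner i j"
  shows "scale p \<otimes>\<^bsub>E\<^esub> f \<in> corner i j"
proof -
  have f: "f \<in> carrier E" "\<epsilon> i \<otimes>\<^bsub>E\<^esub> f = f" "f \<otimes>\<^bsub>E\<^esub> \<epsilon> j = f"
    using assms(3) by (auto simp: corner_def)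
  have "\<epsilon> i \<otimes>\<^bsub>E\<^esub> (scale p \<otimes>\<^bsub>E\<^esub> f) = scale p \<otimes>\<^bsub>E\<^esub> (\<epsilon> i \<otimes>\<^bsub>E\<^esub> f)"
    using E.m_assoc[OF \<epsilon>_closed[OF assms(1)] scale_closed f(1), of p]
      E.m_assoc[OF scale_closed \<epsilon>_closed[OF assms(1)] f(1), of p]
      scale_central[OF \<epsilon>_closed[OF assms(1)], of p] by simp
  moreover have "(scale p \<otimes>\<^bsub>E\<^esub> f) \<otimes>\<^bsub>E\<^esub> \<epsilon> j = scale p \<otimes>\<^bsub>E\<^esub> f"
    using E.m_assoc[OF scale_closed f(1) \<epsilon>_closed[OF assms(2)], of p] f(3) by simp
  ultimately show ?thesis
    using f scale_closed by (simp add: corner_def)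
qed

lemma scale_value:
  assumes "i < N" "j < N" "f \<in> carrier E"
  shows "(scale p \<otimes>\<^bsub>E\<^esub> f) (incl j (x j)) i = \<Phi> p \<odot>\<^bsub>Ms ! i\<^esub> f (incl j (x j)) i"
  using assms E_apply(1)[OF assms(3)] incl_closed[OF cyc_closed[OF assms(2)]]
  by (simp add: E_ops_apply scale_apply D_simps(3))

text \<open>An inverse \<open>q\<close> of \<open>p\<close> modulo \<open>X^(l i)\<close> yields the
  left inverse \<open>scale q\<close>: the product with \<open>a\<close> fixes the generator, and
  corner elements are determined by their value there.\<close>

lemma corner_unit:
  assumes i: "i < N" and a: "a \<in> corner i i" "a (incl i (x i)) i = \<Phi> p \<odot>\<^bsub>Ms ! i\<^esub> x i"
    and p: "coeff p 0 \<noteq> 0"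
  shows "\<exists>b\<in>carrier E. b \<otimes>\<^bsub>E\<^esub> a = \<epsilon> i"
proof -
  obtain q where "monom 1 (l i) dvd q * p - 1"
    using poly_unit_modulo_monom[OF p] by blast
  then have "\<Phi> (q * p) \<odot>\<^bsub>Ms ! i\<^esub> x i = \<Phi> 1 \<odot>\<^bsub>Ms ! i\<^esub> x i"
    using cyclic_eq_iff[OF cyc[OF i]] by blast
  then have "\<Phi> q \<odot>\<^bsub>Ms ! i\<^esub> (\<Phi> p \<odot>\<^bsub>Ms ! i\<^esub> x i) = x i"
    using act_mult[OF cyc_module cyc_closed] act_1[OF cyc_module cyc_closed] i by simp
  then have "scale q \<otimes>\<^bsub>E\<^esub> a = \<epsilon> i"
    using a i \<epsilon>_in_corner corner_scale scale_value[OF i i, of a q] \<epsilon>_value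
    by (intro corner_eqI[of i i]) (auto simp: corner_def)
  then show ?thesis
    using scale_closed by blast
qed

text \<open>If \<open>a\<close> sends the generator to \<open>p x_i\<close>, then
  \<open>\<epsilon> i - a\<close> sends it to \<open>(1 - p) x_i\<close>, and one of the two
  polynomials has a nonzero constant coefficient.\<close>

lemma local_idempotent_\<epsilon>:
  assumes i: "i < N"
  shows "local_idempotent E (\<epsilon> i)"
  unfolding local_idempotent_def
proof (intro conjI ballI impI)
  interpret Mi: left_module A "Ms ! i" by (rule cyc_module[OF i])
  show "\<epsilon> i \<in> carrier E" "\<epsilon> i \<otimes>\<^bsub>E\<^esub> \<epsilon> i = \<epsilon> i"
    using i \<epsilon>_closed \<epsilon>_idempotent by auto
  have z: "incl i (x i) \<in> carrier D"
    using incl_closed[OF cyc_closed[OF i]] .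
  show "\<epsilon> i \<noteq> \<zero>\<^bsub>E\<^esub>"
  proof
    assume "\<epsilon> i = \<zero>\<^bsub>E\<^esub>"
    then have "\<Phi> 1 \<odot>\<^bsub>Ms ! i\<^esub> x i = \<zero>\<^bsub>Ms ! i\<^esub>"
      using \<epsilon>_value[OF i] z i by (simp add: E_ops_apply D_simps(4) act_1[OF cyc_module cyc_closed])
    then have "monom 1 (l i) dvd (1 :: 'k poly)"
      using cyclicD(5)[OF cyc[OF i]] by blast
    then show False
      using cyclicD(2)[OF cyc[OF i]] by (auto simp: monom_1_dvd_iff')
  qed
  fix a assume a: "a \<in> carrier E" "\<epsilon> i \<otimes>\<^bsub>E\<^esub> a = a \<and> a \<otimes>\<^bsub>E\<^esub> \<epsilon> i = a"
  then have ac: "a \<in> corner i i"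
    by (simp add: corner_def)
  obtain p where p: "a (incl i (x i)) = incl i (\<Phi> p \<odot>\<^bsub>Ms ! i\<^esub> x i)"
    using corner_value[OF i i ac] by blast
  then have p: "a (incl i (x i)) i = \<Phi> p \<odot>\<^bsub>Ms ! i\<^esub> x i"
    using i by (simp add: incl_apply)
  show "\<exists>b\<in>carrier E. b \<otimes>\<^bsub>E\<^esub> a = \<epsilon> i \<or> b \<otimes>\<^bsub>E\<^esub> (\<epsilon> i \<ominus>\<^bsub>E\<^esub> a) = \<epsilon> i"
  proof (cases "coeff p 0 = 0")
    case False
    then show ?thesis
      using corner_unit[OF i ac p] by blast
  next
    case True
    let ?b = "\<epsilon> i \<ominus>\<^bsub>E\<^esub> a"
    have bE: "?b \<in> carrier E"
      using a \<epsilon>_closed[OF i] by simp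
    have bc: "?b \<in> corner i i"
      using a bE \<epsilon>_closed[OF i] \<epsilon>_idempotent[OF i]
      by (simp add: corner_def E.minus_eq E.l_distr E.r_distr E.l_minus E.r_minus)
    have "?b \<oplus>\<^bsub>E\<^esub> a = \<epsilon> i"
      using a(1) \<epsilon>_closed[OF i] by (simp add: E.minus_eq E.a_assoc E.l_neg)
    then have "?b (incl i (x i)) i \<oplus>\<^bsub>Ms ! i\<^esub> \<Phi> p \<odot>\<^bsub>Ms ! i\<^esub> x i = x i"
      using \<epsilon>_value[OF i] z i p by (metis E_ops_apply(1) D_simps(2))
    moreover have "?b (incl i (x i)) i \<in> carrier (Ms ! i)"
      using E_apply(1)[OF bE z] D_component i by blast
    moreover have px: "\<Phi> p \<odot>\<^bsub>Ms ! i\<^esub> x i \<in> carrier (Ms ! i)"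
      using act_closed[OF cyc_module cyc_closed] i by simp
    ultimately have "?b (incl i (x i)) i = x i \<ominus>\<^bsub>Ms ! i\<^esub> \<Phi> p \<odot>\<^bsub>Ms ! i\<^esub> x i"
      using Mi.M.a_assoc[of "?b (incl i (x i)) i" "\<Phi> p \<odot>\<^bsub>Ms ! i\<^esub> x i" "\<ominus>\<^bsub>Ms ! i\<^esub> (\<Phi> p \<odot>\<^bsub>Ms ! i\<^esub> x i)"]
      by (simp add: Mi.M.minus_eq Mi.M.r_neg)
    also have "\<dots> = \<Phi> (1 - p) \<odot>\<^bsub>Ms ! i\<^esub> x i"
      using act_diff[OF cyc_module cyc_closed] act_1[OF cyc_module cyc_closed] i by simp
    finally have "\<exists>b\<in>carrier E. b \<otimes>\<^bsub>E\<^esub> ?b = \<epsilon> i"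
      using corner_unit[OF i bc, of "1 - p"] True by simp
    then show ?thesis by blast
  qed
qed

text \<open>Coordinates on \<open>E\<close>, through which left ideals of \<open>E\<close> become
  coordinate modules. An endomorphism is given by its values at the generators, each a double
  sequence of scalars; pairing merges the three indices into one.\<close>

definition encode_endomorphism :: "((nat \<Rightarrow> nat \<Rightarrow> 'k) \<Rightarrow> (nat \<Rightarrow> nat \<Rightarrow> 'k)) \<Rightarrow> nat \<Rightarrow> 'k" where
  "encode_endomorphism f n =
     (case prod_decode n of (i, n') \<Rightarrow> case prod_decode n' of (j, t) \<Rightarrow> f (incl i (x i)) j t)"

lemma inj_on_encode_endomorphism: "inj_on encode_endomorphism (carrier E)"
proof (rule inj_onI)
  fix f g assume "f \<in> carrier E" "g \<in> carrier E" and eq: "encode_endomorphism f = encode_endomorphism g"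
  moreover have "f (incl i (x i)) j t = g (incl i (x i)) j t" for i j t
    using fun_cong[OF eq, of "prod_encode (i, prod_encode (j, t))"] by (simp add: encode_endomorphism_def)
  ultimately show "f = g"
    by (intro E_eqI ext) auto
qed

text \<open>The possible images of the generator of summand \<open>j\<close> are the multiples of
  \<open>X^(l i - l j) x_i\<close>, which form a module of length \<open>min (l i) (l j)\<close>.
  For \<open>l i \<le> l j\<close> the truncated difference is zero and every multiple of
  \<open>x_i\<close> is possible.\<close>

lemma corner_bij:
  assumes i: "i < N" and j: "j < N"
  obtains \<delta> where "bij_betw \<delta> (poly_lt (min (l i) (l j))) (corner i j)"
    "\<And>p q. p \<in> poly_lt (min (l i) (l j)) \<Longrightarrow> q \<in> poly_lt (min (l i) (l j)) \<Longrightarrow> \<delta> (p + q) = \<delta> p \<oplus>\<^bsub>E\<^esub> \<delta> q"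
    "\<And>c p. p \<in> poly_lt (min (l i) (l j)) \<Longrightarrow>
       \<delta> (Polynomial.smult c p) = (c \<odot>\<^bsub>E\<^esub> \<one>\<^bsub>E\<^esub>) \<otimes>\<^bsub>E\<^esub> \<delta> p"
proof -
  let ?d = "min (l i) (l j)" and ?X = "monom (1 :: 'k) (l i - l j)"
  let ?v = "\<lambda>f. f (incl j (x j)) i"
  have lX: "l i - l j + ?d = l i"
    by simp
  have dvd: "monom 1 (l i) dvd monom 1 (l j) * (p * ?X)" for p :: "'k poly"
  proof -
    have "monom 1 (l i) dvd monom (1 :: 'k) (l j + (l i - l j))"
      by (auto simp: monom_1_dvd_iff')
    then have "monom 1 (l i) dvd monom (1 :: 'k) (l j) * ?X"
      by (simp add: mult_monom)
    then show ?thesis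
      using dvd_mult[of _ _ p] by (simp add: ac_simps)
  qed
  define \<delta> where "\<delta> p = (SOME f. f \<in> corner i j \<and> ?v f = \<Phi> (p * ?X) \<odot>\<^bsub>Ms ! i\<^esub> x i)" for p
  have "\<exists>f. f \<in> corner i j \<and> ?v f = \<Phi> (p * ?X) \<odot>\<^bsub>Ms ! i\<^esub> x i" for p
    using corner_exists[OF i j dvd] by blast
  then have d: "\<delta> p \<in> corner i j \<and> ?v (\<delta> p) = \<Phi> (p * ?X) \<odot>\<^bsub>Ms ! i\<^esub> x i" for p
    unfolding \<delta>_def by (rule someI_ex)
  have z: "incl j (x j) \<in> carrier D"
    using incl_closed[OF cyc_closed[OF j]] .
  show thesis
  proof (rule that[of \<delta>])
    show "bij_betw \<delta> (poly_lt ?d) (corner i j)"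
      unfolding bij_betw_def
    proof
      show "inj_on \<delta> (poly_lt ?d)"
      proof (rule inj_onI)
        fix p q assume pq: "p \<in> poly_lt ?d" "q \<in> poly_lt ?d" and eq: "\<delta> p = \<delta> q"
        have "\<Phi> (p * ?X) \<odot>\<^bsub>Ms ! i\<^esub> x i = \<Phi> (q * ?X) \<odot>\<^bsub>Ms ! i\<^esub> x i"
          using d[of p] d[of q] eq by simp
        then have "monom 1 (l i) dvd p * ?X - q * ?X"
          using cyclic_eq_iff[OF cyc[OF i]] by blast
        then have "monom 1 (l i) dvd ?X * (p - q)"
          by (simp add: algebra_simps)
        then have 0: "coeff (?X * (p - q)) k = 0" if "k < l i" for k
          using that by (simp add: monom_1_dvd_iff')
        have "coeff (p - q) k = 0" for k
        proof (cases "k < ?d")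
          case True
          then have "l i - l j + k < l i"
            using lX by linarith
          then show ?thesis
            using 0[of "l i - l j + k"] by (simp add: coeff_monom_mult)
        next
          case False
          then have "k \<ge> ?d"
            by linarith
          then have "coeff p k = 0" "coeff q k = 0"
            using pq unfolding poly_lt_def by blast+
          then show ?thesis
            by simp
        qed
        then show "p = q"
          by (simp add: poly_eq_iff)
      qed
      show "\<delta> ` poly_lt ?d = corner i j"
      proof
        show "\<delta> ` poly_lt ?d \<subseteq> corner i j"
          using d by blast
        show "corner i j \<subseteq> \<delta> ` poly_lt ?d"
        proof
          fix f assume f: "f \<in> corner i j"
          obtain p where p: "f (incl j (x j)) = incl i (\<Phi> p \<odot>\<^bsub>Ms ! i\<^esub> x i)"
            "monom 1 (l i) dvd monom 1 (l j) * p"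
            using corner_value[OF i j f] by blast
          have low: "coeff p k = 0" if "k < l i - l j" for k
          proof -
            have "coeff (monom 1 (l j) * p) (l j + k) = 0"
              using p(2) that unfolding monom_1_dvd_iff' by simp
            then show ?thesis
              by (simp add: coeff_monom_mult)
          qed
          \<comment> \<open>The coefficients of \<open>p\<close> in the degrees from
            \<open>l i - l j\<close> up to \<open>l i - 1\<close>. The lower ones vanish by the
            divisibility, and the higher ones act as zero.\<close>
          define q where "q = (\<Sum>k<?d. monom (coeff p (l i - l j + k)) k)"
          have q_coeff: "coeff q k = (if k < ?d then coeff p (l i - l j + k) else 0)" for k
            by (simp add: q_def coeff_sum)
          have "q \<in> poly_lt ?d"
            by (simp add: poly_lt_def q_coeff del: min_less_iff_conj)
          moreover have "monom 1 (l i) dvd q * ?X - p"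
            unfolding monom_1_dvd_iff'
          proof (intro allI impI)
            fix k assume k: "k < l i"
            show "coeff (q * ?X - p) k = 0"
            proof (cases "k < l i - l j")
              case True
              then show ?thesis
                using low by (simp add: mult.commute[of q] coeff_monom_mult)
            next
              case False
              then have "k - (l i - l j) < ?d"
                using k lX by linarith
              then show ?thesis
                using False by (simp add: mult.commute[of q] coeff_monom_mult q_coeff del: min_less_iff_conj)
            qed
          qed
          then have "\<Phi> (q * ?X) \<odot>\<^bsub>Ms ! i\<^esub> x i = \<Phi> p \<odot>\<^bsub>Ms ! i\<^esub> x i"
            using cyclic_eq_iff[OF cyc[OF i]] by blast
          then have "\<delta> q = f"
            using d[of q] p(1) i f by (intro corner_eqI[OF i j]) (auto simp: incl_apply)
          ultimately show "f \<in> \<delta> ` poly_lt ?d"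
            by blast
        qed
      qed
    qed
    fix p q :: "'k poly"
    show "\<delta> (p + q) = \<delta> p \<oplus>\<^bsub>E\<^esub> \<delta> q"
    proof (rule corner_eqI[OF i j])
      show "\<delta> (p + q) \<in> corner i j" "\<delta> p \<oplus>\<^bsub>E\<^esub> \<delta> q \<in> corner i j"
        using d corner_add[OF i j] by auto
      have "?v (\<delta> (p + q)) = \<Phi> (p * ?X + q * ?X) \<odot>\<^bsub>Ms ! i\<^esub> x i"
        using d[of "p + q"] by (simp add: distrib_right)
      also have "\<dots> = ?v (\<delta> p) \<oplus>\<^bsub>Ms ! i\<^esub> ?v (\<delta> q)"
        using d[of p] d[of q] act_add[OF cyc_module cyc_closed] i by simp
      finally show "?v (\<delta> (p + q)) = ?v (\<delta> p \<oplus>\<^bsub>E\<^esub> \<delta> q)"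
        using z i by (simp add: E_ops_apply D_simps(2))
    qed
  next
    fix c :: 'k and p :: "'k poly"
    have "\<delta> (Polynomial.smult c p) = scale [:c:] \<otimes>\<^bsub>E\<^esub> \<delta> p"
    proof (rule corner_eqI[OF i j])
      show "\<delta> (Polynomial.smult c p) \<in> corner i j" "scale [:c:] \<otimes>\<^bsub>E\<^esub> \<delta> p \<in> corner i j"
        using d corner_scale[OF i j] by auto
      have "?v (\<delta> (Polynomial.smult c p)) = \<Phi> ([:c:] * (p * ?X)) \<odot>\<^bsub>Ms ! i\<^esub> x i"
        using d[of "Polynomial.smult c p"] by simp
      also have "\<dots> = \<Phi> [:c:] \<odot>\<^bsub>Ms ! i\<^esub> ?v (\<delta> p)"
        by (simp only: d[THEN conjunct2] act_mult[OF cyc_module[OF i] cyc_closed[OF i], of "[:c:]"])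
      also have "\<dots> = ?v (scale [:c:] \<otimes>\<^bsub>E\<^esub> \<delta> p)"
        using scale_value[OF i j] d[of p] by (simp add: corner_def)
      finally show "?v (\<delta> (Polynomial.smult c p)) = ?v (scale [:c:] \<otimes>\<^bsub>E\<^esub> \<delta> p)" .
    qed
    then show "\<delta> (Polynomial.smult c p) = (c \<odot>\<^bsub>E\<^esub> \<one>\<^bsub>E\<^esub>) \<otimes>\<^bsub>E\<^esub> \<delta> p"
      by (simp add: scalar_eq_scale)
  qed
qed

lemma hom_dim_principal_eq_min:
  assumes i: "i < N" and j: "j < N"
    and "principal_module E P (\<epsilon> i) y" "principal_module E P' (\<epsilon> j) y'"
  shows "hom_dim E P P' = min (l i) (l j)"
proof -
  obtain \<delta> where "bij_betw \<delta> (poly_lt (min (l i) (l j))) (corner i j)"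
    "\<And>p q. p \<in> poly_lt (min (l i) (l j)) \<Longrightarrow> q \<in> poly_lt (min (l i) (l j)) \<Longrightarrow> \<delta> (p + q) = \<delta> p \<oplus>\<^bsub>E\<^esub> \<delta> q"
    "\<And>c p. p \<in> poly_lt (min (l i) (l j)) \<Longrightarrow>
       \<delta> (Polynomial.smult c p) = (c \<odot>\<^bsub>E\<^esub> \<one>\<^bsub>E\<^esub>) \<otimes>\<^bsub>E\<^esub> \<delta> p"
    using corner_bij[OF i j] by blast
  then show ?thesis
    using assms(3,4) unfolding corner_def
    by (intro hom_dim_principal[of E P "\<epsilon> i" y P' "\<epsilon> j" y' \<delta>])
      (auto simp: scalar_eq_scale scale_closed scale_central)
qed

text \<open>An isomorphism lets the identity of the simple summand \<open>i\<close> factor as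
  \<open>a b\<close> through summand \<open>j\<close>. The image of \<open>b\<close> is killed by
  \<open>X\<close>; for \<open>l j > 1\<close> it therefore consists of multiples of
  \<open>X\<close>, and so does the image of \<open>a b\<close>. But \<open>X\<close> is zero on a
  simple module.\<close>

lemma isomorphic_principal_simple:
  assumes i: "i < N" and j: "j < N" and "l i = 1"
    and P: "principal_module E P (\<epsilon> i) y" "principal_module E P' (\<epsilon> j) y'" "module_iso E P P'"
  shows "l j = 1"
proof (rule ccontr)
  assume "l j \<noteq> 1"
  then have lj: "l j > 1"
    using cyclicD(2)[OF cyc[OF j]] by simp
  obtain a b where a: "a \<in> carrier E" "\<epsilon> i \<otimes>\<^bsub>E\<^esub> a = a" "a \<otimes>\<^bsub>E\<^esub> \<epsilon> j = a"
    and b: "b \<in> carrier E" "\<epsilon> j \<otimes>\<^bsub>E\<^esub> b = b" "b \<otimes>\<^bsub>E\<^esub> \<epsilon> i = b" and ab: "a \<otimes>\<^bsub>E\<^esub> b = \<epsilon> i"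
    using principal_module.isomorphic_imp_factors[OF P] by blast
  let ?z = "incl i (x i)"
  have z: "?z \<in> carrier D"
    using incl_closed[OF cyc_closed[OF i]] .
  have "b \<in> corner j i"
    using b by (simp add: corner_def)
  then obtain p where p: "b ?z = incl j (\<Phi> p \<odot>\<^bsub>Ms ! j\<^esub> x j)" "monom 1 (l j) dvd monom 1 1 * p"
    using corner_value[OF j i] \<open>l i = 1\<close> by metis
  have "coeff p 0 = coeff (monom 1 1 * p) 1"
    by (simp add: coeff_monom_mult)
  also have "\<dots> = 0"
    using p(2) lj unfolding monom_1_dvd_iff' by blast
  finally have "monom 1 1 dvd p"
    by (simp add: monom_1_dvd_iff')
  then obtain r where r: "p = monom 1 1 * r"
    by (elim dvdE)
  let ?w = "incl j (\<Phi> r \<odot>\<^bsub>Ms ! j\<^esub> x j)"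
  have rx: "\<Phi> r \<odot>\<^bsub>Ms ! j\<^esub> x j \<in> carrier (Ms ! j)"
    using act_closed[OF cyc_module cyc_closed] j by simp
  have w: "?w \<in> carrier D"
    using incl_closed[OF rx] .
  have "b ?z = \<Phi> (monom 1 1) \<odot>\<^bsub>D\<^esub> ?w"
    using incl_smult[OF j rx Phi_closed] act_mult[OF cyc_module cyc_closed] j p(1) r by simp
  then have "\<epsilon> i ?z = \<Phi> (monom 1 1) \<odot>\<^bsub>D\<^esub> a ?w"
    using ab[symmetric] z E_apply(3)[OF a(1) Phi_closed w] by (simp add: E_ops_apply)
  then have "x i = \<Phi> (monom 1 (l i)) \<odot>\<^bsub>Ms ! i\<^esub> a ?w i"
    using \<epsilon>_value[OF i] i \<open>l i = 1\<close> by (simp add: D_simps(3))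
  also have "\<dots> = \<zero>\<^bsub>Ms ! i\<^esub>"
    using cyclic_annihilated[OF cyc[OF i] D_component[OF E_apply(1)[OF a(1) w] i]] .
  finally have "\<Phi> 1 \<odot>\<^bsub>Ms ! i\<^esub> x i = \<zero>\<^bsub>Ms ! i\<^esub>"
    using act_1[OF cyc_module[OF i] cyc_closed[OF i]] by metis
  then have "monom 1 (l i) dvd (1 :: 'k poly)"
    using cyclicD(5)[OF cyc[OF i]] by blast
  then show False
    using \<open>l i = 1\<close> by (auto simp: monom_1_dvd_iff')
qed

text \<open>The list \<open>Ps\<close> is arbitrary, so \<open>\<sigma>\<close> records to which
  idempotent each entry belongs. It is injective because equal indices give isomorphic entries, and
  the matrix becomes one of minima of distinct numbers.\<close>

lemma magnitude_endomorphism_algebra: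
  assumes inj: "inj_on l {..<N}" and i0: "i0 < N" "l i0 = 1"
  shows "magnitude E = Some 1"
proof -
  let ?C = "indecomposable_projectives E"
  have left: "left_module E P" if "P \<in> ?C" for P
    using that by (simp add: indecomposable_projectives_def indecomposables_def fg_module_def)
  have ex: "\<exists>P y. principal_module E P (\<epsilon> i) y \<and> P \<in> ?C" if i: "i < N" for i
    using principal_module_exists[OF E.ring_axioms inj_on_encode_endomorphism \<epsilon>_closed[OF i] \<epsilon>_idempotent[OF i]]
      principal_module_indecomposable_projective local_idempotent_\<epsilon>[OF i] by metis
  then obtain T yT where T: "\<And>i. i < N \<Longrightarrow> principal_module E (T i) (\<epsilon> i) (yT i) \<and> T i \<in> ?C"
    by metis
  have classify: "\<exists>i y. i < N \<and> principal_module E P (\<epsilon> i) y" if "P \<in> ?C" for P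
    using indecomposable_projective_principal[OF E.ring_axioms inj_on_encode_endomorphism
        local_idempotent_\<epsilon> finsum_\<epsilon> that] by blast
  have "finite (iso_classes E ?C)"
  proof (rule finite_iso_classes[of ?C E N T])
    fix P assume "P \<in> ?C"
    then obtain i y where iy: "i < N" "principal_module E P (\<epsilon> i) y"
      using classify by blast
    show "\<exists>i<N. T i \<in> ?C \<and> module_iso E P (T i)"
      using iy(1) T[OF iy(1)] principal_module.isomorphic[OF iy(2), of "T i" "yT i"]
      by (intro exI[of _ i]) simp
  qed (rule left)
  then have exPs: "\<exists>Ps. iso_representatives E ?C Ps"
    by (intro iso_representatives_exists left)
  define Ps where "Ps = (SOME Ps. iso_representatives E ?C Ps)"
  have "iso_representatives E ?C Ps"
    unfolding Ps_def by (rule someI_ex[OF exPs])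
  then have PsC: "set Ps \<subseteq> ?C" and uniq: "\<And>P. P \<in> ?C \<Longrightarrow> \<exists>!a. a < length Ps \<and> module_iso E P (Ps ! a)"
    by (auto simp: iso_representatives_def)
  have PsC': "Ps ! a \<in> ?C" if "a < length Ps" for a
    using PsC that by auto
  have "\<exists>\<sigma>. \<forall>a<length Ps. \<sigma> a < N \<and> (\<exists>y. principal_module E (Ps ! a) (\<epsilon> (\<sigma> a)) y)"
    using classify[OF PsC'] by metis
  then obtain \<sigma> y where \<sigma>: "\<And>a. a < length Ps \<Longrightarrow> \<sigma> a < N \<and> principal_module E (Ps ! a) (\<epsilon> (\<sigma> a)) (y a)"
    by metis
  have inj\<sigma>: "inj_on \<sigma> {..<length Ps}"
  proof (rule inj_onI)
    fix a b assume ab: "a \<in> {..<length Ps}" "b \<in> {..<length Ps}" "\<sigma> a = \<sigma> b"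
    then have "module_iso E (Ps ! a) (Ps ! b)"
      using \<sigma>[of a] \<sigma>[of b] principal_module.isomorphic by auto
    then show "a = b"
      using uniq[OF PsC'[of a]] module_iso_refl ab(1,2) by blast
  qed
  have "inj_on (\<lambda>a. l (\<sigma> a)) {..<length Ps}"
    using inj inj\<sigma> \<sigma> by (auto simp: inj_on_def)
  moreover have "l (\<sigma> a) > 0" if "a < length Ps" for a
    using cyclicD(2)[OF cyc] \<sigma>[OF that] by blast
  \<comment> \<open>The index \<open>\<sigma> a\<close> was chosen without regard to
    \<open>i0\<close>. That the entry isomorphic to \<open>T i0\<close> belongs to an idempotent of
    length 1 is the content of \<open>isomorphic_principal_simple\<close>.\<close>
  moreover obtain a0 where "a0 < length Ps" "l (\<sigma> a0) = 1"
  proof -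
    have T0: "principal_module E (T i0) (\<epsilon> i0) (yT i0)" "T i0 \<in> ?C"
      using T[OF i0(1)] by auto
    obtain a where a: "a < length Ps" "module_iso E (T i0) (Ps ! a)"
      using uniq[OF T0(2)] by blast
    then have "l (\<sigma> a) = 1"
      using isomorphic_principal_simple[OF i0(1) _ i0(2) T0(1), of "\<sigma> a" "Ps ! a" "y a"] \<sigma>[OF a(1)]
      by simp
    then show thesis
      using that a(1) by simp
  qed
  ultimately have "map_option sum_mat (mat_inverse (mat (length Ps) (length Ps)
      (\<lambda>(a, b). of_nat (min (l (\<sigma> a)) (l (\<sigma> b)))) :: rat mat)) = Some 1"
    by (rule sum_mat_inverse_min_matrix[where l = "\<lambda>a. l (\<sigma> a)"])
  moreover have hd: "hom_dim E (Ps ! a) (Ps ! b) = min (l (\<sigma> a)) (l (\<sigma> b))"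
    if "a < length Ps" "b < length Ps" for a b
    by (rule hom_dim_principal_eq_min[of _ _ _ "y a" _ "y b"]) (use \<sigma> that in auto)
  then have "hom_matrix E Ps = mat (length Ps) (length Ps) (\<lambda>(a, b). of_nat (min (l (\<sigma> a)) (l (\<sigma> b))))"
    using hd unfolding hom_matrix_def by (intro eq_matI) auto
  ultimately show ?thesis
    using exPs by (simp add: magnitude_def Ps_def)
qed

end

context truncated_polynomial_ring
begin

theorem module_category_magnitude_eq_1:
  assumes "representation_finite A"
  shows "module_category_magnitude A = Some 1"
proof -
  let ?C = "indecomposables A"
  have left: "left_module A M" if "M \<in> ?C" for M
    using that by (simp add: indecomposables_def fg_module_def)
  define Ms where "Ms = (SOME Ms. iso_representatives A ?C Ms)"
  have "iso_representatives A ?C Ms"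
    unfolding Ms_def
    using assms unfolding representation_finite_def
    by (intro someI_ex[of "iso_representatives A ?C"] iso_representatives_exists left)
  then have MsC: "set Ms \<subseteq> ?C" and uniq: "\<And>M. M \<in> ?C \<Longrightarrow> \<exists>!i. i < length Ms \<and> module_iso A M (Ms ! i)"
    by (auto simp: iso_representatives_def)
  have MsC': "Ms ! i \<in> ?C" if "i < length Ms" for i
    using MsC that by auto
  have "\<exists>x l. cyclic (Ms ! i) x l" if i: "i < length Ms" for i
  proof -
    have "indecomposable A (Ms ! i)"
      using MsC'[OF i] by (simp add: indecomposables_def)
    then show ?thesis
      using indecomposable_imp_cyclic[OF left[OF MsC'[OF i]]] by metis
  qed
  then obtain x l where cyc: "\<And>i. i < length Ms \<Longrightarrow> cyclic (Ms ! i) (x i) (l i)"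
    by metis
  interpret cyclic_family A \<Phi> m Ms x l
    by unfold_locales (rule cyc)
  have "inj_on l {..<length Ms}"
  proof (rule inj_onI)
    fix i j assume ij: "i \<in> {..<length Ms}" "j \<in> {..<length Ms}" "l i = l j"
    then have "module_iso A (Ms ! i) (Ms ! j)"
      using cyclic_isomorphic[of "Ms ! i" "x i" "l i" "Ms ! j" "x j"] cyc[of i] cyc[of j] by auto
    then show "i = j"
      using uniq[OF MsC'[of i]] module_iso_refl ij(1,2) by blast
  qed
  moreover obtain i0 where "i0 < length Ms" "l i0 = 1"
  proof -
    obtain S :: "('k, 'a) coord_module" and s where S: "cyclic S s 1"
      using simple_module_exists by blast
    then have "S \<in> ?C"
      using cyclic_fg cyclic_indecomposable by (auto simp: indecomposables_def)
    then obtain i where "i < length Ms" "module_iso A S (Ms ! i)"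
      using uniq by blast
    then show thesis
      using that cyclic_length_unique[OF S cyc] by simp
  qed
  ultimately have "magnitude E = Some 1"
    by (rule magnitude_endomorphism_algebra)
  then show ?thesis
    by (simp add: module_category_magnitude_def auslander_algebra_def Ms_def)
qed

end

section \<open>Kronecker modules\<close>

text \<open>The hypothesis is applied to the projection onto \<open>U\<close> along
  \<open>V\<close>, which has kernel \<open>V\<close> and fixed points \<open>U\<close>.\<close>

lemma indecomposableI:
  assumes "left_module R M" "carrier M \<noteq> {\<zero>\<^bsub>M\<^esub>}"
    and endo: "\<And>f. f \<in> module_hom R M M \<Longrightarrow>
      (\<forall>z\<in>carrier M. f z = \<zero>\<^bsub>M\<^esub> \<longrightarrow> z = \<zero>\<^bsub>M\<^esub>) \<or> (\<forall>z\<in>carrier M. f z = z \<longrightarrow> z = \<zero>\<^bsub>M\<^esub>)"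
  shows "indecomposable R M"
  unfolding indecomposable_def
proof (intro conjI allI impI assms(2))
  interpret left_module R M by fact
  fix U V assume "Module.submodule U R M \<and> Module.submodule V R M \<and>
    U <+>\<^bsub>M\<^esub> V = carrier M \<and> U \<inter> V = {\<zero>\<^bsub>M\<^esub>}"
  then have U: "Module.submodule U R M" and V: "Module.submodule V R M"
    and sum: "U <+>\<^bsub>M\<^esub> V = carrier M" and int: "U \<inter> V = {\<zero>\<^bsub>M\<^esub>}"
    by auto
  note Ud = submoduleD[OF U] and Vd = submoduleD[OF V]
  have UM: "u \<in> carrier M" if "u \<in> U" for u
    using Ud(1) that by blast
  have VM: "v \<in> carrier M" if "v \<in> V" for v
    using Vd(1) that by blast
  define f where "f z = (SOME u. u \<in> U \<and> z \<ominus>\<^bsub>M\<^esub> u \<in> V)" for z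
  have f: "f z \<in> U \<and> z \<ominus>\<^bsub>M\<^esub> f z \<in> V" if "z \<in> carrier M" for z
  proof -
    have "z \<in> U <+>\<^bsub>M\<^esub> V"
      using that sum by simp
    then obtain u v where uv: "u \<in> U" "v \<in> V" "z = u \<oplus>\<^bsub>M\<^esub> v"
      by (auto simp: set_add_def')
    have "z \<ominus>\<^bsub>M\<^esub> u = v"
      using uv UM[OF uv(1)] VM[OF uv(2)] M.a_comm[of u v] by (simp add: M.minus_eq M.a_assoc M.r_neg)
    then have "\<exists>u. u \<in> U \<and> z \<ominus>\<^bsub>M\<^esub> u \<in> V"
      using uv by blast
    then show ?thesis
      unfolding f_def by (rule someI_ex)
  qed
  have f_unique: "f z = u" if z: "z \<in> carrier M" and u: "u \<in> U" "z \<ominus>\<^bsub>M\<^esub> u \<in> V" for z u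
  proof -
    have fz: "f z \<in> U" "z \<ominus>\<^bsub>M\<^esub> f z \<in> V"
      using f[OF z] by auto
    have "(z \<ominus>\<^bsub>M\<^esub> u) \<ominus>\<^bsub>M\<^esub> (z \<ominus>\<^bsub>M\<^esub> f z) = (f z \<ominus>\<^bsub>M\<^esub> u) \<oplus>\<^bsub>M\<^esub> (z \<oplus>\<^bsub>M\<^esub> \<ominus>\<^bsub>M\<^esub> z)"
      using UM[OF fz(1)] UM[OF u(1)] z
      by (simp only: M.minus_eq M.minus_add M.minus_minus M.a_ac M.a_closed M.a_inv_closed)
    then have "f z \<ominus>\<^bsub>M\<^esub> u = (z \<ominus>\<^bsub>M\<^esub> u) \<ominus>\<^bsub>M\<^esub> (z \<ominus>\<^bsub>M\<^esub> f z)"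
      using UM[OF fz(1)] UM[OF u(1)] z by (simp add: M.r_neg)
    then have "f z \<ominus>\<^bsub>M\<^esub> u \<in> V"
      using Vd(4)[OF u(2) fz(2)] by simp
    then have "f z \<ominus>\<^bsub>M\<^esub> u = \<zero>\<^bsub>M\<^esub>"
      using Ud(4)[OF fz(1) u(1)] int by blast
    then show ?thesis
      using UM[OF fz(1)] UM[OF u(1)] by (metis M.minus_eq M.minus_equality M.minus_minus M.a_inv_closed)
  qed
  have "f \<in> module_hom R M M"
  proof (rule module_homI)
    fix z assume z: "z \<in> carrier M"
    show "f z \<in> carrier M"
      using f[OF z] UM by blast
    show "f (z \<oplus>\<^bsub>M\<^esub> w) = f z \<oplus>\<^bsub>M\<^esub> f w" if w: "w \<in> carrier M" for w
    proof (rule f_unique)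
      have "z \<oplus>\<^bsub>M\<^esub> w \<ominus>\<^bsub>M\<^esub> (f z \<oplus>\<^bsub>M\<^esub> f w) = (z \<ominus>\<^bsub>M\<^esub> f z) \<oplus>\<^bsub>M\<^esub> (w \<ominus>\<^bsub>M\<^esub> f w)"
        using z w f[OF z] f[OF w] UM by (simp add: M.minus_eq M.minus_add M.a_ac)
      then show "z \<oplus>\<^bsub>M\<^esub> w \<ominus>\<^bsub>M\<^esub> (f z \<oplus>\<^bsub>M\<^esub> f w) \<in> V"
        using Vd(3) f[OF z] f[OF w] by simp
    qed (use z w f Ud(3) in auto)
    show "f (a \<odot>\<^bsub>M\<^esub> z) = a \<odot>\<^bsub>M\<^esub> f z" if a: "a \<in> carrier R" for a
    proof (rule f_unique)
      show "a \<odot>\<^bsub>M\<^esub> z \<ominus>\<^bsub>M\<^esub> a \<odot>\<^bsub>M\<^esub> f z \<in> V"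
        using Vd(5)[OF a] f[OF z] UM z a by (simp flip: smult_diff_right)
    qed (use a z f Ud(5) smult_closed in auto)
  qed
  then consider "\<And>z. z \<in> carrier M \<Longrightarrow> f z = \<zero>\<^bsub>M\<^esub> \<Longrightarrow> z = \<zero>\<^bsub>M\<^esub>"
    | "\<And>z. z \<in> carrier M \<Longrightarrow> f z = z \<Longrightarrow> z = \<zero>\<^bsub>M\<^esub>"
    using endo by blast
  then show "U = {\<zero>\<^bsub>M\<^esub>} \<or> V = {\<zero>\<^bsub>M\<^esub>}"
  proof cases
    case 1
    have "v = \<zero>\<^bsub>M\<^esub>" if v: "v \<in> V" for v
    proof -
      have "v \<ominus>\<^bsub>M\<^esub> \<zero>\<^bsub>M\<^esub> \<in> V"
        using Vd(4)[OF v Vd(2)] .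
      then have "f v = \<zero>\<^bsub>M\<^esub>"
        using f_unique[OF VM[OF v] Ud(2)] by simp
      then show ?thesis
        using 1 VM[OF v] by simp
    qed
    then show ?thesis
      using Vd(2) by blast
  next
    case 2
    have "u = \<zero>\<^bsub>M\<^esub>" if u: "u \<in> U" for u
    proof -
      have "u \<ominus>\<^bsub>M\<^esub> u \<in> V"
        using UM[OF u] Vd(2) by (simp add: M.minus_eq M.r_neg)
      then have "f u = u"
        using f_unique[OF UM[OF u] u] by simp
      then show ?thesis
        using 2 UM[OF u] by simp
    qed
    then show ?thesis
      using Ud(2) by blast
  qed
qed

lemma indecomposable_iso:
  assumes "left_module R M" "left_module R N" "indecomposable R M" "module_iso R M N"
  shows "indecomposable R N"
  unfolding indecomposable_def
proof (intro conjI allI impI)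
  interpret M: left_module R M by fact
  interpret N: left_module R N by fact
  obtain f where f: "f \<in> module_hom R M N" "bij_betw f (carrier M) (carrier N)"
    using assms(4) by (auto simp: module_iso_def)
  note fd = module_homD[OF f(1)]
  have f0: "f \<zero>\<^bsub>M\<^esub> = \<zero>\<^bsub>N\<^esub>"
    by (rule module_hom_zero[OF assms(1,2) f(1)])
  have inj: "inj_on f (carrier M)" and im: "f ` carrier M = carrier N"
    using f(2) by (auto simp: bij_betw_def)
  have pre: "\<exists>x\<in>carrier M. y = f x" if "y \<in> carrier N" for y
    using that im by auto
  have zero: "x = \<zero>\<^bsub>M\<^esub>" if "x \<in> carrier M" "f x = \<zero>\<^bsub>N\<^esub>" for x
    using inj_onD[OF inj, of x "\<zero>\<^bsub>M\<^esub>"] that f0 by simp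
  show "carrier N \<noteq> {\<zero>\<^bsub>N\<^esub>}"
  proof
    assume "carrier N = {\<zero>\<^bsub>N\<^esub>}"
    then have "carrier M \<subseteq> {\<zero>\<^bsub>M\<^esub>}"
      using zero fd(1) by blast
    then show False
      using assms(3) M.M.zero_closed by (auto simp: indecomposable_def)
  qed
  fix U V assume UV: "Module.submodule U R N \<and> Module.submodule V R N \<and>
    U <+>\<^bsub>N\<^esub> V = carrier N \<and> U \<inter> V = {\<zero>\<^bsub>N\<^esub>}"
  then have U: "Module.submodule U R N" and V: "Module.submodule V R N" by auto
  define U' where "U' = {x \<in> carrier M. f x \<in> U}"
  define V' where "V' = {x \<in> carrier M. f x \<in> V}"
  have U': "Module.submodule U' R M" and V': "Module.submodule V' R M"
    unfolding U'_def V'_def using submodule_vimage[OF assms(1,2) f(1)] U V by auto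
  have "carrier M \<subseteq> U' <+>\<^bsub>M\<^esub> V'"
  proof
    fix x assume x: "x \<in> carrier M"
    then have "f x \<in> U <+>\<^bsub>N\<^esub> V"
      using UV fd(1) by simp
    then obtain u v where uv: "u \<in> U" "v \<in> V" "f x = u \<oplus>\<^bsub>N\<^esub> v"
      by (auto simp: set_add_def')
    have "u \<in> carrier N" "v \<in> carrier N"
      using N.submoduleD(1)[OF U] N.submoduleD(1)[OF V] uv by auto
    then obtain a b where ab: "a \<in> carrier M" "u = f a" "b \<in> carrier M" "v = f b"
      using pre by meson
    then have "x = a \<oplus>\<^bsub>M\<^esub> b"
      using inj_onD[OF inj, of x "a \<oplus>\<^bsub>M\<^esub> b"] uv x fd(2) by simp
    then show "x \<in> U' <+>\<^bsub>M\<^esub> V'"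
      using ab uv by (auto simp: set_add_def' U'_def V'_def)
  qed
  moreover have "U' <+>\<^bsub>M\<^esub> V' \<subseteq> carrier M"
    by (auto simp: set_add_def' U'_def V'_def)
  moreover have "U' \<inter> V' = {\<zero>\<^bsub>M\<^esub>}"
    using UV zero f0 M.submoduleD(2)[OF U'] M.submoduleD(2)[OF V'] by (auto simp: U'_def V'_def)
  ultimately have "U' = {\<zero>\<^bsub>M\<^esub>} \<or> V' = {\<zero>\<^bsub>M\<^esub>}"
    using assms(3) U' V' unfolding indecomposable_def by blast
  moreover have "U \<subseteq> f ` U'" "V \<subseteq> f ` V'"
    using im N.submoduleD(1)[OF U] N.submoduleD(1)[OF V] by (auto simp: U'_def V'_def)
  ultimately show "U = {\<zero>\<^bsub>N\<^esub>} \<or> V = {\<zero>\<^bsub>N\<^esub>}"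
    using f0 N.submoduleD(2)[OF U] N.submoduleD(2)[OF V] by auto
qed

text \<open>
  An algebra that maps onto \<open>k[x, y] / (x, y)\<^sup>2\<close> by \<open>a \<mapsto> \<rho> a + \<alpha> a x + \<beta> a y\<close>. The modules below are
  the preprojective Kronecker modules: \<open>x\<close> is the inclusion of polynomials of degree \<open>< n\<close> into
  those of degree \<open>\<le> n\<close>, and \<open>y\<close> is multiplication by the variable.
\<close>

locale kronecker_quotient = ring A for A :: "('k::field, 'a) module" (structure) +
  fixes \<rho> \<alpha> \<beta> :: "'a \<Rightarrow> 'k"
  assumes additive: "a \<in> carrier A \<Longrightarrow> b \<in> carrier A \<Longrightarrow> \<rho> (a \<oplus>\<^bsub>A\<^esub> b) = \<rho> a + \<rho> b"
      "a \<in> carrier A \<Longrightarrow> b \<in> carrier A \<Longrightarrow> \<alpha> (a \<oplus>\<^bsub>A\<^esub> b) = \<alpha> a + \<alpha> b"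
      "a \<in> carrier A \<Longrightarrow> b \<in> carrier A \<Longrightarrow> \<beta> (a \<oplus>\<^bsub>A\<^esub> b) = \<beta> a + \<beta> b"
    and multiplicative: "a \<in> carrier A \<Longrightarrow> b \<in> carrier A \<Longrightarrow> \<rho> (a \<otimes>\<^bsub>A\<^esub> b) = \<rho> a * \<rho> b"
      "a \<in> carrier A \<Longrightarrow> b \<in> carrier A \<Longrightarrow> \<alpha> (a \<otimes>\<^bsub>A\<^esub> b) = \<rho> a * \<alpha> b + \<alpha> a * \<rho> b"
      "a \<in> carrier A \<Longrightarrow> b \<in> carrier A \<Longrightarrow> \<beta> (a \<otimes>\<^bsub>A\<^esub> b) = \<rho> a * \<beta> b + \<beta> a * \<rho> b"
    and unital: "\<rho> \<one>\<^bsub>A\<^esub> = 1" "\<alpha> \<one>\<^bsub>A\<^esub> = 0" "\<beta> \<one>\<^bsub>A\<^esub> = 0"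
    and surjective: "\<exists>a\<in>carrier A. \<rho> a = r \<and> \<alpha> a = s \<and> \<beta> a = t"
begin

definition kronecker :: "nat \<Rightarrow> ('a, 'k poly \<times> 'k poly) module" where
  "kronecker n = \<lparr>carrier = poly_lt n \<times> poly_lt (Suc n), mult = undefined, one = undefined,
     zero = (0, 0), add = (\<lambda>(p, q) (p', q'). (p + p', q + q')),
     smult = (\<lambda>a (p, q). (Polynomial.smult (\<rho> a) p,
       Polynomial.smult (\<rho> a) q + Polynomial.smult (\<alpha> a) p + Polynomial.smult (\<beta> a) (pCons 0 p)))\<rparr>"

lemma poly_lt_closed:
  "p \<in> poly_lt n \<Longrightarrow> q \<in> poly_lt n \<Longrightarrow> p + q \<in> poly_lt n"
  "p \<in> poly_lt n \<Longrightarrow> Polynomial.smult c p \<in> poly_lt n"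
  "p \<in> poly_lt n \<Longrightarrow> p \<in> poly_lt (Suc n)"
  "p \<in> poly_lt n \<Longrightarrow> pCons 0 p \<in> poly_lt (Suc n)"
  "0 \<in> poly_lt n"
  for p q :: "'k poly"
  by (auto simp: poly_lt_def coeff_pCons split: nat.split)

lemma left_module_kronecker: "left_module A (kronecker n)"
proof -
  have "abelian_group (kronecker n)"
  proof (rule abelian_groupI)
    fix z assume "z \<in> carrier (kronecker n)"
    then obtain p q where "z = (p, q)" "p \<in> poly_lt n" "q \<in> poly_lt (Suc n)"
      by (auto simp: kronecker_def)
    then show "\<exists>w\<in>carrier (kronecker n). w \<oplus>\<^bsub>kronecker n\<^esub> z = \<zero>\<^bsub>kronecker n\<^esub>"
      by (intro bexI[of _ "(- p, - q)"]) (auto simp: kronecker_def poly_lt_def)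
  qed (auto simp: kronecker_def poly_lt_closed)
  then show ?thesis
    by (intro left_module.intro left_module_axioms.intro ring_axioms)
      (auto simp: kronecker_def poly_lt_closed additive multiplicative unital algebra_simps
        smult_add_left smult_add_right)
qed

interpretation K: left_module A "kronecker n" for n
  by (rule left_module_kronecker)

lemma kronecker_simps:
  "(p, q) \<in> carrier (kronecker n) \<longleftrightarrow> p \<in> poly_lt n \<and> q \<in> poly_lt (Suc n)"
  "\<zero>\<^bsub>kronecker n\<^esub> = (0, 0)"
  "(p, q) \<oplus>\<^bsub>kronecker n\<^esub> (p', q') = (p + p', q + q')"
  "a \<odot>\<^bsub>kronecker n\<^esub> (p, q) = (Polynomial.smult (\<rho> a) p,
     Polynomial.smult (\<rho> a) q + Polynomial.smult (\<alpha> a) p + Polynomial.smult (\<beta> a) (pCons 0 p))"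
  by (simp_all add: kronecker_def)

text \<open>For \<open>q = c + X q'\<close>, the element \<open>(0, q)\<close> is the sum of
  \<open>x\<close> acting on \<open>(c, 0)\<close> and \<open>y\<close> acting on
  \<open>(q', 0)\<close>. The constant \<open>c\<close> belongs to the upper layer because
  \<open>n\<close> is positive.\<close>

lemma kronecker_generated:
  assumes "0 < n" and W: "Module.submodule W A (kronecker n)"
    and gen: "\<And>i. i < n \<Longrightarrow> (monom 1 i, 0) \<in> W"
  shows "carrier (kronecker n) \<subseteq> W"
proof
  note Wd = K.submoduleD[OF W]
  have top: "(p, 0) \<in> W" if p: "p \<in> poly_lt n" for p
  proof -
    have "(\<Sum>i<k. monom (coeff p i) i, 0) \<in> W" if "k \<le> n" for k
      using that
    proof (induction k)
      case 0
      then show ?case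
        using Wd(2) by (simp add: kronecker_simps)
    next
      case (Suc k)
      obtain c where c: "c \<in> carrier A" "\<rho> c = coeff p k" "\<alpha> c = 0" "\<beta> c = 0"
        using surjective by blast
      have "(monom (coeff p k) k, 0) \<in> W"
        using Wd(5)[OF c(1) gen[of k]] Suc.prems c(2-) by (simp add: kronecker_simps smult_monom)
      then show ?case
        using Wd(3)[of "(\<Sum>i<k. monom (coeff p i) i, 0)" "(monom (coeff p k) k, 0)"] Suc
        by (simp add: kronecker_simps)
    qed
    then show ?thesis
      using poly_lt_sum_monom[OF p] by (metis order_refl)
  qed
  fix z assume "z \<in> carrier (kronecker n)"
  then obtain p q where z: "z = (p, q)" "p \<in> poly_lt n" "q \<in> poly_lt (Suc n)"
    by (auto simp: kronecker_def)
  obtain c q' where q: "q = pCons c q'"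
    by (cases q) auto
  have "[:c:] \<in> poly_lt n" "q' \<in> poly_lt n"
    using assms(1) z(3) unfolding q poly_lt_def by (force simp: coeff_pCons split: nat.splits)+
  then have "([:c:], 0) \<in> W" "(q', 0) \<in> W"
    using top by auto
  \<comment> \<open>Preimages of \<open>x\<close> and \<open>y\<close> in the algebra.\<close>
  moreover obtain a b where ab: "a \<in> carrier A" "\<rho> a = 0" "\<alpha> a = 1" "\<beta> a = 0"
      "b \<in> carrier A" "\<rho> b = 0" "\<alpha> b = 0" "\<beta> b = 1"
    using surjective by meson
  ultimately have "(0, [:c:]) \<in> W" "(0, pCons 0 q') \<in> W"
    using Wd(5)[OF ab(1), of "([:c:], 0)"] Wd(5)[OF ab(5), of "(q', 0)"] ab
    by (auto simp: kronecker_simps)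
  then have "(p, 0) \<oplus>\<^bsub>kronecker n\<^esub> ((0, [:c:]) \<oplus>\<^bsub>kronecker n\<^esub> (0, pCons 0 q')) \<in> W"
    using Wd(3) top[OF z(2)] by blast
  then show "z \<in> W"
    by (simp add: kronecker_simps z(1) q)
qed

lemma monom_in_poly_lt: "monom c i \<in> poly_lt n \<longleftrightarrow> c = 0 \<or> i < n" for c :: 'k
  by (auto simp: poly_lt_def not_less)

lemma fg_kronecker: "0 < n \<Longrightarrow> fg_module A (kronecker n)"
  unfolding fg_module_def
proof (intro conjI exI[of _ "(\<lambda>i. (monom 1 i, 0)) ` {..<n}"] allI impI left_module_kronecker)
  fix U assume "0 < n" and U: "Module.submodule U A (kronecker n) \<and> (\<lambda>i. (monom 1 i, 0)) ` {..<n} \<subseteq> U"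
  then have "carrier (kronecker n) \<subseteq> U"
    by (intro kronecker_generated) auto
  then show "U = carrier (kronecker n)"
    using K.submoduleD(1) U by blast
qed (auto simp: kronecker_simps monom_in_poly_lt poly_lt_closed)

text \<open>Let \<open>P i\<close> be the upper component of the image of \<open>X^i\<close>. In the
  lower layer \<open>x\<close> on \<open>X^(i+1)\<close> and \<open>y\<close> on \<open>X^i\<close>
  give the same element, so \<open>P (i+1) = X P i\<close>. All \<open>P i\<close> thus come from
  \<open>p = P 0\<close>, and \<open>P (n-1)\<close> bounds the degree of \<open>p\<close>.\<close>

lemma kronecker_hom:
  assumes f: "f \<in> module_hom A (kronecker n) (kronecker m)" and n: "0 < n"
  obtains p where "p \<in> poly_lt m" "monom 1 (n - 1) * p \<in> poly_lt m" "f (0, 1) = (0, p)"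
    "\<And>i. i < n \<Longrightarrow> fst (f (monom 1 i, 0)) = monom 1 i * p"
proof -
  note fd = module_homD[OF f]
  obtain a b where ab: "a \<in> carrier A" "\<rho> a = 0" "\<alpha> a = 1" "\<beta> a = 0"
      "b \<in> carrier A" "\<rho> b = 0" "\<alpha> b = 0" "\<beta> b = 1"
    using surjective by meson
  define P where "P i = fst (f (monom 1 i, 0))" for i
  have mem: "(monom 1 i, 0) \<in> carrier (kronecker n)" if "i < n" for i
    using that by (simp add: kronecker_simps monom_in_poly_lt poly_lt_closed)
  have P: "P i \<in> poly_lt m" if "i < n" for i
    using fd(1)[OF mem[OF that]] by (cases "f (monom 1 i, 0)") (simp add: P_def kronecker_simps)
  have fa: "f (0, monom 1 i) = (0, P i)" if "i < n" for i
    using fd(3)[OF ab(1) mem[OF that]] ab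
    by (cases "f (monom 1 i, 0)") (simp add: P_def kronecker_simps)
  have fb: "f (0, monom 1 (Suc i)) = (0, pCons 0 (P i))" if "i < n" for i
    using fd(3)[OF ab(5) mem[OF that]] ab
    by (cases "f (monom 1 i, 0)") (simp add: P_def kronecker_simps monom_Suc)
  have Pi: "P i = monom 1 i * P 0" if "i < n" for i
    using that
  proof (induction i)
    case (Suc i)
    then have "P (Suc i) = pCons 0 (P i)"
      using fa[of "Suc i"] fb[of i] by simp
    then show ?case
      using Suc by (simp add: monom_Suc)
  qed simp
  show thesis
  proof (rule that[of "P 0"])
    show "P 0 \<in> poly_lt m"
      using P n by simp
    show "monom 1 (n - 1) * P 0 \<in> poly_lt m"
      using P[of "n - 1"] Pi[of "n - 1"] n by simp
    show "f (0, 1) = (0, P 0)"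
      using fa[of 0] n by simp
    show "fst (f (monom 1 i, 0)) = monom 1 i * P 0" if "i < n" for i
      using Pi[OF that] by (simp add: P_def)
  qed
qed

text \<open>For \<open>m < n\<close>, the polynomial \<open>X^(n-1) p\<close> has degree below
  \<open>m\<close> only if \<open>p = 0\<close>; but then the homomorphism kills
  \<open>(0, 1)\<close>.\<close>

lemma kronecker_iso_imp_le:
  assumes "module_iso A (kronecker n) (kronecker m)" "0 < n"
  shows "n \<le> m"
proof (rule ccontr)
  assume "\<not> n \<le> m"
  then have mn: "m \<le> n - 1" by simp
  obtain f where f: "f \<in> module_hom A (kronecker n) (kronecker m)"
    and inj: "inj_on f (carrier (kronecker n))"
    using assms(1) by (auto simp: module_iso_def bij_betw_def)
  obtain p where p: "monom 1 (n - 1) * p \<in> poly_lt m" "f (0, 1) = (0, p)"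
    using kronecker_hom[OF f assms(2)] by blast
  have "coeff p i = coeff (monom 1 (n - 1) * p) (n - 1 + i)" for i
    by (simp add: coeff_monom_mult)
  then have "coeff p i = 0" for i
    using p(1) mn by (simp add: poly_lt_def)
  then have "p = 0"
    by (simp add: poly_eq_iff)
  then have "f (0, 1) = f (0, 0)"
    using p(2) module_hom_zero[OF left_module_kronecker left_module_kronecker f] by (simp add: kronecker_simps)
  moreover have "(0, 1) \<in> carrier (kronecker n)" "(0, 0) \<in> carrier (kronecker n)"
    by (auto simp: kronecker_simps poly_lt_def)
  ultimately have "(0, 1) = (0, 0 :: 'k poly)"
    using inj by (metis inj_onD prod.inject)
  then show False by simp
qed

text \<open>As \<open>X^(n-1) p\<close> has degree below \<open>n\<close>, the polynomial
  \<open>p\<close> is a constant \<open>c\<close>, and the endomorphism is multiplication by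
  \<open>c\<close> up to a map from the upper to the lower layer. For \<open>c \<noteq> 0\<close> it
  is injective; for \<open>c = 0\<close> its square is zero, so it has no nonzero fixed
  point.\<close>

lemma indecomposable_kronecker:
  assumes n: "0 < n"
  shows "indecomposable A (kronecker n)"
proof (rule indecomposableI[OF left_module_kronecker])
  have "(0, 1) \<in> carrier (kronecker n)"
    by (auto simp: kronecker_simps poly_lt_def)
  then show "carrier (kronecker n) \<noteq> {\<zero>\<^bsub>kronecker n\<^esub>}"
    by (metis kronecker_simps(2) prod.inject singletonD zero_neq_one)
  fix f assume f: "f \<in> module_hom A (kronecker n) (kronecker n)"
  note fd = module_homD[OF f]
  obtain p where p: "p \<in> poly_lt n" "monom 1 (n - 1) * p \<in> poly_lt n"
    and fi: "\<And>i. i < n \<Longrightarrow> fst (f (monom 1 i, 0)) = monom 1 i * p"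
    using kronecker_hom[OF f n] by blast
  define c where "c = coeff p 0"
  have "coeff p i = 0" if "i > 0" for i
  proof -
    have "coeff (monom 1 (n - 1) * p) (n - 1 + i) = 0"
      using p(2) that unfolding poly_lt_def by simp
    then show ?thesis
      by (simp add: coeff_monom_mult)
  qed
  then have pc: "p = [:c:]"
    by (auto simp: poly_eq_iff c_def coeff_pCons split: nat.split)
  \<comment> \<open>The elements on whose upper component \<open>f\<close> is multiplication by
    \<open>c\<close> form a submodule, and the generators belong to it.\<close>
  let ?W = "{z \<in> carrier (kronecker n). fst (f z) = Polynomial.smult c (fst z)}"
  have "Module.submodule ?W A (kronecker n)"
  proof (rule K.submoduleI)
    show "\<zero>\<^bsub>kronecker n\<^esub> \<in> ?W"
      using module_hom_zero[OF left_module_kronecker left_module_kronecker f]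
      by (simp add: kronecker_simps poly_lt_closed)
    show "z \<oplus>\<^bsub>kronecker n\<^esub> w \<in> ?W" if zw: "z \<in> ?W" "w \<in> ?W" for z w
    proof -
      have "fst (f z \<oplus>\<^bsub>kronecker n\<^esub> f w) = fst (f z) + fst (f w)"
        "fst (z \<oplus>\<^bsub>kronecker n\<^esub> w) = fst z + fst w"
        by (simp_all add: kronecker_def split_beta)
      then show ?thesis
        using zw fd(2) K.M.a_closed by (simp add: smult_add_right)
    qed
    show "a \<odot>\<^bsub>kronecker n\<^esub> z \<in> ?W" if az: "a \<in> carrier A" "z \<in> ?W" for a z
    proof -
      have "fst (a \<odot>\<^bsub>kronecker n\<^esub> w) = Polynomial.smult (\<rho> a) (fst w)" for w
        by (simp add: kronecker_def split_beta)
      then show ?thesis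
        using az fd(3) K.smult_closed by (simp add: mult.commute)
    qed
  qed auto
  moreover have "(monom 1 i, 0) \<in> ?W" if "i < n" for i
    using fi[OF that] that pc
    by (simp add: kronecker_simps monom_in_poly_lt poly_lt_closed smult_monom mult.commute[of "monom 1 i"])
  ultimately have top: "fst (f z) = Polynomial.smult c (fst z)" if "z \<in> carrier (kronecker n)" for z
    using kronecker_generated[OF n] that by blast
  obtain a b where ab: "a \<in> carrier A" "\<rho> a = 0" "\<alpha> a = 1" "\<beta> a = 0"
      "b \<in> carrier A" "\<rho> b = 0" "\<alpha> b = 0" "\<beta> b = 1"
    using surjective by meson
  have socle: "f (0, q) = (0, Polynomial.smult c q)" if q: "q \<in> poly_lt (Suc n)" for q
  proof -
    obtain d q' where qd: "q = pCons d q'"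
      by (cases q) auto
    have d: "[:d:] \<in> poly_lt n" and q': "q' \<in> poly_lt n"
      using n q unfolding qd poly_lt_def by (force simp: coeff_pCons split: nat.splits)+
    have mem: "([:d:], 0) \<in> carrier (kronecker n)" "(q', 0) \<in> carrier (kronecker n)"
      using d q' by (auto simp: kronecker_simps poly_lt_closed)
    have "f (0, [:d:]) = (0, Polynomial.smult c [:d:])"
      using fd(3)[OF ab(1) mem(1)] top[OF mem(1)] ab
      by (cases "f ([:d:], 0)") (simp add: kronecker_simps)
    moreover have "f (0, pCons 0 q') = (0, Polynomial.smult c (pCons 0 q'))"
      using fd(3)[OF ab(5) mem(2)] top[OF mem(2)] ab
      by (cases "f (q', 0)") (simp add: kronecker_simps)
    moreover have "(0, [:d:]) \<in> carrier (kronecker n)" "(0, pCons 0 q') \<in> carrier (kronecker n)"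
      using d q' by (auto simp: kronecker_simps poly_lt_closed)
    ultimately show ?thesis
      using fd(2)[of "(0, [:d:])" "(0, pCons 0 q')"] by (simp add: kronecker_simps qd)
  qed
  have ker: "z = \<zero>\<^bsub>kronecker n\<^esub>" if z: "z \<in> carrier (kronecker n)" "f z = (0, 0)" "c \<noteq> 0" for z
  proof -
    have "fst z = 0"
      using top[OF z(1)] z(2,3) by simp
    then obtain q where q: "z = (0, q)" by (cases z) auto
    then show ?thesis
      using socle[of q] z by (simp add: kronecker_simps)
  qed
  have fix_pt: "z = \<zero>\<^bsub>kronecker n\<^esub>" if z: "z \<in> carrier (kronecker n)" "f z = z" "c = 0" for z
  proof -
    have "fst z = 0"
      using top[OF z(1)] z(2,3) by simp
    then obtain q where q: "z = (0, q)" by (cases z) auto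
    then show ?thesis
      using socle[of q] z by (simp add: kronecker_simps)
  qed
  show "(\<forall>z\<in>carrier (kronecker n). f z = \<zero>\<^bsub>kronecker n\<^esub> \<longrightarrow> z = \<zero>\<^bsub>kronecker n\<^esub>)
      \<or> (\<forall>z\<in>carrier (kronecker n). f z = z \<longrightarrow> z = \<zero>\<^bsub>kronecker n\<^esub>)"
  proof (cases "c = 0")
    case True
    then show ?thesis
      using fix_pt by blast
  next
    case False
    then show ?thesis
      using ker by (metis kronecker_simps(2))
  qed
qed

theorem not_representation_finite: "\<not> representation_finite A"
proof -
  define \<kappa> :: "'k poly \<times> 'k poly \<Rightarrow> nat \<Rightarrow> 'k" where
    "\<kappa> z n = (if even n then coeff (fst z) (n div 2) else coeff (snd z) (n div 2))" for z n
  have "inj \<kappa>"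
  proof (rule injI)
    fix z w assume eq: "\<kappa> z = \<kappa> w"
    have "coeff (fst z) n = coeff (fst w) n" "coeff (snd z) n = coeff (snd w) n" for n
      using fun_cong[OF eq, of "2 * n"] fun_cong[OF eq, of "2 * n + 1"] by (auto simp: \<kappa>_def)
    then show "z = w"
      by (auto simp: prod_eq_iff poly_eq_iff)
  qed
  then have inj: "inj_on \<kappa> (carrier (kronecker n))" for n
    by (rule inj_on_subset) simp
  \<comment> \<open>The shift to \<open>Suc n\<close> avoids \<open>kronecker 0\<close>, whose lower
    layer is not generated by its zero upper layer.\<close>
  define M where "M n = transport \<kappa> (kronecker (Suc n))" for n
  have left: "left_module A (M n)" for n
    unfolding M_def using left_module_transport[OF left_module_kronecker inj] .
  have hom: "\<kappa> \<in> module_hom A (kronecker (Suc n)) (M n)"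
    and bij: "bij_betw \<kappa> (carrier (kronecker (Suc n))) (carrier (M n))" for n
    unfolding M_def using transport_hom[OF inj] bij_betw_transport[OF inj] by auto
  have iso: "module_iso A (kronecker (Suc n)) (M n)" for n
    using hom bij by (auto simp: module_iso_def)
  have "M n \<in> indecomposables A" for n
    using fg_module_image[OF fg_kronecker left hom] bij
      indecomposable_iso[OF left_module_kronecker left indecomposable_kronecker iso]
    by (auto simp: indecomposables_def bij_betw_def)
  moreover have "m = n" if "module_iso A (M m) (M n)" for m n
  proof -
    have mn: "module_iso A (kronecker (Suc m)) (kronecker (Suc n))"
      using module_iso_trans[OF module_iso_trans[OF iso that] module_iso_sym[OF left_module_kronecker iso]] .
    show ?thesis
      using kronecker_iso_imp_le[OF mn] kronecker_iso_imp_le[OF module_iso_sym[OF left_module_kronecker mn]]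
      by simp
  qed
  ultimately have "infinite (iso_classes A (indecomposables A))"
    by (intro infinite_iso_classes[of _ A M]) (auto simp: indecomposables_def fg_module_def)
  then show ?thesis
    by (simp add: representation_finite_def)
qed

end

section \<open>Bound path algebras\<close>

abbreviation path_length :: "('v, 'e) path \<Rightarrow> nat" where
  "path_length r \<equiv> length (fst (snd r))"

definition single :: "('v, 'e) path \<Rightarrow> 'k::zero \<Rightarrow> ('v, 'e) path \<Rightarrow> 'k" where
  "single r c = (\<lambda>_. 0)(r := c)"

lemma single_apply: "single r c p = (if p = r then c else 0)"
  by (simp add: single_def)

lemma path_concat_eq_Some_iff:
  "path_concat p q = Some r \<longleftrightarrow>
     snd (snd p) = fst q \<and> r = (fst p, fst (snd p) @ fst (snd q), snd (snd q))"
  by (cases p; cases q) auto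

lemma path_algebra_simps:
  "f \<in> carrier (path_algebra Q) \<longleftrightarrow> finite {p. f p \<noteq> 0} \<and> {p. f p \<noteq> 0} \<subseteq> paths Q"
  "(f \<oplus>\<^bsub>path_algebra Q\<^esub> g) p = f p + g p"
  "\<zero>\<^bsub>path_algebra Q\<^esub> p = 0"
  "c \<odot>\<^bsub>path_algebra Q\<^esub> f = (\<lambda>p. c * f p)"
  "\<one>\<^bsub>path_algebra Q\<^esub> p = (if fst p \<in> verts Q \<and> fst (snd p) = [] \<and> snd (snd p) = fst p then 1 else 0)"
  "(f \<otimes>\<^bsub>path_algebra Q\<^esub> g) r =
     (\<Sum>(p, q) | f p \<noteq> 0 \<and> g q \<noteq> 0 \<and> path_concat p q = Some r. f p * g q)"
  by (auto simp: path_algebra_def split_beta)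

lemma path_mult_nonzero:
  assumes "(f \<otimes>\<^bsub>path_algebra Q\<^esub> g) r \<noteq> 0"
  obtains p q where "f p \<noteq> 0" "g q \<noteq> 0" "path_concat p q = Some r"
proof -
  have "{(p, q). f p \<noteq> 0 \<and> g q \<noteq> 0 \<and> path_concat p q = Some r} \<noteq> {}"
    using assms unfolding path_algebra_simps by (metis (no_types, lifting) sum.empty)
  then show thesis
    using that by blast
qed

text \<open>At most one factorisation contributes to the coefficient. If \<open>p\<close> or
  \<open>q\<close> lies outside the support, none does and both sides are zero.\<close>

lemma path_mult_unique:
  assumes "path_concat p q = Some r"
    and "\<And>p' q'. f p' \<noteq> 0 \<Longrightarrow> g q' \<noteq> 0 \<Longrightarrow> path_concat p' q' = Some r \<Longrightarrow> p' = p \<and> q' = q"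
  shows "(f \<otimes>\<^bsub>path_algebra Q\<^esub> g) r = f p * g q"
proof -
  let ?S = "{(p, q). f p \<noteq> 0 \<and> g q \<noteq> 0 \<and> path_concat p q = Some r}"
  have "?S \<subseteq> {(p, q)}"
    using assms(2) by auto
  then have "(\<Sum>(p, q)\<in>?S. f p * g q) = (\<Sum>(p, q)\<in>{(p, q)}. f p * g q)"
    using assms(1) by (intro sum.mono_neutral_left) auto
  then show ?thesis
    by (simp add: path_algebra_simps)
qed

text \<open>The geometric series: \<open>b\<close> is \<open>e + n + n^2 + ...\<close> up to the
  power \<open>m\<close>, with \<open>e\<close> in the role of \<open>n^0\<close>, and the product
  telescopes.\<close>

lemma idempotent_minus_nilpotent_invertible:
  assumes "ring R" and e: "e \<in> carrier R" "e \<otimes>\<^bsub>R\<^esub> e = e" and n: "n \<in> carrier R"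
    and en: "e \<otimes>\<^bsub>R\<^esub> n = n" "n \<otimes>\<^bsub>R\<^esub> e = n" and "n [^]\<^bsub>R\<^esub> (m :: nat) = \<zero>\<^bsub>R\<^esub>"
  shows "\<exists>b\<in>carrier R. b \<otimes>\<^bsub>R\<^esub> (e \<ominus>\<^bsub>R\<^esub> n) = e"
proof -
  interpret ring R by fact
  have "\<exists>b\<in>carrier R. b \<otimes>\<^bsub>R\<^esub> (e \<ominus>\<^bsub>R\<^esub> n) = e \<ominus>\<^bsub>R\<^esub> n [^]\<^bsub>R\<^esub> Suc k" for k :: nat
  proof (induction k)
    case 0
    have "e \<otimes>\<^bsub>R\<^esub> (e \<ominus>\<^bsub>R\<^esub> n) = e \<ominus>\<^bsub>R\<^esub> n [^]\<^bsub>R\<^esub> Suc 0"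
      using e n en by (simp add: minus_eq r_distr r_minus)
    then show ?case
      using e by blast
  next
    case (Suc k)
    then obtain b where b: "b \<in> carrier R" "b \<otimes>\<^bsub>R\<^esub> (e \<ominus>\<^bsub>R\<^esub> n) = e \<ominus>\<^bsub>R\<^esub> n [^]\<^bsub>R\<^esub> Suc k"
      by blast
    let ?p = "n [^]\<^bsub>R\<^esub> Suc k"
    have p: "?p \<in> carrier R" "?p \<otimes>\<^bsub>R\<^esub> e = ?p" "?p \<otimes>\<^bsub>R\<^esub> n = n [^]\<^bsub>R\<^esub> Suc (Suc k)"
      using e n en by (auto simp: m_assoc)
    have "(b \<oplus>\<^bsub>R\<^esub> ?p) \<otimes>\<^bsub>R\<^esub> (e \<ominus>\<^bsub>R\<^esub> n) = (e \<ominus>\<^bsub>R\<^esub> ?p) \<oplus>\<^bsub>R\<^esub> (?p \<ominus>\<^bsub>R\<^esub> ?p \<otimes>\<^bsub>R\<^esub> n)"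
      using e n b p(1,2) l_distr[OF b(1) p(1), of "e \<ominus>\<^bsub>R\<^esub> n"]
      by (simp add: minus_eq r_distr r_minus del: nat_pow_Suc)
    also have "\<dots> = e \<ominus>\<^bsub>R\<^esub> ?p \<otimes>\<^bsub>R\<^esub> n"
      using e n p(1) by (simp add: minus_eq a_assoc r_neg1 del: nat_pow_Suc)
    also have "\<dots> = e \<ominus>\<^bsub>R\<^esub> n [^]\<^bsub>R\<^esub> Suc (Suc k)"
      by (simp only: p(3))
    finally show ?case
      using b(1) p(1) by blast
  qed
  then obtain b where b: "b \<in> carrier R" "b \<otimes>\<^bsub>R\<^esub> (e \<ominus>\<^bsub>R\<^esub> n) = e \<ominus>\<^bsub>R\<^esub> n [^]\<^bsub>R\<^esub> Suc m"
    by blast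
  then show ?thesis
    using assms(7) e n by (auto simp: minus_eq)
qed

section \<open>The path algebra, filtered by path length\<close>

locale bound_quiver = fin_digraph Q for Q :: "('v, 'e) pre_digraph" +
  fixes I :: "(('v, 'e) path \<Rightarrow> 'k::field) set"
  assumes admissible: "admissible_ideal Q I"
begin

abbreviation KQ :: "('k, ('v, 'e) path \<Rightarrow> 'k) module" where
  "KQ \<equiv> path_algebra Q"

abbreviation "\<Lambda> \<equiv> bound_path_algebra Q I"

text \<open>The ring axioms for the path algebra come along with the ideal, since
  \<open>ideal\<close> includes them.\<close>

sublocale I: ideal I KQ
  using admissible by (simp add: admissible_ideal_def)

lemma paths_iff: "(u, w, v) \<in> paths Q \<longleftrightarrow> u \<in> verts Q \<and> set w \<subseteq> arcs Q \<and> cas u w v"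
  by (simp add: paths_def awalk_def)

lemma single_closed: "r \<in> paths Q \<Longrightarrow> single r c \<in> carrier KQ"
  by (auto simp: path_algebra_simps single_def)

lemma KQ_add: "f \<oplus>\<^bsub>KQ\<^esub> g = (\<lambda>p. f p + g p)"
  by (rule ext) (simp add: path_algebra_simps)

lemma KQ_zero: "\<zero>\<^bsub>KQ\<^esub> = (\<lambda>p. 0)"
  by (rule ext) (simp add: path_algebra_simps)

lemma KQ_minus:
  assumes "f \<in> carrier KQ"
  shows "\<ominus>\<^bsub>KQ\<^esub> f = (\<lambda>p. - f p)"
  using assms by (intro I.minus_equality) (auto simp: path_algebra_simps)

lemma KQ_diff: "f \<in> carrier KQ \<Longrightarrow> g \<in> carrier KQ \<Longrightarrow> f \<ominus>\<^bsub>KQ\<^esub> g = (\<lambda>p. f p - g p)"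
  by (simp add: I.minus_eq KQ_minus KQ_add)

text \<open>The combinations of paths of length at least \<open>n\<close>. This is the power
  \<open>n\<close> of the arrow ideal, in a form that is checked on coefficients; both inclusions
  are proved below.\<close>

definition order_ge :: "nat \<Rightarrow> (('v, 'e) path \<Rightarrow> 'k) set" where
  "order_ge n = {f \<in> carrier KQ. \<forall>r. path_length r < n \<longrightarrow> f r = 0}"

lemma order_geD:
  assumes "f \<in> order_ge n"
  shows "f \<in> carrier KQ" "f r \<noteq> 0 \<Longrightarrow> n \<le> path_length r"
  using assms unfolding order_ge_def by (blast, metis (mono_tags, lifting) mem_Collect_eq not_le)

lemma order_ge_mult:
  assumes "f \<in> order_ge m" "g \<in> order_ge n"
  shows "f \<otimes>\<^bsub>KQ\<^esub> g \<in> order_ge (m + n)"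
  unfolding order_ge_def
proof (intro CollectI conjI allI impI)
  show "f \<otimes>\<^bsub>KQ\<^esub> g \<in> carrier KQ"
    using assms I.m_closed by (simp add: order_ge_def)
  fix r :: "('v, 'e) path" assume r: "path_length r < m + n"
  show "(f \<otimes>\<^bsub>KQ\<^esub> g) r = 0"
  proof (rule ccontr)
    assume "(f \<otimes>\<^bsub>KQ\<^esub> g) r \<noteq> 0"
    then obtain p q where pq: "f p \<noteq> 0" "g q \<noteq> 0" "path_concat p q = Some r"
      by (rule path_mult_nonzero)
    then have "m \<le> path_length p" "n \<le> path_length q"
      using order_geD(2)[OF assms(1)] order_geD(2)[OF assms(2)] by auto
    then show False
      using pq(3) r by (simp add: path_concat_eq_Some_iff)
  qed
qed

lemma order_ge_0: "order_ge 0 = carrier KQ"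
  by (simp add: order_ge_def)

lemma ideal_order_ge: "ideal (order_ge n) KQ"
proof (rule idealI)
  show "ring KQ"
    by (rule I.ring_axioms)
  show "subgroup (order_ge n) (add_monoid KQ)"
  proof (rule subgroup.intro)
    fix f assume f: "f \<in> order_ge n"
    then have "\<ominus>\<^bsub>KQ\<^esub> f \<in> order_ge n"
      using KQ_minus[of f] I.a_inv_closed[of f] by (simp add: order_ge_def)
    then show "inv\<^bsub>add_monoid KQ\<^esub> f \<in> order_ge n"
      by (simp add: a_inv_def)
  qed (auto simp: order_ge_def path_algebra_simps(2,3) I.a_closed)
  fix f g assume "f \<in> order_ge n" "g \<in> carrier KQ"
  then show "g \<otimes>\<^bsub>KQ\<^esub> f \<in> order_ge n" "f \<otimes>\<^bsub>KQ\<^esub> g \<in> order_ge n"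
    using order_ge_mult[of g 0 f n] order_ge_mult[of f n g 0] by (auto simp: order_ge_0)
qed

lemma arrow_in_paths: "a \<in> arcs Q \<Longrightarrow> (tail Q a, [a], head Q a) \<in> paths Q"
  by (simp add: paths_iff)

lemma arrow_ideal_subset: "arrow_ideal Q \<subseteq> order_ge 1"
  unfolding arrow_ideal_def
  using arrow_in_paths single_closed[of _ 1]
  by (intro I.genideal_minimal ideal_order_ge) (auto simp: order_ge_def single_def)

lemma ideal_arrow_ideal: "ideal (arrow_ideal Q) KQ"
  unfolding arrow_ideal_def using arrow_in_paths single_closed[of _ 1]
  by (intro I.genideal_ideal) (auto simp: single_def)

lemma arrow_in_arrow_ideal: "a \<in> arcs Q \<Longrightarrow> single (tail Q a, [a], head Q a) (1 :: 'k) \<in> arrow_ideal Q"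
proof -
  assume a: "a \<in> arcs Q"
  have "{(\<lambda>p. 0)((tail Q a, [a], head Q a) := 1 :: 'k) | a. a \<in> arcs Q} \<subseteq> carrier KQ"
    using arrow_in_paths single_closed[of _ 1] by (auto simp: single_def)
  from subsetD[OF I.genideal_self[OF this]] show ?thesis
    unfolding arrow_ideal_def single_def by this (use a in auto)
qed

lemma ideal_power_subset: "ideal_power KQ (arrow_ideal Q) n \<subseteq> order_ge n"
proof (induction n)
  case (Suc n)
  have "f \<in> order_ge (Suc n)" if "f \<in> ideal_prod KQ (arrow_ideal Q) (ideal_power KQ (arrow_ideal Q) n)" for f
    using that
  proof (induction rule: ideal_prod.induct)
    case (prod f g)
    then have "f \<in> order_ge 1" "g \<in> order_ge n"
      using arrow_ideal_subset Suc.IH by auto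
    then show ?case
      using order_ge_mult[of f 1 g n] by simp
  next
    case (sum f g)
    interpret Z: ideal "order_ge (Suc n)" KQ
      by (rule ideal_order_ge)
    show ?case
      using sum by (intro Z.a_closed)
  qed
  then show ?case by auto
qed (simp add: order_ge_0)

lemma ideal_ideal_power: "ideal (ideal_power KQ (arrow_ideal Q) n) KQ"
  by (induction n) (simp_all add: I.oneideal I.ideal_prod_is_ideal ideal_arrow_ideal)

text \<open>The first arrow is split off; the rest of the path lies in the preceding power.\<close>

lemma single_in_ideal_power:
  assumes "r \<in> paths Q" "n \<le> path_length r"
  shows "single r c \<in> ideal_power KQ (arrow_ideal Q) n"
  using assms
proof (induction n arbitrary: r)
  case 0
  then show ?case
    using single_closed by simp
next
  case (Suc n)
  obtain u w v where r: "r = (u, w, v)" by (cases r)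
  then obtain a w' where w: "w = a # w'"
    using Suc.prems(2) by (cases w) auto
  have a: "a \<in> arcs Q" "tail Q a = u" and r': "(head Q a, w', v) \<in> paths Q"
    using Suc.prems(1) unfolding r w by (auto simp: paths_iff)
  have "single (tail Q a, [a], head Q a) 1 \<otimes>\<^bsub>KQ\<^esub> single (head Q a, w', v) c = single r c"
  proof
    fix s
    show "(single (tail Q a, [a], head Q a) 1 \<otimes>\<^bsub>KQ\<^esub> single (head Q a, w', v) c) s = single r c s"
    proof (cases "s = r")
      case True
      then show ?thesis
        using a(2) by (subst path_mult_unique[of "(tail Q a, [a], head Q a)" "(head Q a, w', v)"])
          (auto simp: single_apply r w split: if_splits)
    next
      case False
      have "(single (tail Q a, [a], head Q a) 1 \<otimes>\<^bsub>KQ\<^esub> single (head Q a, w', v) c) s = 0"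
      proof (rule ccontr)
        assume "(single (tail Q a, [a], head Q a) 1 \<otimes>\<^bsub>KQ\<^esub> single (head Q a, w', v) c) s \<noteq> 0"
        then show False
          using False a(2) by (elim path_mult_nonzero) (auto simp: single_apply r w split: if_splits)
      qed
      then show ?thesis
        using False by (simp add: single_apply)
    qed
  qed
  moreover have "single (head Q a, w', v) c \<in> ideal_power KQ (arrow_ideal Q) n"
    using Suc.prems(2) r' by (intro Suc.IH) (auto simp: r w)
  ultimately show ?case
    using ideal_prod.prod[OF arrow_in_arrow_ideal[OF a(1)]] by (metis ideal_power.simps(2))
qed

lemma order_ge_subset_ideal_power: "order_ge n \<subseteq> ideal_power KQ (arrow_ideal Q) n"
proof
  interpret P: ideal "ideal_power KQ (arrow_ideal Q) n" KQ
    by (rule ideal_ideal_power)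
  fix f assume f: "f \<in> order_ge n"
  have fin: "finite {p. f p \<noteq> 0}" and supp: "\<And>p. f p \<noteq> 0 \<Longrightarrow> p \<in> paths Q \<and> n \<le> path_length p"
    using order_geD[OF f] by (auto simp: path_algebra_simps)
  \<comment> \<open>The restriction of \<open>f\<close> to a finite part of its support, enlarged
    one path at a time.\<close>
  have "(\<lambda>p. if p \<in> S then f p else 0) \<in> ideal_power KQ (arrow_ideal Q) n"
    if "finite S" "S \<subseteq> {p. f p \<noteq> 0}" for S
    using that
  proof (induction S rule: finite_induct)
    case empty
    then show ?case
      using P.zero_closed by (simp add: KQ_zero)
  next
    case (insert r S)
    have "(\<lambda>p. if p \<in> insert r S then f p else 0) = single r (f r) \<oplus>\<^bsub>KQ\<^esub> (\<lambda>p. if p \<in> S then f p else 0)"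
      using insert.hyps by (auto simp: KQ_add single_apply)
    then show ?case
      using insert supp[of r] single_in_ideal_power[of r n "f r"] by simp
  qed
  note partial = this
  have "(\<lambda>p. if p \<in> {p. f p \<noteq> 0} then f p else 0) = f"
    by auto
  from this[symmetric] show "f \<in> ideal_power KQ (arrow_ideal Q) n"
    by (rule ssubst) (rule partial[OF fin order_refl])
qed

lemma I_subset: "I \<subseteq> order_ge 2"
  using admissible ideal_power_subset[of 2] unfolding admissible_ideal_def by blast

lemma nilpotency_bound: obtains m where "order_ge m \<subseteq> I"
  using admissible order_ge_subset_ideal_power unfolding admissible_ideal_def by blast

section \<open>The bound path algebra: cosets, coefficients and coordinates\<close>

definition coset :: "(('v, 'e) path \<Rightarrow> 'k) \<Rightarrow> (('v, 'e) path \<Rightarrow> 'k) set" where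
  "coset f = I +>\<^bsub>KQ\<^esub> f"

lemma ring_\<Lambda>: "ring \<Lambda>"
proof -
  interpret R: ring "KQ Quot I"
    by (rule I.quotient_is_ring)
  have eq: "carrier \<Lambda> = carrier (KQ Quot I)" "mult \<Lambda> = mult (KQ Quot I)" "one \<Lambda> = one (KQ Quot I)"
    "zero \<Lambda> = zero (KQ Quot I)" "add \<Lambda> = add (KQ Quot I)"
    by (simp_all add: bound_path_algebra_def quotient_algebra_def)
  have "abelian_group \<Lambda>"
  proof (rule abelian_groupI, unfold eq)
    show "\<exists>y\<in>carrier (KQ Quot I). y \<oplus>\<^bsub>KQ Quot I\<^esub> x = \<zero>\<^bsub>KQ Quot I\<^esub>" if "x \<in> carrier (KQ Quot I)" for x
      using R.l_neg[OF that] R.a_inv_closed[OF that] by blast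
  qed (simp_all add: R.a_ac)
  moreover have "Group.monoid \<Lambda>"
    by (rule monoidI, unfold eq) (simp_all add: R.m_assoc)
  ultimately show ?thesis
    by (rule ringI, unfold eq) (simp_all add: R.l_distr R.r_distr)
qed

sublocale \<Lambda>: ring \<Lambda>
  by (rule ring_\<Lambda>)

lemma \<Lambda>_carrier: "X \<in> carrier \<Lambda> \<longleftrightarrow> (\<exists>f\<in>carrier KQ. X = coset f)"
  by (auto simp: bound_path_algebra_def quotient_algebra_def FactRing_def A_RCOSETS_def' coset_def)

lemma coset_closed: "f \<in> carrier KQ \<Longrightarrow> coset f \<in> carrier \<Lambda>"
  by (auto simp: \<Lambda>_carrier)

lemma coset_hom:
  assumes "f \<in> carrier KQ" "g \<in> carrier KQ"
  shows "coset f \<oplus>\<^bsub>\<Lambda>\<^esub> coset g = coset (f \<oplus>\<^bsub>KQ\<^esub> g)"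
    and "coset f \<otimes>\<^bsub>\<Lambda>\<^esub> coset g = coset (f \<otimes>\<^bsub>KQ\<^esub> g)"
  using I.a_rcos_sum[OF assms] I.rcoset_mult_add[OF assms]
  by (simp_all add: bound_path_algebra_def quotient_algebra_def FactRing_def coset_def)

lemma coset_one: "\<one>\<^bsub>\<Lambda>\<^esub> = coset \<one>\<^bsub>KQ\<^esub>"
  by (simp add: bound_path_algebra_def quotient_algebra_def FactRing_def coset_def)

lemma coset_eq_iff:
  "f \<in> carrier KQ \<Longrightarrow> g \<in> carrier KQ \<Longrightarrow> coset f = coset g \<longleftrightarrow> f \<ominus>\<^bsub>KQ\<^esub> g \<in> I"
  unfolding coset_def using I.quotient_eq_iff_same_a_r_cos[OF I.ideal_axioms] by blast

lemma coset_eq_zero: "f \<in> I \<Longrightarrow> coset f = \<zero>\<^bsub>\<Lambda>\<^esub>"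
  using I.a_rcos_zero[OF I.ideal_axioms]
  by (simp add: bound_path_algebra_def quotient_algebra_def FactRing_def coset_def)

lemma coset_zero: "\<zero>\<^bsub>\<Lambda>\<^esub> = coset \<zero>\<^bsub>KQ\<^esub>"
  using coset_eq_zero[OF additive_subgroup.zero_closed[OF I.additive_subgroup_axioms]] by simp

text \<open>Coefficients at paths of length at most one are well defined modulo \<open>I\<close>.\<close>

definition coefficient :: "('v, 'e) path \<Rightarrow> (('v, 'e) path \<Rightarrow> 'k) set \<Rightarrow> 'k" where
  "coefficient r X = (SOME f. f \<in> X) r"

lemma coefficient_coset:
  assumes "f \<in> carrier KQ" "path_length r < 2"
  shows "coefficient r (coset f) = f r"
proof -
  have "f \<in> coset f"
    using I.a_rcos_self[OF assms(1)] by (simp add: coset_def)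
  then have "(SOME g. g \<in> coset f) \<in> coset f"
    by (rule someI[of "\<lambda>g. g \<in> coset f"])
  then obtain i where i: "i \<in> I" "(SOME g. g \<in> coset f) = i \<oplus>\<^bsub>KQ\<^esub> f"
    by (auto simp: coset_def a_r_coset_def')
  have "i r = 0"
    using order_geD(2)[of i 2 r] I_subset i(1) assms(2) by fastforce
  then show ?thesis
    using i(2) by (simp add: coefficient_def KQ_add)
qed

lemma coefficient_add:
  assumes "X \<in> carrier \<Lambda>" "Y \<in> carrier \<Lambda>" "path_length r < 2"
  shows "coefficient r (X \<oplus>\<^bsub>\<Lambda>\<^esub> Y) = coefficient r X + coefficient r Y"
  using assms by (auto simp: \<Lambda>_carrier coset_hom coefficient_coset I.a_closed path_algebra_simps(2))

text \<open>A stationary path is only a product of stationary paths. A triple such as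
  \<open>(v, [], u)\<close> with \<open>u \<noteq> v\<close> would give further factorisations of
  \<open>(v, [], v)\<close>, but it is not a path, so the elements of the algebra vanish
  there.\<close>

lemma stationary_mult: "(f \<otimes>\<^bsub>KQ\<^esub> g) (v, [], v) = f (v, [], v) * g (v, [], v)"
  if "f \<in> carrier KQ" "g \<in> carrier KQ"
proof (rule path_mult_unique)
  fix p q assume pq: "f p \<noteq> 0" "g q \<noteq> 0" "path_concat p q = Some (v, [], v)"
  obtain u w v' where p: "p = (u, w, v')" by (cases p)
  have "p \<in> paths Q"
    using that(1) pq(1) by (auto simp: path_algebra_simps)
  then show "p = (v, [], v) \<and> q = (v, [], v)"
    using pq(3) by (cases q) (auto simp: p paths_iff split: if_splits)
qed simp

lemma coefficient_stationary_mult: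
  assumes "X \<in> carrier \<Lambda>" "Y \<in> carrier \<Lambda>"
  shows "coefficient (v, [], v) (X \<otimes>\<^bsub>\<Lambda>\<^esub> Y) = coefficient (v, [], v) X * coefficient (v, [], v) Y"
  using assms by (auto simp: \<Lambda>_carrier coset_hom coefficient_coset I.m_closed stationary_mult)

lemma finite_short_paths: "finite {r \<in> paths Q. path_length r < m}"
proof -
  have "{r \<in> paths Q. path_length r < m} \<subseteq>
      verts Q \<times> {w. set w \<subseteq> arcs Q \<and> length w \<le> m} \<times> verts Q"
    by (auto simp: paths_def dest: awalk_last_in_verts)
  then show ?thesis
    by (rule finite_subset) (intro finite_cartesian_product finite_lists_length_le finite_verts finite_arcs)
qed

text \<open>Long paths vanish modulo \<open>I\<close>, so each coset has a representative supported
  on the finitely many paths shorter than \<open>m\<close>. Its values along an enumeration of those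
  paths are the coordinates, by which left ideals of the algebra become coordinate modules.\<close>

lemma coordinates_exist: "\<exists>\<iota> :: (('v, 'e) path \<Rightarrow> 'k) set \<Rightarrow> nat \<Rightarrow> 'k. inj_on \<iota> (carrier \<Lambda>)"
proof -
  obtain m where m: "order_ge m \<subseteq> I"
    by (rule nilpotency_bound)
  let ?S = "{r \<in> paths Q. path_length r < m}"
  obtain h where h: "bij_betw h {0..<card ?S} ?S"
    using ex_bij_betw_nat_finite[OF finite_short_paths] by blast
  have ex: "\<exists>f. f \<in> carrier KQ \<and> X = coset f \<and> {r. f r \<noteq> 0} \<subseteq> ?S" if X: "X \<in> carrier \<Lambda>" for X
  proof -
    obtain f where f: "f \<in> carrier KQ" "X = coset f"
      using X by (auto simp: \<Lambda>_carrier)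
    define g where "g r = (if path_length r < m then f r else 0)" for r
    have g: "g \<in> carrier KQ"
      using f(1) by (auto simp: path_algebra_simps g_def elim!: finite_subset[rotated])
    have "f \<ominus>\<^bsub>KQ\<^esub> g \<in> order_ge m"
      using I.minus_closed[OF f(1) g] by (auto simp: order_ge_def KQ_diff[OF f(1) g] g_def)
    then have "X = coset g"
      using m f g coset_eq_iff by blast
    moreover have "{r. g r \<noteq> 0} \<subseteq> ?S"
      using f(1) by (auto simp: path_algebra_simps g_def)
    ultimately show ?thesis
      using g by blast
  qed
  define rep where "rep X = (SOME f. f \<in> carrier KQ \<and> X = coset f \<and> {r. f r \<noteq> 0} \<subseteq> ?S)" for X
  have rep: "rep X \<in> carrier KQ \<and> X = coset (rep X) \<and> {r. rep X r \<noteq> 0} \<subseteq> ?S" if "X \<in> carrier \<Lambda>" for X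
    unfolding rep_def using ex[OF that] by (rule someI_ex)
  have "inj_on (\<lambda>X n. if n < card ?S then rep X (h n) else 0) (carrier \<Lambda>)"
  proof (rule inj_onI)
    fix X Y assume XY: "X \<in> carrier \<Lambda>" "Y \<in> carrier \<Lambda>"
      and eq: "(\<lambda>n. if n < card ?S then rep X (h n) else 0) = (\<lambda>n. if n < card ?S then rep Y (h n) else 0)"
    have "rep X r = rep Y r" for r
    proof (cases "r \<in> ?S")
      case True
      then have "r \<in> h ` {0..<card ?S}"
        by (simp only: bij_betw_imp_surj_on[OF h])
      then obtain n where "n < card ?S" "r = h n"
        by (elim imageE) simp
      then show ?thesis
        using fun_cong[OF eq, of n] by simp
    next
      case False
      have "rep Z r = 0" if "Z \<in> carrier \<Lambda>" for Z
        using rep[OF that, THEN conjunct2, THEN conjunct2] False by (metis (mono_tags, lifting) mem_Collect_eq subsetD)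
      then show ?thesis
        using XY by simp
    qed
    then have "rep X = rep Y" ..
    moreover have "X = coset (rep X)" "Y = coset (rep Y)"
      using rep XY by blast+
    ultimately show "X = Y"
      by simp
  qed
  then show ?thesis by blast
qed

section \<open>Stationary paths as local idempotents, and the rank\<close>

definition stationary :: "'v \<Rightarrow> ('v, 'e) path \<Rightarrow> 'k" where
  "stationary v = single (v, [], v) 1"

lemma stationary_path: "v \<in> verts Q \<Longrightarrow> (v, [], v) \<in> paths Q"
  by (simp add: paths_iff)

lemma stationary_closed: "v \<in> verts Q \<Longrightarrow> stationary v \<in> carrier KQ"
  unfolding stationary_def by (intro single_closed stationary_path)

lemma single_stationary_left:
  "(single (v, [], v) c \<otimes>\<^bsub>KQ\<^esub> f) r = (if fst r = v then c * f r else 0)"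
proof (cases "fst r = v")
  case True
  then show ?thesis
    by (subst path_mult_unique[of "(v, [], v)" r])
      (cases r, auto simp: single_apply path_concat_eq_Some_iff split: if_splits)+
next
  case False
  have "(single (v, [], v) c \<otimes>\<^bsub>KQ\<^esub> f) r = 0"
  proof (rule ccontr)
    assume "(single (v, [], v) c \<otimes>\<^bsub>KQ\<^esub> f) r \<noteq> 0"
    then show False
      using False by (elim path_mult_nonzero) (auto simp: single_apply path_concat_eq_Some_iff split: if_splits)
  qed
  then show ?thesis
    using False by simp
qed

lemma stationary_idempotent: "stationary v \<otimes>\<^bsub>KQ\<^esub> stationary v = stationary v"
  by (rule ext) (auto simp: stationary_def single_stationary_left single_apply)

lemma coefficient_stationary:
  assumes "u \<in> verts Q" "v \<in> verts Q"
  shows "coefficient (v, [], v) (coset (stationary u)) = (if u = v then 1 else 0)"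
  using assms by (simp add: coefficient_coset stationary_closed) (simp add: stationary_def single_apply)

text \<open>The powers of \<open>f\<close> involve longer and longer paths and end up in
  \<open>I\<close>.\<close>

lemma nilpotent_if_stationary_zero:
  assumes "f \<in> order_ge 1"
  obtains m :: nat where "coset f [^]\<^bsub>\<Lambda>\<^esub> m = \<zero>\<^bsub>\<Lambda>\<^esub>"
proof -
  obtain m where m: "order_ge m \<subseteq> I"
    by (rule nilpotency_bound)
  have f: "f \<in> carrier KQ"
    using assms by (simp add: order_ge_def)
  have "coset f [^]\<^bsub>\<Lambda>\<^esub> k = coset (f [^]\<^bsub>KQ\<^esub> k) \<and> f [^]\<^bsub>KQ\<^esub> k \<in> order_ge k" for k :: nat
  proof (induction k)
    case 0
    then show ?case
      by (simp add: coset_one order_ge_0)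
  next
    case (Suc k)
    then show ?case
      using f order_ge_mult[OF _ assms, of "f [^]\<^bsub>KQ\<^esub> k" k]
      by (simp add: coset_hom I.nat_pow_closed)
  qed
  then have "coset f [^]\<^bsub>\<Lambda>\<^esub> m = \<zero>\<^bsub>\<Lambda>\<^esub>"
    using m coset_eq_zero by (metis subsetD)
  then show thesis
    by (rule that)
qed

text \<open>If \<open>X\<close> has a nonzero coefficient at \<open>v\<close>, a scalar
  \<open>c\<close> makes it 1. Then \<open>n = e - c X\<close> has coefficient zero at every
  stationary path, hence is nilpotent, and \<open>c X = e - n\<close> has a left inverse. If the
  coefficient of \<open>X\<close> is zero, that of \<open>e - X\<close> is 1 and the same applies to
  \<open>e - X\<close>.\<close>

lemma local_idempotent_stationary:
  assumes v: "v \<in> verts Q"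
  shows "local_idempotent \<Lambda> (coset (stationary v))"
  unfolding local_idempotent_def
proof (intro conjI ballI impI)
  let ?e = "coset (stationary v)" and ?co = "coefficient (v, [], v)"
  have sv: "stationary v \<in> carrier KQ"
    using stationary_closed[OF v] .
  show e: "?e \<in> carrier \<Lambda>"
    using coset_closed[OF sv] .
  show ee: "?e \<otimes>\<^bsub>\<Lambda>\<^esub> ?e = ?e"
    by (simp add: coset_hom sv stationary_idempotent)
  have co_e: "?co ?e = 1"
    using coefficient_stationary[OF v v] by simp
  show "?e \<noteq> \<zero>\<^bsub>\<Lambda>\<^esub>"
    using co_e coefficient_coset[of "\<zero>\<^bsub>KQ\<^esub>" "(v, [], v)"] I.zero_closed
    by (auto simp: coset_zero path_algebra_simps(3))
  have unit: "\<exists>b\<in>carrier \<Lambda>. b \<otimes>\<^bsub>\<Lambda>\<^esub> X = ?e"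
    if X: "X \<in> carrier \<Lambda>" "?e \<otimes>\<^bsub>\<Lambda>\<^esub> X = X" "X \<otimes>\<^bsub>\<Lambda>\<^esub> ?e = X" and co: "?co X \<noteq> 0" for X
  proof -
    let ?c = "coset (single (v, [], v) (inverse (?co X)))"
    have sc: "single (v, [], v) (inverse (?co X)) \<in> carrier KQ"
      using single_closed[OF stationary_path[OF v]] .
    have c: "?c \<in> carrier \<Lambda>"
      using coset_closed[OF sc] .
    have "stationary v \<otimes>\<^bsub>KQ\<^esub> single (v, [], v) (inverse (?co X)) = single (v, [], v) (inverse (?co X))"
      by (rule ext) (auto simp: stationary_def single_stationary_left single_apply)
    then have ec: "?e \<otimes>\<^bsub>\<Lambda>\<^esub> ?c = ?c"
      by (simp add: coset_hom sv sc)
    define n where "n = ?e \<ominus>\<^bsub>\<Lambda>\<^esub> ?c \<otimes>\<^bsub>\<Lambda>\<^esub> X"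
    have cX: "?c \<otimes>\<^bsub>\<Lambda>\<^esub> X \<in> carrier \<Lambda>"
      using c X by simp
    have n: "n \<in> carrier \<Lambda>"
      using e cX by (simp add: n_def)
    have ecX: "?e \<otimes>\<^bsub>\<Lambda>\<^esub> (?c \<otimes>\<^bsub>\<Lambda>\<^esub> X) = ?c \<otimes>\<^bsub>\<Lambda>\<^esub> X" "(?c \<otimes>\<^bsub>\<Lambda>\<^esub> X) \<otimes>\<^bsub>\<Lambda>\<^esub> ?e = ?c \<otimes>\<^bsub>\<Lambda>\<^esub> X"
      using e c X ec by (simp_all add: \<Lambda>.m_assoc) (simp flip: \<Lambda>.m_assoc)
    have en: "?e \<otimes>\<^bsub>\<Lambda>\<^esub> n = n" "n \<otimes>\<^bsub>\<Lambda>\<^esub> ?e = n"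
      using e cX ecX ee by (simp_all add: n_def \<Lambda>.minus_eq \<Lambda>.r_distr \<Lambda>.l_distr \<Lambda>.r_minus \<Lambda>.l_minus)
    have n_plus: "n \<oplus>\<^bsub>\<Lambda>\<^esub> ?c \<otimes>\<^bsub>\<Lambda>\<^esub> X = ?e"
      using e cX by (simp add: n_def \<Lambda>.minus_eq \<Lambda>.a_assoc \<Lambda>.l_neg)
    have "?co ?c = inverse (?co X)"
      by (simp add: coefficient_coset sc) (simp add: single_apply)
    then have "?co n + 1 = 1"
      using coefficient_add[OF n cX, of "(v, [], v)"] coefficient_stationary_mult[OF c X(1)] co co_e n_plus
      by simp
    then have co_n: "?co n = 0"
      by simp
    obtain f where f: "f \<in> carrier KQ" "n = coset f"
      using n by (auto simp: \<Lambda>_carrier)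
    have "f (w, [], w) = 0" if w: "w \<in> verts Q" for w
    proof (cases "w = v")
      case True
      then show ?thesis
        using co_n f by (simp add: coefficient_coset)
    next
      case False
      \<comment> \<open>At a vertex \<open>w\<close> other than \<open>v\<close>, the factor
        \<open>e\<close> in \<open>n = e n\<close> has coefficient zero.\<close>
      have "coefficient (w, [], w) n = coefficient (w, [], w) ?e * coefficient (w, [], w) n"
        using coefficient_stationary_mult[OF e n, of w] en(1) by simp
      then show ?thesis
        using False f coefficient_stationary[OF v w] by (simp add: coefficient_coset)
    qed
    moreover have "r = (fst r, [], fst r) \<and> fst r \<in> verts Q" if "f r \<noteq> 0" "path_length r < 1" for r
    proof -
      have "r \<in> paths Q"
        using that(1) f(1) by (auto simp: path_algebra_simps)
      then show ?thesis
        using that(2) by (cases r) (auto simp: paths_iff)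
    qed
    ultimately have "f r = 0" if "path_length r < 1" for r
      using that by metis
    then have "f \<in> order_ge 1"
      using f(1) unfolding order_ge_def by blast
    then obtain m :: nat where "n [^]\<^bsub>\<Lambda>\<^esub> m = \<zero>\<^bsub>\<Lambda>\<^esub>"
      using nilpotent_if_stationary_zero f(2) by blast
    then obtain b where b: "b \<in> carrier \<Lambda>" "b \<otimes>\<^bsub>\<Lambda>\<^esub> (?e \<ominus>\<^bsub>\<Lambda>\<^esub> n) = ?e"
      using idempotent_minus_nilpotent_invertible[OF ring_\<Lambda> e ee n en] by blast
    have "?e \<ominus>\<^bsub>\<Lambda>\<^esub> n = (?c \<otimes>\<^bsub>\<Lambda>\<^esub> X \<oplus>\<^bsub>\<Lambda>\<^esub> n) \<oplus>\<^bsub>\<Lambda>\<^esub> \<ominus>\<^bsub>\<Lambda>\<^esub> n"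
      using n_plus \<Lambda>.a_comm[OF n cX] by (simp add: \<Lambda>.minus_eq)
    also have "\<dots> = ?c \<otimes>\<^bsub>\<Lambda>\<^esub> X"
      using n cX by (simp add: \<Lambda>.a_assoc \<Lambda>.r_neg)
    finally have "(b \<otimes>\<^bsub>\<Lambda>\<^esub> ?c) \<otimes>\<^bsub>\<Lambda>\<^esub> X = ?e"
      using b c X by (simp add: \<Lambda>.m_assoc)
    then show ?thesis
      using b(1) c by blast
  qed
  fix X assume X: "X \<in> carrier \<Lambda>" "?e \<otimes>\<^bsub>\<Lambda>\<^esub> X = X \<and> X \<otimes>\<^bsub>\<Lambda>\<^esub> ?e = X"
  show "\<exists>b\<in>carrier \<Lambda>. b \<otimes>\<^bsub>\<Lambda>\<^esub> X = ?e \<or> b \<otimes>\<^bsub>\<Lambda>\<^esub> (?e \<ominus>\<^bsub>\<Lambda>\<^esub> X) = ?e"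
  proof (cases "?co X = 0")
    case False
    then show ?thesis
      using unit[OF X(1)] X(2) by blast
  next
    case True
    let ?Y = "?e \<ominus>\<^bsub>\<Lambda>\<^esub> X"
    have Y: "?Y \<in> carrier \<Lambda>"
      using e X by simp
    have "?Y \<oplus>\<^bsub>\<Lambda>\<^esub> X = ?e"
      using e X by (simp add: \<Lambda>.minus_eq \<Lambda>.a_assoc \<Lambda>.l_neg)
    then have "?co ?Y = 1"
      using coefficient_add[OF Y X(1), of "(v, [], v)"] True co_e by simp
    moreover have "?e \<otimes>\<^bsub>\<Lambda>\<^esub> ?Y = ?Y" "?Y \<otimes>\<^bsub>\<Lambda>\<^esub> ?e = ?Y"
      using e X ee by (simp_all add: \<Lambda>.minus_eq \<Lambda>.r_distr \<Lambda>.l_distr \<Lambda>.r_minus \<Lambda>.l_minus)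
    ultimately show ?thesis
      using unit[OF Y] by auto
  qed
qed

text \<open>For \<open>u \<noteq> v\<close>, an isomorphism of the two projectives gives
  \<open>e_u = a b\<close> with \<open>a e_v = a\<close>. The coefficient at \<open>u\<close> is
  multiplicative and vanishes on \<open>e_v\<close>, hence on \<open>a\<close> and on
  \<open>e_u\<close>; but its value on \<open>e_u\<close> is one.\<close>

lemma one_vertex_if_rank_1:
  assumes "algebra_rank \<Lambda> = 1"
  obtains v where "verts Q = {v}"
proof -
  let ?C = "indecomposable_projectives \<Lambda>"
  have left: "left_module \<Lambda> M" if "M \<in> ?C" for M
    using that by (simp add: indecomposable_projectives_def indecomposables_def fg_module_def)
  have rank: "card (iso_classes \<Lambda> ?C) = 1"
    using assms by (simp add: algebra_rank_def)
  note one = card_iso_classes_eq_1D[OF left rank]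
  \<comment> \<open>Without vertices the algebra is zero, and a module over it is zero and not
    indecomposable; yet rank 1 provides an indecomposable module.\<close>
  have "verts Q \<noteq> {}"
  proof
    assume "verts Q = {}"
    then have "\<one>\<^bsub>KQ\<^esub> = \<zero>\<^bsub>KQ\<^esub>"
      by (auto simp: path_algebra_simps)
    then have 10: "\<one>\<^bsub>\<Lambda>\<^esub> = \<zero>\<^bsub>\<Lambda>\<^esub>"
      by (simp add: coset_one coset_zero)
    obtain P where P: "P \<in> ?C"
      using one(1) by blast
    interpret P: left_module \<Lambda> P
      using left[OF P] .
    have "x = \<zero>\<^bsub>P\<^esub>" if "x \<in> carrier P" for x
      using P.smult_one[OF that] P.smult_zero_left[OF that] 10 by simp
    then have "carrier P = {\<zero>\<^bsub>P\<^esub>}"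
      using P.M.zero_closed by blast
    then show False
      using P by (simp add: indecomposable_projectives_def indecomposables_def indecomposable_def)
  qed
  moreover have "u = v" if u: "u \<in> verts Q" and v: "v \<in> verts Q" for u v
  proof (rule ccontr)
    assume uv: "u \<noteq> v"
    let ?e = "\<lambda>w. coset (stationary w)"
    obtain \<iota> :: "(('v, 'e) path \<Rightarrow> 'k) set \<Rightarrow> nat \<Rightarrow> 'k" where \<iota>: "inj_on \<iota> (carrier \<Lambda>)"
      using coordinates_exist by blast
    have ex: "\<exists>P y. principal_module \<Lambda> P (?e w) y \<and> P \<in> ?C" if w: "w \<in> verts Q" for w
    proof -
      have "?e w \<in> carrier \<Lambda>" "?e w \<otimes>\<^bsub>\<Lambda>\<^esub> ?e w = ?e w"
        using local_idempotent_stationary[OF w] by (auto simp: local_idempotent_def)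
      then obtain P :: "('k, (('v, 'e) path \<Rightarrow> 'k) set) coord_module" and y where
        P: "principal_module \<Lambda> P (?e w) y"
        using principal_module_exists[OF ring_\<Lambda> \<iota>] by blast
      then show ?thesis
        using principal_module_indecomposable_projective[OF P local_idempotent_stationary[OF w]] by blast
    qed
    obtain P y P' y' where P: "principal_module \<Lambda> P (?e u) y" "P \<in> ?C"
      "principal_module \<Lambda> P' (?e v) y'" "P' \<in> ?C"
      using ex[OF u] ex[OF v] by blast
    have "module_iso \<Lambda> P P'"
      by (rule one(2)[OF _ P(2) P(4)])
    then obtain a b where ab: "a \<in> carrier \<Lambda>" "b \<in> carrier \<Lambda>" "a \<otimes>\<^bsub>\<Lambda>\<^esub> ?e v = a" "a \<otimes>\<^bsub>\<Lambda>\<^esub> b = ?e u"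
      by (rule principal_module.isomorphic_imp_factors[OF P(1) P(3)]) (rule that)
    let ?co = "coefficient (u, [], u)"
    have "?co a = ?co a * ?co (?e v)"
      using coefficient_stationary_mult[OF ab(1) coset_closed[OF stationary_closed[OF v]], of u] ab(3) by simp
    then have "?co a = 0"
      using coefficient_stationary[OF v u] uv by simp
    then have "?co (?e u) = 0"
      using coefficient_stationary_mult[OF ab(1,2), of u] ab(4) by simp
    then show False
      using coefficient_stationary[OF u u] by simp
  qed
  ultimately show thesis
    using that by blast
qed

end

section \<open>Quivers with one vertex\<close>

locale one_vertex_quiver = bound_quiver Q I
    for Q :: "('v, 'e) pre_digraph" and I :: "(('v, 'e) path \<Rightarrow> 'k::field) set" +
  fixes v :: 'v
  assumes one_vertex: "verts Q = {v}"
begin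

lemma arc_ends: "a \<in> arcs Q \<Longrightarrow> tail Q a = v" "a \<in> arcs Q \<Longrightarrow> head Q a = v"
  using tail_in_verts head_in_verts one_vertex by auto

lemma cas_loops: "set w \<subseteq> arcs Q \<Longrightarrow> cas u w u' \<longleftrightarrow> (if w = [] then u = u' else u = v \<and> u' = v)"
  by (induction w arbitrary: u) (auto simp: arc_ends)

lemma paths_loops: "r \<in> paths Q \<longleftrightarrow> (\<exists>w. set w \<subseteq> arcs Q \<and> r = (v, w, v))"
  by (cases r) (auto simp: paths_iff one_vertex cas_loops split: if_splits)

lemma KQ_vanishes: "f \<in> carrier KQ \<Longrightarrow> r \<notin> paths Q \<Longrightarrow> f r = 0"
  by (auto simp: path_algebra_simps)

text \<open>With one vertex the paths are the words in the arrows, and the factorisations of a word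
  are its splittings into a prefix and a suffix.\<close>

lemma path_mult_loops:
  assumes f: "f \<in> carrier KQ" and g: "g \<in> carrier KQ"
  shows "(f \<otimes>\<^bsub>KQ\<^esub> g) (v, w, v) = (\<Sum>i\<le>length w. f (v, take i w, v) * g (v, drop i w, v))"
proof -
  let ?S = "{(p, q). f p \<noteq> 0 \<and> g q \<noteq> 0 \<and> path_concat p q = Some (v, w, v)}"
  let ?h = "\<lambda>i. ((v, take i w, v), (v, drop i w, v))"
  have inj: "inj_on ?h {..length w}"
  proof (rule inj_onI)
    fix i j assume ij: "i \<in> {..length w}" "j \<in> {..length w}" "?h i = ?h j"
    then have "length (take i w) = length (take j w)"
      by simp
    then show "i = j"
      using ij by simp
  qed
  have "?S \<subseteq> ?h ` {..length w}"
  proof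
    fix z assume "z \<in> ?S"
    then obtain p q where z: "z = (p, q)" "f p \<noteq> 0" "g q \<noteq> 0" "path_concat p q = Some (v, w, v)"
      by auto
    then have "p \<in> paths Q" "q \<in> paths Q"
      using KQ_vanishes f g by blast+
    then obtain w1 w2 where w: "p = (v, w1, v)" "q = (v, w2, v)"
      by (auto simp: paths_loops)
    then have "w = w1 @ w2"
      using z(4) by simp
    then show "z \<in> ?h ` {..length w}"
      using z(1) w by (intro image_eqI[of _ _ "length w1"]) auto
  qed
  then have "(f \<otimes>\<^bsub>KQ\<^esub> g) (v, w, v) = (\<Sum>(p, q)\<in>?h ` {..length w}. f p * g q)"
    unfolding path_algebra_simps by (intro sum.mono_neutral_left) auto
  also have "\<dots> = (\<Sum>i\<le>length w. f (v, take i w, v) * g (v, drop i w, v))"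
    by (subst sum.reindex[OF inj]) simp
  finally show ?thesis .
qed

lemma coefficient_arrow_mult:
  assumes "X \<in> carrier \<Lambda>" "Y \<in> carrier \<Lambda>"
  shows "coefficient (v, [a], v) (X \<otimes>\<^bsub>\<Lambda>\<^esub> Y)
    = coefficient (v, [], v) X * coefficient (v, [a], v) Y + coefficient (v, [a], v) X * coefficient (v, [], v) Y"
  using assms by (auto simp: \<Lambda>_carrier coset_hom coefficient_coset I.m_closed path_mult_loops)

text \<open>The stationary path and the two arrows supply the three coefficients; all other paths
  are sent to zero. The product formula at an arrow holds because a word of one letter has only two
  splittings.\<close>

lemma kronecker_quotient_if_two_arrows:
  assumes ab: "a \<in> arcs Q" "b \<in> arcs Q" "a \<noteq> b"
  shows "kronecker_quotient \<Lambda> (coefficient (v, [], v)) (coefficient (v, [a], v)) (coefficient (v, [b], v))"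
proof (intro kronecker_quotient.intro ring_\<Lambda> kronecker_quotient_axioms.intro)
  have one: "\<one>\<^bsub>KQ\<^esub> \<in> carrier KQ"
    by simp
  show "coefficient (v, [], v) \<one>\<^bsub>\<Lambda>\<^esub> = 1" "coefficient (v, [a], v) \<one>\<^bsub>\<Lambda>\<^esub> = 0"
    "coefficient (v, [b], v) \<one>\<^bsub>\<Lambda>\<^esub> = 0"
    using one by (simp_all add: coset_one coefficient_coset) (simp_all add: path_algebra_simps(5) one_vertex)
  fix r s t
  define f where "f = single (v, [], v) r \<oplus>\<^bsub>KQ\<^esub> (single (v, [a], v) s \<oplus>\<^bsub>KQ\<^esub> single (v, [b], v) t)"
  have "f \<in> carrier KQ"
    unfolding f_def using ab by (intro I.a_closed single_closed) (auto simp: paths_loops)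
  then show "\<exists>X\<in>carrier \<Lambda>. coefficient (v, [], v) X = r \<and> coefficient (v, [a], v) X = s \<and> coefficient (v, [b], v) X = t"
    using ab(3) by (intro bexI[of _ "coset f"])
      (auto simp: coefficient_coset coset_closed f_def KQ_add single_apply)
qed (simp_all add: coefficient_add coefficient_stationary_mult coefficient_arrow_mult)

text \<open>The image of the variable is the sum of the arrows.\<close>

definition eval_arrows :: "'k poly \<Rightarrow> ('v, 'e) path \<Rightarrow> 'k" where
  "eval_arrows p r = (if r \<in> paths Q then coeff p (path_length r) else 0)"

lemma eval_arrows_closed: "eval_arrows p \<in> carrier KQ"
proof -
  have "{r. eval_arrows p r \<noteq> 0} \<subseteq> {r \<in> paths Q. path_length r < Suc (degree p)}"
    by (auto simp: eval_arrows_def less_Suc_eq_le le_degree split: if_splits)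
  then show ?thesis
    using finite_subset[OF _ finite_short_paths] by (auto simp: path_algebra_simps)
qed

lemma eval_arrows_add: "eval_arrows (p + q) = eval_arrows p \<oplus>\<^bsub>KQ\<^esub> eval_arrows q"
  by (auto simp: KQ_add eval_arrows_def)

text \<open>Coefficients depend only on the length of a path, so the sum over the splittings of a
  word is the Cauchy product of the coefficients.\<close>

lemma eval_arrows_mult: "eval_arrows (p * q) = eval_arrows p \<otimes>\<^bsub>KQ\<^esub> eval_arrows q"
proof
  fix r
  show "eval_arrows (p * q) r = (eval_arrows p \<otimes>\<^bsub>KQ\<^esub> eval_arrows q) r"
  proof (cases "r \<in> paths Q")
    case False
    then show ?thesis
      using KQ_vanishes[OF I.m_closed[OF eval_arrows_closed eval_arrows_closed]] by (simp add: eval_arrows_def)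
  next
    case True
    then obtain w where w: "set w \<subseteq> arcs Q" "r = (v, w, v)"
      by (auto simp: paths_loops)
    have "(v, take i w, v) \<in> paths Q" "(v, drop i w, v) \<in> paths Q" for i
      using w(1) set_take_subset[of i w] set_drop_subset[of i w] by (auto simp: paths_loops)
    then have "(\<Sum>i\<le>length w. eval_arrows p (v, take i w, v) * eval_arrows q (v, drop i w, v))
        = (\<Sum>i\<le>length w. coeff p i * coeff q (length w - i))"
      by (intro sum.cong) (auto simp: eval_arrows_def min_def)
    then show ?thesis
      using True by (simp add: w(2) path_mult_loops eval_arrows_closed coeff_mult) (simp add: eval_arrows_def coeff_mult)
  qed
qed

lemma eval_arrows_const: "eval_arrows [:c:] = single (v, [], v) c"
  by (auto simp: eval_arrows_def single_apply paths_loops coeff_pCons split: nat.split)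

lemma eval_arrows_1: "eval_arrows 1 = \<one>\<^bsub>KQ\<^esub>"
  by (rule ext) (auto simp: eval_arrows_def path_algebra_simps(5) paths_iff one_vertex)

text \<open>Scalar multiplication in the quotient is a union over the members of a coset. Each
  member contributes the same coset, because multiplication by \<open>c\<close> is multiplication by
  \<open>c\<close> times the only stationary path and so preserves \<open>I\<close>.\<close>

lemma coset_scalar: "coset (eval_arrows [:c:]) = c \<odot>\<^bsub>\<Lambda>\<^esub> \<one>\<^bsub>\<Lambda>\<^esub>"
proof -
  let ?c = "eval_arrows [:c:]"
  have smult: "c \<odot>\<^bsub>KQ\<^esub> f = ?c \<otimes>\<^bsub>KQ\<^esub> f" if f: "f \<in> carrier KQ" for f
  proof
    fix r
    show "(c \<odot>\<^bsub>KQ\<^esub> f) r = (?c \<otimes>\<^bsub>KQ\<^esub> f) r"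
    proof (cases "fst r = v")
      case False
      then have "f r = 0"
        by (intro KQ_vanishes[OF f]) (auto simp: paths_loops)
      then show ?thesis
        by (simp add: path_algebra_simps(4) eval_arrows_const single_stationary_left)
    qed (simp add: path_algebra_simps(4) eval_arrows_const single_stationary_left)
  qed
  have "I +>\<^bsub>KQ\<^esub> (c \<odot>\<^bsub>KQ\<^esub> f) = coset ?c" if fc: "f \<in> coset \<one>\<^bsub>KQ\<^esub>" for f
  proof -
    obtain i where i: "i \<in> I" "f = i \<oplus>\<^bsub>KQ\<^esub> \<one>\<^bsub>KQ\<^esub>"
      using fc by (auto simp: coset_def a_r_coset_def')
    have iK: "i \<in> carrier KQ"
      using i(1) I.a_subset by blast
    have ci: "?c \<otimes>\<^bsub>KQ\<^esub> i \<in> I"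
      using I.I_l_closed[OF i(1) eval_arrows_closed] .
    have fK: "f \<in> carrier KQ"
      using i iK by simp
    have "?c \<otimes>\<^bsub>KQ\<^esub> f \<ominus>\<^bsub>KQ\<^esub> ?c = ?c \<otimes>\<^bsub>KQ\<^esub> i"
      using iK eval_arrows_closed[of "[:c:]"] by (simp add: i(2) I.r_distr I.minus_eq I.a_assoc I.r_neg)
    then have "coset (?c \<otimes>\<^bsub>KQ\<^esub> f) = coset ?c"
      using ci fK eval_arrows_closed by (subst coset_eq_iff) auto
    then show ?thesis
      by (simp add: smult[OF fK] coset_def)
  qed
  moreover have "\<one>\<^bsub>KQ\<^esub> \<in> coset \<one>\<^bsub>KQ\<^esub>"
    using I.a_rcos_self[of "\<one>\<^bsub>KQ\<^esub>"] by (simp add: coset_def)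
  ultimately have "(\<Union>f\<in>coset \<one>\<^bsub>KQ\<^esub>. I +>\<^bsub>KQ\<^esub> (c \<odot>\<^bsub>KQ\<^esub> f)) = coset ?c"
    by auto
  then show ?thesis
    by (simp add: bound_path_algebra_def quotient_algebra_def FactRing_def coset_def)
qed

text \<open>A path is determined by its length here, which makes the evaluation surjective. A quiver
  without arrows is included: the variable is then sent to zero.\<close>

lemma truncated_polynomial_ring_if_one_arrow:
  assumes unique: "\<And>a b. a \<in> arcs Q \<Longrightarrow> b \<in> arcs Q \<Longrightarrow> a = b"
  obtains m where "truncated_polynomial_ring \<Lambda> (\<lambda>p. coset (eval_arrows p)) m"
proof -
  obtain m where m: "order_ge m \<subseteq> I"
    by (rule nilpotency_bound)
  have path_unique: "r = r'" if r: "r \<in> paths Q" "r' \<in> paths Q" "path_length r = path_length r'" for r r'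
  proof -
    obtain w w' where w: "set w \<subseteq> arcs Q" "r = (v, w, v)" "set w' \<subseteq> arcs Q" "r' = (v, w', v)"
      using r(1,2) by (auto simp: paths_loops)
    have "w ! i = w' ! i" if "i < length w" for i
    proof (rule unique)
      show "w ! i \<in> arcs Q" "w' ! i \<in> arcs Q"
        using that w r(3) subsetD[OF w(1) nth_mem[of i w]] subsetD[OF w(3) nth_mem[of i w']] by auto
    qed
    then show ?thesis
      using w r(3) by (auto intro: nth_equalityI)
  qed
  have "truncated_polynomial_ring \<Lambda> (\<lambda>p. coset (eval_arrows p)) m"
  proof (intro truncated_polynomial_ring.intro ring_\<Lambda> truncated_polynomial_ring_axioms.intro)
    fix p q
    show "coset (eval_arrows p) \<in> carrier \<Lambda>"
      by (intro coset_closed eval_arrows_closed)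
    show "coset (eval_arrows (p + q)) = coset (eval_arrows p) \<oplus>\<^bsub>\<Lambda>\<^esub> coset (eval_arrows q)"
      "coset (eval_arrows (p * q)) = coset (eval_arrows p) \<otimes>\<^bsub>\<Lambda>\<^esub> coset (eval_arrows q)"
      by (simp_all add: eval_arrows_add eval_arrows_mult coset_hom eval_arrows_closed)
    show "coset (eval_arrows 1) = \<one>\<^bsub>\<Lambda>\<^esub>"
      by (simp add: eval_arrows_1 coset_one)
    show "coeff p 0 = coeff q 0" if eq: "coset (eval_arrows p) = coset (eval_arrows q)"
    proof -
      have "coefficient (v, [], v) (coset (eval_arrows s)) = coeff s 0" for s
        by (simp add: coefficient_coset eval_arrows_closed) (simp add: eval_arrows_def paths_loops)
      then show ?thesis
        using eq by metis
    qed
  next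
    show "coset (eval_arrows [:c:]) = c \<odot>\<^bsub>\<Lambda>\<^esub> \<one>\<^bsub>\<Lambda>\<^esub>" for c
      by (rule coset_scalar)
    have "eval_arrows (monom 1 m) \<in> order_ge m"
      using eval_arrows_closed[of "monom 1 m"] by (auto simp: order_ge_def eval_arrows_def)
    then show "coset (eval_arrows (monom 1 m)) = \<zero>\<^bsub>\<Lambda>\<^esub>"
      using m coset_eq_zero by blast
    fix X assume "X \<in> carrier \<Lambda>"
    then obtain f where f: "f \<in> carrier KQ" "X = coset f"
      by (auto simp: \<Lambda>_carrier)
    \<comment> \<open>Distinct paths have distinct lengths, so no two terms of this sum share a
      degree.\<close>
    define p where "p = (\<Sum>r | f r \<noteq> 0. monom (f r) (path_length r))"
    have fin: "finite {r. f r \<noteq> 0}"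
      using f(1) by (simp add: path_algebra_simps)
    have "eval_arrows p r = f r" for r
    proof (cases "r \<in> paths Q")
      case True
      have "coeff p (path_length r) = (\<Sum>r' | f r' \<noteq> 0. if r' = r then f r' else 0)"
        unfolding p_def coeff_sum
      proof (intro sum.cong refl)
        fix r' assume "r' \<in> {r. f r \<noteq> 0}"
        then have "r' \<in> paths Q"
          using KQ_vanishes[OF f(1)] by blast
        then show "coeff (monom (f r') (path_length r')) (path_length r) = (if r' = r then f r' else 0)"
          using path_unique[OF _ True] by auto
      qed
      also have "\<dots> = f r"
        using fin by simp
      finally show ?thesis
        using True by (simp add: eval_arrows_def)
    next
      case False
      then show ?thesis
        using KQ_vanishes[OF f(1)] by (simp add: eval_arrows_def)
    qed
    then have "X = coset (eval_arrows p)"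
      using f(2) by (metis ext)
    then show "\<exists>p. X = coset (eval_arrows p)" ..
  qed
  then show thesis
    by (rule that)
qed

end

theorem corollary4p8:
  fixes Q :: "('v, 'e) pre_digraph"
    and I :: "(('v, 'e) path \<Rightarrow> 'k::field) set"
  assumes "fin_digraph Q"
    and "admissible_ideal Q I"
    and "representation_finite (bound_path_algebra Q I)"
    and "algebra_rank (bound_path_algebra Q I) = 1"
  shows "module_category_magnitude (bound_path_algebra Q I) = Some 1"
proof -
  interpret bound_quiver Q I
    using assms by (intro bound_quiver.intro bound_quiver_axioms.intro)
  obtain v where v: "verts Q = {v}"
    using one_vertex_if_rank_1[OF assms(4)] by blast
  interpret one_vertex_quiver Q I v
    by unfold_locales (rule v)
  have "a = b" if "a \<in> arcs Q" "b \<in> arcs Q" for a b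
    using kronecker_quotient.not_representation_finite[OF kronecker_quotient_if_two_arrows[OF that]] assms(3)
    by blast
  then obtain m where "truncated_polynomial_ring (bound_path_algebra Q I) (\<lambda>p. coset (eval_arrows p)) m"
    using truncated_polynomial_ring_if_one_arrow by blast
  then show ?thesis
    using assms(3) by (rule truncated_polynomial_ring.module_category_magnitude_eq_1)
qed

end
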